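(* Let $d\in\mathbb{N}$ and let $s,t$ be real numbers with $t\le s<(d+1)/2$. Then the pair $(B^s_{\mathbf 1},B^t_{\mathbf 1})$ of weighted Besov spaces on $\mathbb{B}_d$ satisfies the multiplier inclusion condition.
   Context: $\mathbb{B}_d$ is the open unit ball of $\mathbb{C}^d$ and $V$ is Lebesgue measure on $\mathbb{B}_d$ normalized so that $V(\mathbb{B}_d)=1$. For $s\in\mathbb{R}$, $B^s_{\mathbf 1}$ is the Hilbert space of all $f\in\operatorname{Hol}(\mathbb{B}_d)$ with $\|f\|^2_{B^s_{\mathbf 1}}=\|f_0\|^2_{L^2_a}+\sum_{n\ge1}n^{2s}\|f_n\|^2_{L^2_a}<\infty$, where $f=\sum_{n\ge0}f_n$ is the expansion into homogeneous polynomials $f_n$ of degree $n$ and $L^2_a=L^2(V)\cap\operatorname{Hol}(\mathbb{B}_d)$. (For $s<(d+1)/2$ it coincides, with equivalence of norms, with the Hilbert function space on $\mathbb{B}_d$ with reproducing kernel $(1-\langle z,w\rangle)^{-(d+1-2s)}$; $s=d/2$ gives the Drury-Arveson space.) A non-negative integrable function $\omega$ on $\mathbb{B}_d$ is an admissible weight if $L^2_a(\omega)=L^2(\omega\,dV)\cap\operatorname{Hol}(\mathbb{B}_d)$ is closed in $L^2(\omega\,dV)$ and point evaluations are bounded on $L^2_a(\omega)$ for each $z\in\mathbb{B}_d$. Let $R=\sum_{i=1}^dz_i\frac{\partial}{\partial z_i}$. For a positive integer $N$ let $B^N_\omega=\{f\in\operatorname{Hol}(\mathbb{B}_d):R^Nf\in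 L^2_a(\omega)\}$ with norm $\|f\|^2_{B^N_\omega}=\|\omega\|_{L^1(V)}|f(0)|^2+\int_{\mathbb{B}_d}|R^Nf|^2\omega\,dV$, and let $B^0_\omega=L^2_a(\omega)$. A weighted Besov space is a Hilbert space of analytic functions on $\mathbb{B}_d$ equal, with equivalence of norms, to $B^N_\omega$ for some admissible $\omega$ and some integer $N\ge0$. For Hilbert spaces $\mathcal{H},\mathcal{K}$ of analytic functions on $\mathbb{B}_d$, $\operatorname{Mult}(\mathcal{H},\mathcal{K}(\ell_2))$ is the space of functions $\Phi=(\varphi_1,\varphi_2,\dots):\mathbb{B}_d\to\ell_2$ for which $h\mapsto(\varphi_1h,\varphi_2h,\dots)$ is a bounded operator $\mathcal{H}\to\bigoplus_{n=1}^\infty\mathcal{K}$, normed by the operator norm. A pair $(\mathcal{H},\mathcal{K})$ of weighted Besov spaces satisfies the multiplier inclusion condition if there are admissible weights $\omega,\tilde\omega$ and $N\in\mathbb{N}$ such that $\mathcal{H}=B^N_\omega$, $\mathcal{K}=B^N_{\tilde\omega}$ (equivalent norms) and $$\operatorname{Mult}(B^N_\omega,B^N_{\tilde\omega}(\ell_2))\subseteq\operatorname{Mult}(B^{N-1}_\omega,B^{N-1}_{\tilde\omega}(\ell_2))\subseteq\cdots\subseteq\operatorname{Mult}(B^0_\omega,B^0_{\tilde\omega}(\ell_2))$$ with continuous inclusions, i.e. for each $1\le n\le N$ there is $c>0$ with $\|\Phi\|_{\operatorname{Mult}(B^{n-1}_\omega,B^{n-1}_{\tilde\omega}(\ell_2))}\le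 c\|\Phi\|_{\operatorname{Mult}(B^n_\omega,B^n_{\tilde\omega}(\ell_2))}$ for all $\Phi\in\operatorname{Mult}(B^n_\omega,B^n_{\tilde\omega}(\ell_2))$. *)

theory Defs
  imports "HOL-Analysis.Analysis"
begin

text \<open>
  Functions on the unit ball of \<open>\<complex>\<^sup>d\<close>, \<open>d = CARD('d)\<close>, are represented by total functions on
  \<^typ>\<open>complex ^ 'd\<close> whose values off the ball are irrelevant: two such functions are to be
  identified when they agree on the ball.
\<close>

abbreviation unit_ball :: "(complex ^ 'd) set"
  where "unit_ball \<equiv> ball 0 1"

definition V :: "(complex ^ 'd) measure"
  where "V = uniform_measure (lebesgue_on unit_ball) unit_ball"

definition Hol :: "(complex ^ 'd \<Rightarrow> complex) set"
  where "Hol = {f. \<forall>z\<in>unit_ball. \<exists>D. (f has_derivative D) (at z) \<and> (\<forall>c v. D (c *s v) = c * D v)}"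

record 'd fn_space =
  funs :: "(complex ^ 'd \<Rightarrow> complex) set"
  fnorm :: "(complex ^ 'd \<Rightarrow> complex) \<Rightarrow> real"

definition L2 :: "(complex ^ 'd \<Rightarrow> real) \<Rightarrow> (complex ^ 'd \<Rightarrow> complex) set"
  where "L2 \<omega> = {f \<in> borel_measurable V. integrable V (\<lambda>z. (cmod (f z))\<^sup>2 * \<omega> z)}"

definition L2_norm :: "(complex ^ 'd \<Rightarrow> real) \<Rightarrow> (complex ^ 'd \<Rightarrow> complex) \<Rightarrow> real"
  where "L2_norm \<omega> f = sqrt (LINT z|V. (cmod (f z))\<^sup>2 * \<omega> z)"

definition L2a :: "(complex ^ 'd \<Rightarrow> real) \<Rightarrow> (complex ^ 'd \<Rightarrow> complex) set"
  where "L2a \<omega> = L2 \<omega> \<inter> Hol"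

text \<open>
  The elements of \<open>L\<^sup>2(\<omega> dV)\<close> are classes modulo equality \<open>\<omega> dV\<close>-almost everywhere, so closedness
  of \<open>L2a \<omega>\<close> says that every \<open>L\<^sup>2\<close>-limit of a sequence in \<open>L2a \<omega>\<close> has a representative in \<open>L2a \<omega>\<close>.
\<close>

definition admissible_weight :: "(complex ^ 'd \<Rightarrow> real) \<Rightarrow> bool"
  where "admissible_weight \<omega> \<longleftrightarrow>
    (\<forall>z\<in>unit_ball. 0 \<le> \<omega> z) \<and> integrable V \<omega> \<and>
    (\<forall>F. \<forall>g\<in>L2 \<omega>.
       (\<forall>k::nat. F k \<in> L2a \<omega>) \<and> (\<lambda>k. L2_norm \<omega> (\<lambda>z. F k z - g z)) \<longlonglongrightarrow> 0 \<longrightarrow>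
       (\<exists>f\<in>L2a \<omega>. AE z in density V (\<lambda>z. ennreal (\<omega> z)). f z = g z)) \<and>
    (\<forall>z\<in>unit_ball. \<exists>C. \<forall>f\<in>L2a \<omega>. cmod (f z) \<le> C * L2_norm \<omega> f)"

definition partial_deriv :: "'d \<Rightarrow> (complex ^ 'd \<Rightarrow> complex) \<Rightarrow> complex ^ 'd \<Rightarrow> complex"
  where "partial_deriv i f z = deriv (\<lambda>w. f (z + axis i w)) 0"

definition radial_deriv :: "(complex ^ 'd \<Rightarrow> complex) \<Rightarrow> complex ^ 'd \<Rightarrow> complex"
  where "radial_deriv f z = (\<Sum>i\<in>UNIV. z $ i * partial_deriv i f z)"

definition besov :: "nat \<Rightarrow> (complex ^ 'd \<Rightarrow> real) \<Rightarrow> 'd fn_space"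
  where "besov N \<omega> =
    (if N = 0 then \<lparr>funs = L2a \<omega>, fnorm = L2_norm \<omega>\<rparr>
     else \<lparr>funs = {f \<in> Hol. (radial_deriv ^^ N) f \<in> L2a \<omega>},
           fnorm = (\<lambda>f. sqrt ((LINT z|V. \<omega> z) * (cmod (f 0))\<^sup>2 +
                              (LINT z|V. (cmod ((radial_deriv ^^ N) f z))\<^sup>2 * \<omega> z)))\<rparr>)"

definition equal_equiv_norms :: "'d::finite fn_space \<Rightarrow> 'd fn_space \<Rightarrow> bool"
  where "equal_equiv_norms H K \<longleftrightarrow> funs H = funs K \<and>
    (\<exists>a>0. \<exists>b>0. \<forall>f\<in>funs H. a * fnorm K f \<le> fnorm H f \<and> fnorm H f \<le> b * fnorm K f)"

definition hilbert_analytic_space :: "'d::finite fn_space \<Rightarrow> bool"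
  where "hilbert_analytic_space H \<longleftrightarrow>
    funs H \<subseteq> Hol \<and> (\<lambda>z. 0) \<in> funs H \<and>
    (\<forall>f\<in>funs H. \<forall>g\<in>funs H. (\<lambda>z. f z + g z) \<in> funs H) \<and>
    (\<forall>c. \<forall>f\<in>funs H. (\<lambda>z. c * f z) \<in> funs H) \<and>
    (\<exists>ip :: (complex ^ 'd \<Rightarrow> complex) \<Rightarrow> (complex ^ 'd \<Rightarrow> complex) \<Rightarrow> complex.
       (\<forall>f\<in>funs H. \<forall>g\<in>funs H. \<forall>h\<in>funs H. ip (\<lambda>z. f z + g z) h = ip f h + ip g h) \<and>
       (\<forall>c. \<forall>f\<in>funs H. \<forall>h\<in>funs H. ip (\<lambda>z. c * f z) h = c * ip f h) \<and>
       (\<forall>f\<in>funs H. \<forall>g\<in>funs H. ip g f = cnj (ip f g)) \<and>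
       (\<forall>f\<in>funs H. 0 \<le> fnorm H f \<and> ip f f = complex_of_real ((fnorm H f)\<^sup>2))) \<and>
    (\<forall>f\<in>funs H. fnorm H f = 0 \<longleftrightarrow> (\<forall>z\<in>unit_ball. f z = 0)) \<and>
    (\<forall>F :: nat \<Rightarrow> complex ^ 'd \<Rightarrow> complex.
       (\<forall>k. F k \<in> funs H) \<and>
       (\<forall>e>0. \<exists>M. \<forall>k\<ge>M. \<forall>l\<ge>M. fnorm H (\<lambda>z. F k z - F l z) < e) \<longrightarrow>
       (\<exists>f\<in>funs H. (\<lambda>k. fnorm H (\<lambda>z. F k z - f z)) \<longlonglongrightarrow> 0))"

definition weighted_besov_space :: "'d::finite fn_space \<Rightarrow> bool"
  where "weighted_besov_space H \<longleftrightarrow> hilbert_analytic_space H \<and>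
    (\<exists>N \<omega>. admissible_weight \<omega> \<and> equal_equiv_norms H (besov N \<omega>))"

definition homogeneous_poly :: "nat \<Rightarrow> (complex ^ 'd \<Rightarrow> complex) \<Rightarrow> bool"
  where "homogeneous_poly n p \<longleftrightarrow>
    (\<exists>c :: ('d \<Rightarrow> nat) \<Rightarrow> complex.
       p = (\<lambda>z. \<Sum>\<alpha> | (\<Sum>i\<in>UNIV. \<alpha> i) = n. c \<alpha> * (\<Prod>i\<in>UNIV. z $ i ^ \<alpha> i)))"

text \<open>The homogeneous expansion of a function in \<^const>\<open>Hol\<close> exists and is unique, also as a
  sequence of functions on all of \<open>\<complex>\<^sup>d\<close>, because homogeneous polynomials that agree on the ball are equal.\<close>

definition hom_expansion :: "(complex ^ 'd \<Rightarrow> complex) \<Rightarrow> nat \<Rightarrow> complex ^ 'd \<Rightarrow> complex"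
  where "hom_expansion f =
    (THE p. (\<forall>n. homogeneous_poly n (p n)) \<and> (\<forall>z\<in>unit_ball. (\<lambda>n. p n z) sums f z))"

definition B1 :: "real \<Rightarrow> 'd::finite fn_space"
  where "B1 s =
    \<lparr>funs = {f \<in> Hol. summable (\<lambda>n. real (Suc n) powr (2 * s) *
                                    (L2_norm (\<lambda>_. 1) (hom_expansion f (Suc n)))\<^sup>2)},
     fnorm = (\<lambda>f. sqrt ((L2_norm (\<lambda>_. 1) (hom_expansion f 0))\<^sup>2 +
                (\<Sum>n. real (Suc n) powr (2 * s) *
                      (L2_norm (\<lambda>_. 1) (hom_expansion f (Suc n)))\<^sup>2)))\<rparr>"

definition Mult :: "'d::finite fn_space \<Rightarrow> 'd fn_space \<Rightarrow> (nat \<Rightarrow> complex ^ 'd \<Rightarrow> complex) set"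
  where "Mult H K = {\<Phi>.
    (\<forall>z\<in>unit_ball. summable (\<lambda>k. (cmod (\<Phi> k z))\<^sup>2)) \<and>
    (\<forall>h\<in>funs H. (\<forall>k. (\<lambda>z. \<Phi> k z * h z) \<in> funs K) \<and>
                summable (\<lambda>k. (fnorm K (\<lambda>z. \<Phi> k z * h z))\<^sup>2)) \<and>
    (\<exists>C. \<forall>h\<in>funs H. sqrt (\<Sum>k. (fnorm K (\<lambda>z. \<Phi> k z * h z))\<^sup>2) \<le> C * fnorm H h)}"

definition Mult_norm ::
    "'d::finite fn_space \<Rightarrow> 'd fn_space \<Rightarrow> (nat \<Rightarrow> complex ^ 'd \<Rightarrow> complex) \<Rightarrow> real"
  where "Mult_norm H K \<Phi> =
    (SUP h\<in>{h \<in> funs H. fnorm H h \<le> 1}. sqrt (\<Sum>k. (fnorm K (\<lambda>z. \<Phi> k z * h z))\<^sup>2))"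

text \<open>\<open>\<nat>\<close> starts at 1 here, so the chain of inclusions below is never empty.\<close>

definition multiplier_inclusion_condition :: "'d::finite fn_space \<Rightarrow> 'd fn_space \<Rightarrow> bool"
  where "multiplier_inclusion_condition H K \<longleftrightarrow>
    weighted_besov_space H \<and> weighted_besov_space K \<and>
    (\<exists>\<omega> \<omega>'. \<exists>N\<ge>1.
       admissible_weight \<omega> \<and> admissible_weight \<omega>' \<and>
       equal_equiv_norms H (besov N \<omega>) \<and> equal_equiv_norms K (besov N \<omega>') \<and>
       (\<forall>n\<in>{1..N}.
          Mult (besov n \<omega>) (besov n \<omega>') \<subseteq> Mult (besov (n - 1) \<omega>) (besov (n - 1) \<omega>') \<and>
          (\<exists>c>0. \<forall>\<Phi>\<in>Mult (besov n \<omega>) (besov n \<omega>').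
             Mult_norm (besov (n - 1) \<omega>) (besov (n - 1) \<omega>') \<Phi>
               \<le> c * Mult_norm (besov n \<omega>) (besov n \<omega>') \<Phi>)))"

end

(*
  For f in Hol with homogeneous components f_n, Euler's identity gives (R^N f)_n = n^N f_n, and for the
  radial weight (1 - |z|^2)^b scaling gives ||p||^2 = mu_n ||p||^2_{L^2(V)} for every homogeneous p of
  degree n, with mu_n comparable to n^(-b). Hence, with b = 2 (N - s), the space B^n_w is the space
  B_1^(s - N + n) up to equivalence of norms, and lowering n by one lowers the index by one. Since
  s < (d + 1) / 2, all these spaces are, up to equivalence, the spaces with reproducing kernel
  (1 - <z,w>)^(-a) for some a > 0, and lowering the index by one replaces a by a + 2.

  Multipliers survive the step from a to a + 1, on both sides simultaneously and with the same norm: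
  multiply the positive kernel expressing contractivity by (1 - <z,w>)^(-1) (Schur). On the level of
  functions this says that a polynomial can be split as h = sum z_w h_w over words w, the inequalities
  for the two norms being the column and row contraction properties of z_1, ..., z_d on the
  Drury-Arveson space. These follow from the fact that, on polynomials of degree n + 1 and n,
  d/dz_i is n + d + 1 times the adjoint of multiplication by z_i in L^2(V), which is an integration by
  parts against (1 - |z|^2)^2.
*)

theory Submission
  imports Defs "HOL-Complex_Analysis.Complex_Analysis"
begin

text \<open>The Schur argument multiplies exact kernels, and an equivalent norm has another kernel.
  So each space is first moved to the one whose kernel is exactly (1 - <z, w>)^(-a), where the
  argument costs no constant, and then moved back; the constants of the inclusions come from these
  changes of norm.

  The split of h is dictated by (1 - x)^(-a) (1 - x)^(-1) = (1 - x)^(-(a + 1)): normalised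
  coefficients of the left side are the shares with which words of each length enter. Cauchy-Schwarz
  with the analogous weights for the target exponent b bounds the image.

  Integration by parts over the ball alone would leave boundary terms. The square (1 - |z|^2)^2,
  extended by zero, is continuously differentiable on the whole space, where the integral of a
  derivative vanishes by translation invariance. Its derivative links the weights of exponents 2 and
  1. On homogeneous polynomials both reduce to multiples of the unweighted inner product, and the
  quotient of the two multiples is the origin of n + d + 1.\<close>

no_notation fps_nth (infixl "$" 75)

section \<open>Complex differentiability in several variables, in coordinates\<close>

lemma norm_vector_smult_complex: "norm (c *s (v :: complex ^ 'd::finite)) = cmod c * norm v"
  by (simp add: norm_vec_def norm_mult L2_set_right_distrib)

lemma norm_vec_power2: "(norm (z :: complex ^ 'd::finite))\<^sup>2 = (\<Sum>i\<in>UNIV. (cmod (z $ i))\<^sup>2)"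
  by (simp add: norm_vec_def L2_set_def sum_nonneg)

lemma vector_smult_basis_expansion: "(v :: complex ^ 'd::finite) = (\<Sum>i\<in>UNIV. v $ i *s axis i 1)"
  by (simp add: vec_eq_iff axis_def if_distrib sum.delta cong: if_cong)

lemma bounded_linear_vector_smult_left: "bounded_linear (\<lambda>c. c *s (v :: complex ^ 'd::finite))"
proof
  show "(a + b) *s v = a *s v + b *s v" for a b by (simp add: vector_sadd_rdistrib)
  show "(r *\<^sub>R b) *s v = r *\<^sub>R (b *s v)" for r b by (simp add: vec_eq_iff)
  show "\<exists>K. \<forall>x. norm (x *s v) \<le> norm x * K" by (auto simp: norm_vector_smult_complex)
qed

text \<open>\<open>Hol\<close> is the case of the unit ball. Other sets occur as well: small balls
  for local uniform limits, the whole space for polynomials.\<close>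

definition holo_on :: "(complex ^ 'd) set \<Rightarrow> (complex ^ 'd::finite \<Rightarrow> complex) \<Rightarrow> bool"
  where "holo_on U f \<longleftrightarrow> (\<forall>z\<in>U. \<exists>D. (f has_derivative D) (at z) \<and> (\<forall>c v. D (c *s v) = c * D v))"

lemma Hol_iff_holo_on: "f \<in> Hol \<longleftrightarrow> holo_on unit_ball f"
  by (simp add: Hol_def holo_on_def)

lemma holo_on_subset: "holo_on U f \<Longrightarrow> W \<subseteq> U \<Longrightarrow> holo_on W f"
  by (auto simp: holo_on_def)

lemma partial_deriv_eq_derivative:
  fixes f :: "complex ^ 'd::finite \<Rightarrow> complex"
  assumes f: "(f has_derivative D) (at z)" and D: "\<And>c v. D (c *s v) = c * D v"
  shows "partial_deriv i f z = D (axis i 1)"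
proof -
  have ax: "(\<lambda>w. f (z + axis i w)) = (\<lambda>w. f (z + w *s axis i 1))"
    by (intro ext arg_cong[of _ _ f]) (simp add: vec_eq_iff axis_def)
  have "((\<lambda>w. z + w *s axis i 1) has_derivative (\<lambda>w. w *s axis i 1)) (at 0)"
    by (rule has_derivative_eq_rhs[OF has_derivative_add[OF has_derivative_const
          bounded_linear_imp_has_derivative[OF bounded_linear_vector_smult_left]]]) auto
  then have "((\<lambda>w. f (z + axis i w)) has_derivative (\<lambda>w. D (w *s axis i 1))) (at 0)"
    unfolding ax using has_derivative_compose[of "\<lambda>w. z + w *s axis i 1" _ 0 UNIV f D] f by simp
  then have "((\<lambda>w. f (z + axis i w)) has_field_derivative D (axis i 1)) (at 0)"
    by (simp add: has_field_derivative_def D mult_commute_abs)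
  then show ?thesis unfolding partial_deriv_def by (rule DERIV_imp_deriv)
qed

text \<open>Complex homogeneity makes the differential determined by its values on the axes. In this
  coordinate form differentials are added, multiplied and passed to limits below.\<close>

lemma holo_on_has_derivative:
  fixes f :: "complex ^ 'd::finite \<Rightarrow> complex"
  assumes "holo_on U f" "z \<in> U"
  shows "(f has_derivative (\<lambda>v. \<Sum>i\<in>UNIV. v $ i * partial_deriv i f z)) (at z)"
proof -
  obtain D where D: "(f has_derivative D) (at z)" "\<And>c v. D (c *s v) = c * D v"
    using assms by (auto simp: holo_on_def)
  have "D v = (\<Sum>i\<in>UNIV. v $ i * partial_deriv i f z)" for v
  proof -
    have "D v = D (\<Sum>i\<in>UNIV. v $ i *s axis i 1)"
      by (subst vector_smult_basis_expansion[of v]) simp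
    also have "\<dots> = (\<Sum>i\<in>UNIV. D (v $ i *s axis i 1))"
      using has_derivative_linear[OF D(1)] by (simp add: linear_sum)
    finally show ?thesis by (simp add: D(2) partial_deriv_eq_derivative[OF D])
  qed
  then show ?thesis using D(1) by (metis (no_types, lifting) ext)
qed

lemma holo_onI:
  fixes f :: "complex ^ 'd::finite \<Rightarrow> complex"
  assumes "\<And>z. z \<in> U \<Longrightarrow> \<exists>a. (f has_derivative (\<lambda>v. \<Sum>i\<in>UNIV. v $ i * a i)) (at z)"
  shows "holo_on U f"
  unfolding holo_on_def
proof
  fix z assume "z \<in> U"
  then obtain a where "(f has_derivative (\<lambda>v. \<Sum>i\<in>UNIV. v $ i * a i)) (at z)" using assms by blast
  then show "\<exists>D. (f has_derivative D) (at z) \<and> (\<forall>c v. D (c *s v) = c * D v)"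
    by (intro exI[of _ "\<lambda>v. \<Sum>i\<in>UNIV. v $ i * a i"]) (auto simp: sum_distrib_left mult.assoc)
qed

lemma partial_deriv_eqI:
  fixes f :: "complex ^ 'd::finite \<Rightarrow> complex"
  assumes "(f has_derivative (\<lambda>v. \<Sum>i\<in>UNIV. v $ i * a i)) (at z)"
  shows "partial_deriv i f z = a i"
  using partial_deriv_eq_derivative[OF assms, of i]
  by (simp add: sum_distrib_left mult.assoc axis_def if_distrib[of "\<lambda>x. x * _"] cong: if_cong)

lemma continuous_on_holo_on: "holo_on U f \<Longrightarrow> continuous_on U f"
  by (intro continuous_at_imp_continuous_on ballI has_derivative_continuous[OF holo_on_has_derivative])

lemma holo_on_has_field_derivative_line:
  fixes f :: "complex ^ 'd::finite \<Rightarrow> complex"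
  assumes "holo_on U f" "z + t *s v \<in> U"
  shows "((\<lambda>t. f (z + t *s v)) has_field_derivative (\<Sum>i\<in>UNIV. v $ i * partial_deriv i f (z + t *s v))) (at t)"
proof -
  have "((\<lambda>w. z + w *s v) has_derivative (\<lambda>w. w *s v)) (at t)"
    by (rule has_derivative_eq_rhs[OF has_derivative_add[OF has_derivative_const
          bounded_linear_imp_has_derivative[OF bounded_linear_vector_smult_left]]]) auto
  from has_derivative_compose[OF this holo_on_has_derivative[OF assms]]
  show ?thesis by (simp add: has_field_derivative_def mult.assoc mult_commute_abs flip: sum_distrib_left)
qed

lemma holo_on_const: "holo_on U (\<lambda>z. c)"
  by (auto intro!: holo_onI exI[of _ "\<lambda>_. 0"])

lemma has_derivative_vec_nth_sum:
  "((\<lambda>z. z $ j) has_derivative (\<lambda>v. \<Sum>i\<in>UNIV. v $ i * (if i = j then 1 else 0))) (at (z :: complex ^ 'd::finite))"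
  using bounded_linear_imp_has_derivative[OF bounded_linear_vec_nth[of j]]
  by (simp add: if_distrib[of "\<lambda>x. _ * x"] cong: if_cong)

lemma holo_on_vec_nth: "holo_on U (\<lambda>z. z $ i)"
  by (rule holo_onI) (rule exI, rule has_derivative_vec_nth_sum)

lemma has_derivative_add_sum:
  fixes f g :: "complex ^ 'd::finite \<Rightarrow> complex"
  assumes "(f has_derivative (\<lambda>v. \<Sum>i\<in>UNIV. v $ i * a i)) (at z)" "(g has_derivative (\<lambda>v. \<Sum>i\<in>UNIV. v $ i * b i)) (at z)"
  shows "((\<lambda>z. f z + g z) has_derivative (\<lambda>v. \<Sum>i\<in>UNIV. v $ i * (a i + b i))) (at z)"
  using has_derivative_add[OF assms] by (simp add: sum.distrib distrib_left)

lemma has_derivative_mult_sum: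
  fixes f g :: "complex ^ 'd::finite \<Rightarrow> complex"
  assumes "(f has_derivative (\<lambda>v. \<Sum>i\<in>UNIV. v $ i * a i)) (at z)" "(g has_derivative (\<lambda>v. \<Sum>i\<in>UNIV. v $ i * b i)) (at z)"
  shows "((\<lambda>z. f z * g z) has_derivative (\<lambda>v. \<Sum>i\<in>UNIV. v $ i * (f z * b i + a i * g z))) (at z)"
  using has_derivative_mult[OF assms]
  by (rule has_derivative_eq_rhs)
     (simp add: fun_eq_iff distrib_left sum.distrib sum_distrib_left sum_distrib_right mult_ac)

lemma holo_on_add: "holo_on U f \<Longrightarrow> holo_on U g \<Longrightarrow> holo_on U (\<lambda>z. f z + g z)"
  by (rule holo_onI) (rule exI, rule has_derivative_add_sum; rule holo_on_has_derivative; assumption)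

lemma holo_on_mult: "holo_on U f \<Longrightarrow> holo_on U g \<Longrightarrow> holo_on U (\<lambda>z. f z * g z)"
  by (rule holo_onI) (rule exI, rule has_derivative_mult_sum; rule holo_on_has_derivative; assumption)

lemma holo_on_cmult: "holo_on U f \<Longrightarrow> holo_on U (\<lambda>z. c * f z)"
  by (intro holo_on_mult holo_on_const)

lemma holo_on_diff: "holo_on U f \<Longrightarrow> holo_on U g \<Longrightarrow> holo_on U (\<lambda>z. f z - g z)"
  using holo_on_add[of U f "\<lambda>z. (-1) * g z"] holo_on_cmult[of U g "-1"] by simp

lemma holo_on_sum: "(\<And>i. i \<in> A \<Longrightarrow> holo_on U (f i)) \<Longrightarrow> holo_on U (\<lambda>z. \<Sum>i\<in>A. f i z)"
  by (induction A rule: infinite_finite_induct) (auto intro: holo_on_add holo_on_const)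

lemma partial_deriv_add:
  "holo_on U f \<Longrightarrow> holo_on U g \<Longrightarrow> z \<in> U \<Longrightarrow>
   partial_deriv i (\<lambda>z. f z + g z) z = partial_deriv i f z + partial_deriv i g z"
  by (rule partial_deriv_eqI[of _ "\<lambda>i. partial_deriv i f z + partial_deriv i g z"])
     (intro has_derivative_add_sum holo_on_has_derivative; assumption)

lemma partial_deriv_mult:
  "holo_on U f \<Longrightarrow> holo_on U g \<Longrightarrow> z \<in> U \<Longrightarrow>
   partial_deriv i (\<lambda>z. f z * g z) z = f z * partial_deriv i g z + partial_deriv i f z * g z"
  by (rule partial_deriv_eqI[of _ "\<lambda>i. f z * partial_deriv i g z + partial_deriv i f z * g z"])
     (intro has_derivative_mult_sum holo_on_has_derivative; assumption)

lemma partial_deriv_const: "partial_deriv i (\<lambda>z. c) z = 0"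
  by (rule partial_deriv_eqI[of _ "\<lambda>_. 0"]) auto

lemma partial_deriv_cmult:
  "holo_on U f \<Longrightarrow> z \<in> U \<Longrightarrow> partial_deriv i (\<lambda>z. c * f z) z = c * partial_deriv i f z"
  by (simp add: partial_deriv_mult[OF holo_on_const] partial_deriv_const)

lemma partial_deriv_diff:
  "holo_on U f \<Longrightarrow> holo_on U g \<Longrightarrow> z \<in> U \<Longrightarrow>
   partial_deriv i (\<lambda>z. f z - g z) z = partial_deriv i f z - partial_deriv i g z"
  using partial_deriv_add[of U f "\<lambda>z. (-1) * g z" z i] holo_on_cmult[of U g "-1"]
    partial_deriv_cmult[of U g z i "-1"] by simp

lemma has_derivative_at_cong_open:
  assumes "open U" "z \<in> U" "\<And>w. w \<in> U \<Longrightarrow> f w = g w" "(f has_derivative D) (at z)"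
  shows "(g has_derivative D) (at z)"
  using assms has_derivative_transform_within_open by blast

section \<open>Homogeneous polynomials\<close>

definition monomial :: "('d::finite \<Rightarrow> nat) \<Rightarrow> complex ^ 'd \<Rightarrow> complex"
  where "monomial \<alpha> z = (\<Prod>i\<in>UNIV. z $ i ^ \<alpha> i)"

lemma finite_multi_indices: "finite {\<alpha> :: 'd::finite \<Rightarrow> nat. (\<Sum>i\<in>UNIV. \<alpha> i) = n}"
proof (rule finite_subset)
  show "{\<alpha> :: 'd \<Rightarrow> nat. (\<Sum>i\<in>UNIV. \<alpha> i) = n} \<subseteq> {\<alpha>. \<forall>i. \<alpha> i \<in> {..n}}"
    by (auto intro!: member_le_sum)
  show "finite {\<alpha> :: 'd \<Rightarrow> nat. \<forall>i. \<alpha> i \<in> {..n}}"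
    using finite_PiE[of "UNIV :: 'd set" "\<lambda>_. {..n}"] by (simp add: PiE_def Pi_def)
qed

lemma homogeneous_poly_zero: "homogeneous_poly n (\<lambda>z. 0)"
  unfolding homogeneous_poly_def by (rule exI[of _ "\<lambda>_. 0"]) simp

lemma homogeneous_poly_add:
  assumes "homogeneous_poly n p" "homogeneous_poly n q"
  shows "homogeneous_poly n (\<lambda>z. p z + q z)"
proof -
  obtain c e where "p = (\<lambda>z. \<Sum>\<alpha> | (\<Sum>i\<in>UNIV. \<alpha> i) = n. c \<alpha> * (\<Prod>i\<in>UNIV. z $ i ^ \<alpha> i))"
    "q = (\<lambda>z. \<Sum>\<alpha> | (\<Sum>i\<in>UNIV. \<alpha> i) = n. e \<alpha> * (\<Prod>i\<in>UNIV. z $ i ^ \<alpha> i))"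
    using assms unfolding homogeneous_poly_def by blast
  then show ?thesis unfolding homogeneous_poly_def
    by (intro exI[of _ "\<lambda>\<alpha>. c \<alpha> + e \<alpha>"]) (simp add: sum.distrib distrib_right)
qed

lemma homogeneous_poly_cmult:
  assumes "homogeneous_poly n p" shows "homogeneous_poly n (\<lambda>z. a * p z)"
proof -
  obtain c where "p = (\<lambda>z. \<Sum>\<alpha> | (\<Sum>i\<in>UNIV. \<alpha> i) = n. c \<alpha> * (\<Prod>i\<in>UNIV. z $ i ^ \<alpha> i))"
    using assms unfolding homogeneous_poly_def by blast
  then show ?thesis unfolding homogeneous_poly_def
    by (intro exI[of _ "\<lambda>\<alpha>. a * c \<alpha>"]) (simp add: sum_distrib_left mult.assoc)
qed

lemma homogeneous_poly_sum:
  "(\<And>i. i \<in> A \<Longrightarrow> homogeneous_poly n (f i)) \<Longrightarrow> homogeneous_poly n (\<lambda>z. \<Sum>i\<in>A. f i z)"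
  by (induction A rule: infinite_finite_induct) (auto intro: homogeneous_poly_add homogeneous_poly_zero)

lemma homogeneous_poly_monomial: "homogeneous_poly (\<Sum>i\<in>UNIV. \<alpha> i) (monomial \<alpha>)"
  unfolding homogeneous_poly_def monomial_def
  by (rule exI[of _ "\<lambda>\<beta>. if \<beta> = \<alpha> then 1 else 0"])
     (simp add: if_distrib[of "\<lambda>x. x * _"] sum.delta' finite_multi_indices cong: if_cong)

text \<open>Homogeneous polynomials of degree \<open>n\<close> are the span of the monomials of that
  degree, and the zero polynomial comes from \<open>cmult\<close> with factor 0.\<close>

lemma homogeneous_poly_induct [consumes 1, case_names add cmult monomial]:
  assumes p: "homogeneous_poly n p"
    and add: "\<And>p q. homogeneous_poly n p \<Longrightarrow> homogeneous_poly n q \<Longrightarrow> P p \<Longrightarrow> P q \<Longrightarrow> P (\<lambda>z. p z + q z)"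
    and cmult: "\<And>p c. homogeneous_poly n p \<Longrightarrow> P p \<Longrightarrow> P (\<lambda>z. c * p z)"
    and mono: "\<And>\<alpha>. (\<Sum>i\<in>UNIV. \<alpha> i) = n \<Longrightarrow> P (monomial \<alpha>)"
  shows "P p"
proof -
  obtain c where c: "p = (\<lambda>z. \<Sum>\<alpha> | (\<Sum>i\<in>UNIV. \<alpha> i) = n. c \<alpha> * monomial \<alpha> z)"
    using p unfolding homogeneous_poly_def monomial_def by blast
  let ?M = "{\<alpha> :: 'a \<Rightarrow> nat. (\<Sum>i\<in>UNIV. \<alpha> i) = n}"
  \<comment> \<open>Some monomial of degree \<open>n\<close> is required; here all of its degree
    sits in one variable.\<close>
  have z: "P (\<lambda>z. 0)"
  proof -
    have "(\<Sum>i\<in>UNIV. if i = (undefined::'a) then n else 0) = n" by simp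
    from cmult[OF _ mono[OF this], of 0] homogeneous_poly_monomial[of "\<lambda>i. if i = (undefined::'a) then n else 0"] this
    show ?thesis by simp
  qed
  have "A \<subseteq> ?M \<Longrightarrow> P (\<lambda>z. \<Sum>\<alpha>\<in>A. c \<alpha> * monomial \<alpha> z)" if "finite A" for A
    using that
  proof (induction A)
    case (insert \<alpha> A)
    have m: "homogeneous_poly n (monomial \<beta>)" if "\<beta> \<in> ?M" for \<beta>
      using that homogeneous_poly_monomial[of \<beta>] by simp
    have "homogeneous_poly n (\<lambda>z. \<Sum>\<alpha>\<in>A. c \<alpha> * monomial \<alpha> z)"
      using insert.prems by (intro homogeneous_poly_sum homogeneous_poly_cmult m) auto
    then have "P (\<lambda>z. c \<alpha> * monomial \<alpha> z + (\<Sum>\<alpha>\<in>A. c \<alpha> * monomial \<alpha> z))"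
      using insert.prems insert.IH by (intro add cmult homogeneous_poly_cmult m mono) auto
    then show ?case using insert.hyps by simp
  qed (simp add: z)
  from this[OF finite_multi_indices order_refl] c show ?thesis by simp
qed

lemma monomial_mult: "monomial \<alpha> z * monomial \<beta> z = monomial (\<lambda>i. \<alpha> i + \<beta> i) z"
  by (simp add: monomial_def power_add prod.distrib)

lemma homogeneous_poly_mult:
  assumes "homogeneous_poly n p" "homogeneous_poly m q"
  shows "homogeneous_poly (n + m) (\<lambda>z. p z * q z)"
  using assms(1)
proof (induction rule: homogeneous_poly_induct)
  case (monomial \<alpha>)
  from assms(2) show ?case
  proof (induction rule: homogeneous_poly_induct)
    case (monomial \<beta>)
    with \<open>sum \<alpha> UNIV = n\<close> show ?case
      using homogeneous_poly_monomial[of "\<lambda>i. \<alpha> i + \<beta> i"] by (simp add: monomial_mult sum.distrib)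
  next
    case (add p q) then show ?case
      using homogeneous_poly_add[OF add(3,4)] by (simp add: algebra_simps)
  next
    case (cmult p c) then show ?case
      using homogeneous_poly_cmult[OF cmult(2), of c] by (simp add: algebra_simps)
  qed
next
  case (add p q) then show ?case
    using homogeneous_poly_add[OF add(3,4)] by (simp add: algebra_simps)
next
  case (cmult p c) then show ?case
    using homogeneous_poly_cmult[OF cmult(2), of c] by (simp add: algebra_simps)
qed

lemma monomial_indicator: "monomial (\<lambda>j. if j = i then 1 else 0) = (\<lambda>z. z $ i)"
proof
  fix z :: "complex ^ 'a"
  have "(\<Prod>j\<in>UNIV. z $ j ^ (if j = i then 1 else 0)) = (\<Prod>j\<in>UNIV. if j = i then z $ j else 1)"
    by (rule prod.cong) auto
  then show "monomial (\<lambda>j. if j = i then 1 else 0) z = z $ i" by (simp add: monomial_def)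
qed

lemma homogeneous_poly_vec_nth: "homogeneous_poly 1 (\<lambda>z. z $ i)"
  using homogeneous_poly_monomial[of "\<lambda>j. if j = i then 1 else 0"] by (simp add: monomial_indicator)

lemma homogeneous_poly_vec_nth_mult:
  "homogeneous_poly n p \<Longrightarrow> homogeneous_poly (Suc n) (\<lambda>z. z $ i * p z)"
  using homogeneous_poly_mult[OF homogeneous_poly_vec_nth] by simp

lemma homogeneous_poly_const: "homogeneous_poly 0 (\<lambda>z. c)"
  using homogeneous_poly_cmult[OF homogeneous_poly_monomial[of "\<lambda>_. 0"], of c] by (simp add: monomial_def)

lemma homogeneous_poly_0_const: "homogeneous_poly 0 p \<Longrightarrow> p z = p 0"
  by (induction rule: homogeneous_poly_induct) (auto simp: monomial_def)

lemma homogeneous_poly_smult: "homogeneous_poly n p \<Longrightarrow> p (c *s z) = c ^ n * p z"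
proof (induction rule: homogeneous_poly_induct)
  case (monomial \<alpha>)
  then show ?case by (auto simp: monomial_def power_mult_distrib prod.distrib power_sum)
qed (auto simp: algebra_simps)

lemma holo_on_monomial: "holo_on U (monomial \<alpha>)"
proof -
  have power_weight: "holo_on U (\<lambda>z. z $ i ^ k)" for i k
    by (induction k) (auto intro: holo_on_const holo_on_mult holo_on_vec_nth)
  have "holo_on U (\<lambda>z. \<Prod>i\<in>A. z $ i ^ \<alpha> i)" for A
    by (induction A rule: infinite_finite_induct) (auto intro: holo_on_const holo_on_mult power_weight)
  then show ?thesis unfolding monomial_def[abs_def] .
qed

lemma holo_on_homogeneous_poly: "homogeneous_poly n p \<Longrightarrow> holo_on U p"
  by (induction rule: homogeneous_poly_induct) (auto intro: holo_on_add holo_on_cmult holo_on_monomial)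

lemma monomial_split: "monomial \<alpha> z = z $ i ^ \<alpha> i * (\<Prod>j\<in>UNIV - {i}. z $ j ^ \<alpha> j)"
  unfolding monomial_def by (subst prod.remove[of UNIV i]) auto

text \<open>For \<open>\<alpha> i = 0\<close> the truncated exponent is harmless, because the factor
  \<open>of_nat (\<alpha> i)\<close> vanishes.\<close>

lemma partial_deriv_monomial: "partial_deriv i (monomial \<alpha>) z = of_nat (\<alpha> i) * monomial (\<alpha>(i := \<alpha> i - 1)) z"
proof -
  let ?c = "\<Prod>j\<in>UNIV - {i}. z $ j ^ \<alpha> j"
  have "monomial \<alpha> (z + axis i w) = (z $ i + w) ^ \<alpha> i * ?c" for w
    unfolding monomial_split[of _ _ i] by (auto simp: axis_def intro!: prod.cong)
  moreover have "((\<lambda>w. (z $ i + w) ^ \<alpha> i * ?c) has_field_derivative of_nat (\<alpha> i) * (z $ i) ^ (\<alpha> i - 1) * ?c) (at 0)"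
    by (auto intro!: derivative_eq_intros)
  ultimately have "partial_deriv i (monomial \<alpha>) z = of_nat (\<alpha> i) * (z $ i) ^ (\<alpha> i - 1) * ?c"
    unfolding partial_deriv_def by (simp add: DERIV_imp_deriv)
  also have "\<dots> = of_nat (\<alpha> i) * monomial (\<alpha>(i := \<alpha> i - 1)) z"
    unfolding monomial_split[of _ z i] by simp
  finally show ?thesis .
qed

lemma partial_deriv_homogeneous_poly_add:
  "homogeneous_poly n p \<Longrightarrow> homogeneous_poly m q \<Longrightarrow>
   partial_deriv i (\<lambda>z. p z + q z) = (\<lambda>z. partial_deriv i p z + partial_deriv i q z)"
  by (rule ext, rule partial_deriv_add[of UNIV]) (auto intro: holo_on_homogeneous_poly)

lemma partial_deriv_homogeneous_poly_cmult:
  "homogeneous_poly n p \<Longrightarrow> partial_deriv i (\<lambda>z. c * p z) = (\<lambda>z. c * partial_deriv i p z)"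
  by (rule ext, rule partial_deriv_cmult[of UNIV]) (auto intro: holo_on_homogeneous_poly)

text \<open>The truncated \<open>n - 1\<close> is correct at degree 0 too: the derivative is then
  zero, which is homogeneous of every degree.\<close>

lemma homogeneous_poly_partial_deriv:
  "homogeneous_poly n p \<Longrightarrow> homogeneous_poly (n - 1) (partial_deriv i p)"
proof (induction rule: homogeneous_poly_induct)
  case (monomial \<alpha>)
  have eq: "partial_deriv i (monomial \<alpha>) = (\<lambda>z. of_nat (\<alpha> i) * monomial (\<alpha>(i := \<alpha> i - 1)) z)"
    by (rule ext) (rule partial_deriv_monomial)
  show ?case
  proof (cases "\<alpha> i = 0")
    case False
    have "(\<Sum>j\<in>UNIV. (\<alpha>(i := \<alpha> i - 1)) j) = n - 1"
      using monomial False sum.remove[of UNIV i \<alpha>] sum.remove[of UNIV i "\<alpha>(i := \<alpha> i - 1)"] by simp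
    then show ?thesis unfolding eq
      using homogeneous_poly_monomial[of "\<alpha>(i := \<alpha> i - 1)"] by (intro homogeneous_poly_cmult) simp
  qed (simp add: eq homogeneous_poly_zero)
qed (simp_all add: partial_deriv_homogeneous_poly_add partial_deriv_homogeneous_poly_cmult
      homogeneous_poly_add homogeneous_poly_cmult)

lemma homogeneous_poly_euler:
  "homogeneous_poly n p \<Longrightarrow> (\<Sum>i\<in>UNIV. z $ i * partial_deriv i p z) = of_nat n * p z"
proof (induction rule: homogeneous_poly_induct)
  case (monomial \<alpha>)
  have "z $ i * partial_deriv i (monomial \<alpha>) z = of_nat (\<alpha> i) * monomial \<alpha> z" for i
  proof (cases "\<alpha> i")
    case (Suc k)
    then show ?thesis by (simp add: partial_deriv_monomial monomial_split[of _ z i])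
  qed (simp add: partial_deriv_monomial)
  then show ?case using monomial by (simp flip: sum_distrib_right of_nat_sum)
qed (simp_all add: partial_deriv_homogeneous_poly_add partial_deriv_homogeneous_poly_cmult
      distrib_left sum.distrib sum_distrib_left[symmetric] mult.left_commute)

section \<open>Holomorphic functions on the ball\<close>

text \<open>The one-variable Cauchy estimate on the complex line through \<open>z\<close> in
  direction \<open>v\<close>, where the disc of radius \<open>r / norm v\<close> corresponds to the
  ball of radius \<open>r\<close>.\<close>

lemma cauchy_line_bound:
  fixes f :: "complex ^ 'd::finite \<Rightarrow> complex"
  assumes f: "holo_on U f" and U: "cball z r \<subseteq> U" and r: "r > 0"
    and B: "\<And>w. w \<in> cball z r \<Longrightarrow> cmod (f w) \<le> B"
  shows "cmod (\<Sum>i\<in>UNIV. v $ i * partial_deriv i f z) \<le> B * norm v / r"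
proof (cases "v = 0")
  case False
  let ?g = "\<lambda>t. f (z + t *s v)"
  define R where "R = r / norm v"
  have R: "R > 0" using False r by (simp add: R_def)
  have mem: "z + t *s v \<in> cball z r" if "cmod t \<le> R" for t
    using that False by (simp add: dist_norm norm_vector_smult_complex R_def field_simps)
  have der: "(?g has_field_derivative (\<Sum>i\<in>UNIV. v $ i * partial_deriv i f (z + t *s v))) (at t)" if "cmod t \<le> R" for t
    using holo_on_has_field_derivative_line[OF f] mem[OF that] U by blast
  have "cmod ((deriv ^^ 1) ?g 0) \<le> fact 1 * B / R ^ 1"
  proof (rule Cauchy_inequality)
    show "?g holomorphic_on ball 0 R"
      unfolding holomorphic_on_def field_differentiable_def
      by (intro ballI exI, rule has_field_derivative_at_within, rule der) simp
    show "continuous_on (cball 0 R) ?g"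
      using der by (intro continuous_at_imp_continuous_on ballI DERIV_isCont) auto
    show "cmod (0 - x) = R \<Longrightarrow> cmod (f (z + x *s v)) \<le> B" for x
      by (rule B, rule mem) simp
  qed (use R in auto)
  moreover have "deriv ?g 0 = (\<Sum>i\<in>UNIV. v $ i * partial_deriv i f z)"
    using der[of 0] R by (simp add: DERIV_imp_deriv)
  ultimately show ?thesis by (simp add: R_def)
qed (simp)

lemma norm_axis_complex: "norm (axis i c :: complex ^ 'd::finite) = cmod c"
proof -
  have "(cmod (axis i c $ j))\<^sup>2 = (if j = i then (cmod c)\<^sup>2 else 0)" for j by (simp add: axis_def)
  then have "(norm (axis i c :: complex ^ 'd))\<^sup>2 = (cmod c)\<^sup>2" by (simp add: norm_vec_power2)
  then show ?thesis by (simp add: power2_eq_iff_nonneg)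
qed

lemma sum_axis_mult: "(\<Sum>j\<in>UNIV. axis i c $ j * b j) = c * b (i :: 'd::finite)" for c :: complex
proof -
  have "axis i c $ j * b j = (if j = i then c * b j else 0)" for j by (simp add: axis_def)
  then show ?thesis by simp
qed

text \<open>Cauchy's estimate makes the differentials uniformly Cauchy on a smaller ball.\<close>

lemma holo_on_uniform_limit_ball:
  fixes F :: "nat \<Rightarrow> complex ^ 'd::finite \<Rightarrow> complex"
  assumes F: "\<And>k. holo_on (ball a (2 * r)) (F k)" and r: "r > 0"
    and lim: "uniform_limit (ball a (2 * r)) F f sequentially"
  shows "(f has_derivative (\<lambda>v. \<Sum>i\<in>UNIV. v $ i * partial_deriv i f a)) (at a)
    \<and> (\<forall>i. (\<lambda>k. partial_deriv i (F k) a) \<longlonglongrightarrow> partial_deriv i f a)"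
proof -
  \<comment> \<open>Half the radius leaves room for Cauchy discs of radius \<open>r / 2\<close>
    around every point of \<open>S\<close>.\<close>
  define S where "S = ball a r"
  have sub: "cball z (r / 2) \<subseteq> ball a (2 * r)" if "z \<in> S" for z
    using that r by (auto simp: S_def dist_norm) (smt (verit) dist_norm dist_triangle field_sum_of_halves)
  have ucau: "\<exists>M. \<forall>m\<ge>M. \<forall>n\<ge>M. \<forall>z\<in>S. \<forall>v. 
     cmod ((\<Sum>i\<in>UNIV. v $ i * partial_deriv i (F m) z) - (\<Sum>i\<in>UNIV. v $ i * partial_deriv i (F n) z)) \<le> e * norm v"
    if e: "e > 0" for e
  proof -
    have "uniformly_Cauchy_on (ball a (2 * r)) F"
      using lim by (meson uniformly_convergent_on_def uniformly_convergent_Cauchy)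
    then obtain M where M: "\<And>m n w. m \<ge> M \<Longrightarrow> n \<ge> M \<Longrightarrow> w \<in> ball a (2 * r) \<Longrightarrow> dist (F m w) (F n w) < e * r / 2"
      using e r unfolding uniformly_Cauchy_on_def by (metis divide_pos_pos mult_pos_pos zero_less_numeral)
    show ?thesis
    proof (intro exI allI impI ballI)
      fix m n z v assume mn: "m \<ge> M" "n \<ge> M" and z: "z \<in> S"
      have "cmod (\<Sum>i\<in>UNIV. v $ i * partial_deriv i (\<lambda>z. F m z - F n z) z) \<le> (e * r / 2) * norm v / (r / 2)"
      proof (rule cauchy_line_bound[OF holo_on_diff[OF F[of m] F[of n]]])
        show "cmod (F m w - F n w) \<le> e * r / 2" if "w \<in> cball z (r / 2)" for w
          using M[OF mn, of w] sub[OF z] that by (auto simp: dist_norm)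
      qed (use r sub[OF z] in auto)
      moreover have "z \<in> ball a (2 * r)" using z r by (auto simp: S_def)
      ultimately show "cmod ((\<Sum>i\<in>UNIV. v $ i * partial_deriv i (F m) z) - (\<Sum>i\<in>UNIV. v $ i * partial_deriv i (F n) z)) \<le> e * norm v"
        using r by (simp add: partial_deriv_diff[OF F[of m] F[of n]] right_diff_distrib sum_subtractf)
    qed
  qed
  define g where "g z i = lim (\<lambda>k. partial_deriv i (F k) z)" for z i
  have g: "(\<lambda>k. partial_deriv i (F k) z) \<longlonglongrightarrow> g z i" if z: "z \<in> S" for z i
    unfolding g_def convergent_LIMSEQ_iff[symmetric] Cauchy_convergent_iff[symmetric]
  proof (rule CauchyI)
    fix e :: real assume e: "0 < e"
    have ax: "(\<Sum>j\<in>UNIV. axis i 1 $ j * c j) = c i" for c :: "'d \<Rightarrow> complex"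
      by (simp add: sum_axis_mult)
    have e2: "e / 2 > 0" using e by simp
    obtain M where M: "\<And>m n z v. m\<ge>M \<Longrightarrow> n\<ge>M \<Longrightarrow> z\<in>S \<Longrightarrow>
     cmod ((\<Sum>i\<in>UNIV. v $ i * partial_deriv i (F m) z) - (\<Sum>i\<in>UNIV. v $ i * partial_deriv i (F n) z)) \<le> (e/2) * norm v"
      using ucau[OF e2] by blast
    have "cmod (partial_deriv i (F m) z - partial_deriv i (F n) z) \<le> e/2" if "m \<ge> M" "n \<ge> M" for m n
      using M[OF that z, of "axis i 1"] by (simp add: ax norm_axis_complex)
    then show "\<exists>M. \<forall>m\<ge>M. \<forall>n\<ge>M. cmod (partial_deriv i (F m) z - partial_deriv i (F n) z) < e"
      using e by (intro exI[of _ M]) fastforce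
  qed
  have nle: "\<forall>\<^sub>F n in sequentially. \<forall>z\<in>S. \<forall>v. norm ((\<Sum>i\<in>UNIV. v $ i * partial_deriv i (F n) z) - (\<Sum>i\<in>UNIV. v $ i * g z i)) \<le> e * norm v"
    if e: "e > 0" for e
  proof -
    obtain M where M: "\<And>m n z v. m\<ge>M \<Longrightarrow> n\<ge>M \<Longrightarrow> z\<in>S \<Longrightarrow> 
     cmod ((\<Sum>i\<in>UNIV. v $ i * partial_deriv i (F m) z) - (\<Sum>i\<in>UNIV. v $ i * partial_deriv i (F n) z)) \<le> e * norm v"
      using ucau[OF e] by blast
    have "norm ((\<Sum>i\<in>UNIV. v $ i * partial_deriv i (F n) z) - (\<Sum>i\<in>UNIV. v $ i * g z i)) \<le> e * norm v"
      if "n \<ge> M" "z \<in> S" for n z v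
    proof (rule Lim_bounded[of _ _ M])
      show "(\<lambda>m. norm ((\<Sum>i\<in>UNIV. v $ i * partial_deriv i (F n) z) - (\<Sum>i\<in>UNIV. v $ i * partial_deriv i (F m) z))) 
        \<longlonglongrightarrow> norm ((\<Sum>i\<in>UNIV. v $ i * partial_deriv i (F n) z) - (\<Sum>i\<in>UNIV. v $ i * g z i))"
        by (intro tendsto_intros g that)
    qed (use M that in auto)
    then show ?thesis unfolding eventually_sequentially by blast
  qed
  have "\<exists>h. \<forall>z\<in>S. (\<lambda>n. F n z) \<longlonglongrightarrow> h z \<and> (h has_derivative (\<lambda>v. \<Sum>i\<in>UNIV. v $ i * g z i)) (at z within S)"
  proof (rule has_derivative_sequence[where ?x0.0 = a and l = "f a"])
    show "convex S" by (simp add: S_def)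
    show "a \<in> S" using r by (simp add: S_def)
    show "(F n has_derivative (\<lambda>v. \<Sum>i\<in>UNIV. v $ i * partial_deriv i (F n) x)) (at x within S)" if "x \<in> S" for n x
      by (rule has_derivative_at_withinI, rule holo_on_has_derivative[OF F]) (use that r in \<open>auto simp: S_def\<close>)
    show "(\<lambda>n. F n a) \<longlonglongrightarrow> f a" by (rule tendsto_uniform_limitI[OF lim]) (use r in auto)
  qed (rule nle)
  then obtain h where h: "\<And>z. z \<in> S \<Longrightarrow> (\<lambda>n. F n z) \<longlonglongrightarrow> h z"
     "\<And>z. z \<in> S \<Longrightarrow> (h has_derivative (\<lambda>v. \<Sum>i\<in>UNIV. v $ i * g z i)) (at z within S)" by blast
  have a: "a \<in> S" using r by (simp add: S_def)
  have hf: "h z = f z" if "z \<in> S" for z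
    by (rule LIMSEQ_unique[OF h(1)[OF that]], rule tendsto_uniform_limitI[OF lim]) (use that r in \<open>auto simp: S_def\<close>)
  have "(h has_derivative (\<lambda>v. \<Sum>i\<in>UNIV. v $ i * g a i)) (at a)"
    using h(2)[OF a] at_within_open[OF a] by (simp add: S_def)
  from has_derivative_at_cong_open[OF _ a hf this]
  have d: "(f has_derivative (\<lambda>v. \<Sum>i\<in>UNIV. v $ i * g a i)) (at a)" by (simp add: S_def)
  have "partial_deriv i f a = g a i" for i using partial_deriv_eqI[OF d] .
  with d g[OF a] show ?thesis by simp
qed

lemma holo_on_uniform_limit:
  fixes f :: "complex ^ 'd::finite \<Rightarrow> complex"
  assumes "\<And>a. a \<in> U \<Longrightarrow> \<exists>r>0. \<exists>F. uniform_limit (ball a r) F f sequentially \<and> (\<forall>k. holo_on (ball a r) (F k))"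
  shows "holo_on U f"
proof (rule holo_onI)
  fix a assume "a \<in> U"
  then obtain r F where r: "r > 0" "uniform_limit (ball a r) F f sequentially" "\<And>k::nat. holo_on (ball a r) (F k)"
    using assms by blast
  from holo_on_uniform_limit_ball[of a "r/2" F f] r
  show "\<exists>b. (f has_derivative (\<lambda>v. \<Sum>i\<in>UNIV. v $ i * b i)) (at a)" by auto
qed

text \<open>The difference quotients along the axis are holomorphic. Taylor's formula, with a Cauchy
  bound on the second derivative along the axis, makes them converge locally uniformly.\<close>

lemma holo_on_partial_deriv:
  fixes f :: "complex ^ 'd::finite \<Rightarrow> complex"
  assumes f: "holo_on U f" and U: "open U"
  shows "holo_on U (partial_deriv i f)"
proof (rule holo_on_uniform_limit)
  fix a assume "a \<in> U"
  then obtain r0 where r0: "r0 > 0" "cball a r0 \<subseteq> U" using U open_contains_cball by blast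
  \<comment> \<open>A point of \<open>ball a r\<close> moved by at most \<open>2 * r\<close> stays
    in \<open>cball a r0\<close>, where \<open>f\<close> is bounded by \<open>B\<close>.\<close>
  define r where "r = r0 / 3"
  have r: "r > 0" using r0 by (simp add: r_def)
  have "compact (f ` cball a r0)"
    using continuous_on_holo_on[OF f] r0 by (intro compact_continuous_image) (auto intro: continuous_on_subset)
  then obtain B where B: "\<And>w. w \<in> cball a r0 \<Longrightarrow> cmod (f w) \<le> B"
    by (metis bounded_iff compact_imp_bounded imageI)
  let ?h = "\<lambda>k. complex_of_real (r / real (Suc k))"
  have hn: "cmod (?h k) = r / real (Suc k)" for k
    unfolding norm_of_real using r by simp
  have hle: "cmod (?h k) \<le> r" for k
    unfolding hn using r by (simp add: field_simps)
  let ?q = "\<lambda>k z. (f (z + axis i (?h k)) - f z) / ?h k"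
  have ax: "axis i t = t *s axis i (1::complex)" for t by (simp add: vec_eq_iff axis_def)
  have sc: "(z + t *s axis i 1) \<in> cball a r0" if "z \<in> ball a r" "cmod t \<le> 2 * r" for z t
  proof -
    have "dist a (z + t *s axis i 1) \<le> dist a z + norm (t *s axis i (1::complex))"
      by (metis add.commute dist_norm dist_triangle2 dist_commute add_diff_cancel_left' dist_triangle norm_minus_commute)
    then show ?thesis using that by (simp add: norm_vector_smult_complex r_def)
  qed
  let ?u = "\<lambda>z t. f (z + t *s axis i 1)"
  have hol: "?u z holomorphic_on ball 0 (2 * r)" if z: "z \<in> ball a r" for z
  proof -
    have "((?u z) has_field_derivative (\<Sum>j\<in>UNIV. axis i 1 $ j * partial_deriv j f (z + t *s axis i 1))) (at t within ball 0 (2*r))" 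
      if "t \<in> ball 0 (2 * r)" for t
      by (rule has_field_derivative_at_within, rule holo_on_has_field_derivative_line[OF f])
        (use sc[OF z, of t] that r0 in auto)
    then show ?thesis unfolding holomorphic_on_def field_differentiable_def by blast
  qed
  have d0: "deriv (?u z) 0 = partial_deriv i f z" for z
    by (simp add: partial_deriv_def flip: ax)
  have b2: "cmod ((deriv ^^ 2) (?u z) t) \<le> 2 * B / (r/2)^2" if z: "z \<in> ball a r" and t: "t \<in> cball 0 r" for z t
  proof -
    have sub: "cball t (r/2) \<subseteq> ball 0 (2 * r)"
      using t r by (auto simp: dist_norm) (smt (verit) norm_triangle_ineq2 norm_minus_commute field_sum_of_halves)
    have "cmod ((deriv ^^ 2) (?u z) t) \<le> fact 2 * B / (r/2) ^ 2"
    proof (rule Cauchy_inequality)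
      show "?u z holomorphic_on ball t (r/2)" using hol[OF z] sub by (meson ball_subset_cball holomorphic_on_subset order_trans)
      show "continuous_on (cball t (r/2)) (?u z)" using hol[OF z] sub by (meson holomorphic_on_imp_continuous_on holomorphic_on_subset)
      show "cmod (?u z x) \<le> B" if "cmod (t - x) = r/2" for x
      proof -
        have "x \<in> cball t (r/2)" using that by (simp add: dist_norm)
        then have "cmod x \<le> 2 * r" using sub by (auto simp: less_imp_le)
        from B[OF sc[OF z this]] show ?thesis .
      qed
    qed (use r in auto)
    then show ?thesis by (simp add: fact_2)
  qed
  have est: "cmod (?q k z - partial_deriv i f z) \<le> (2 * B / (r/2)^2) * (r / real (Suc k))" if z: "z \<in> ball a r" for k z
  proof -
    let ?f = "\<lambda>n. (deriv ^^ n) (?u z)"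
    note hk = hle[of k]
    have "cmod (?f 0 (?h k) - (\<Sum>j\<le>1. ?f j 0 * (?h k - 0) ^ j / fact j)) \<le> (2 * B / (r/2)^2) * cmod (?h k - 0) ^ Suc 1 / fact 1"
    proof (rule complex_Taylor[where S = "cball 0 r"])
      fix j x assume x: "x \<in> cball (0::complex) r" "j \<le> (1::nat)"
      have "(deriv ^^ j) (?u z) holomorphic_on ball 0 (2*r)" by (rule holomorphic_higher_deriv[OF hol[OF z]]) simp
      then have "((deriv ^^ j) (?u z) has_field_derivative deriv ((deriv ^^ j) (?u z)) x) (at x)"
        by (rule holomorphic_derivI) (use x r in auto)
      then show "((deriv ^^ j) (?u z) has_field_derivative (deriv ^^ Suc j) (?u z) x) (at x within cball 0 r)"
        by (simp add: has_field_derivative_at_within)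
    next
      show "cmod ((deriv ^^ Suc 1) (?u z) x) \<le> 2 * B / (r / 2)\<^sup>2" if "x \<in> cball 0 r" for x
        using b2[OF z that] by (simp add: numeral_2_eq_2)
    qed (use hk r in auto)
    moreover have "(\<Sum>j\<le>1. ?f j 0 * (?h k - 0) ^ j / fact j) = f z + partial_deriv i f z * ?h k"
      by (simp add: d0 del: of_real_divide)
    ultimately have "cmod (?u z (?h k) - (f z + partial_deriv i f z * ?h k)) \<le> (2 * B / (r/2)^2) * cmod (?h k) ^ 2"
      by (simp only: funpow_0 diff_zero fact_1 div_by_1 Suc_1)
    then have e: "cmod (?u z (?h k) - f z - partial_deriv i f z * ?h k) \<le> (2 * B / (r/2)^2) * (r / real (Suc k))^2"
      unfolding hn by (simp only: diff_diff_eq)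
    have nz: "?h k \<noteq> 0" using r by (simp only: of_real_eq_0_iff) simp
    have "?q k z - partial_deriv i f z = (?u z (?h k) - f z - partial_deriv i f z * ?h k) / ?h k"
      using nz unfolding ax[of "?h k"] by (simp add: diff_divide_distrib del: of_real_divide of_nat_Suc)
    then have "cmod (?q k z - partial_deriv i f z) = cmod (?u z (?h k) - f z - partial_deriv i f z * ?h k) / (r / real (Suc k))"
      by (simp only: norm_divide hn)
    also have "\<dots> \<le> (2 * B / (r/2)^2) * (r / real (Suc k))^2 / (r / real (Suc k))"
      using e r by (intro divide_right_mono) auto
    also have "\<dots> = (2 * B / (r/2)^2) * (r / real (Suc k))"
    proof -
      have "K * x\<^sup>2 / x = K * x" if "x > 0" for K x :: real using that by (simp add: power2_eq_square)
      then show ?thesis by this (use r in simp)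
    qed
    finally show ?thesis .
  qed
  have B0: "B \<ge> 0" using B[of a] r0 by (meson centre_in_cball less_imp_le norm_ge_zero order_trans)
  have ul: "uniform_limit (ball a r) ?q (partial_deriv i f) sequentially"
  proof (rule uniform_limitI)
    fix e :: real assume e: "e > 0"
    have "(\<lambda>k. (2 * B / (r/2)^2) * (r / real (Suc k))) \<longlonglongrightarrow> (2 * B / (r/2)^2) * 0"
      by (intro tendsto_intros LIMSEQ_Suc[OF lim_const_over_n])
    then have "\<forall>\<^sub>F k in sequentially. (2 * B / (r/2)^2) * (r / real (Suc k)) < e"
      using e by (auto dest: order_tendstoD)
    then show "\<forall>\<^sub>F k in sequentially. \<forall>x\<in>ball a r. dist (?q k x) (partial_deriv i f x) < e"
    proof eventually_elim
      case (elim k)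
      show ?case
      proof
        fix x assume "x \<in> ball a r"
        from est[OF this, of k] elim show "dist (?q k x) (partial_deriv i f x) < e"
          unfolding dist_norm by (rule le_less_trans)
      qed
    qed
  qed
  have "holo_on (ball a r) (?q k)" for k
  proof -
    have sub: "ball a r \<subseteq> U" using r0 r by (auto simp: r_def)
    have "holo_on (ball a r) (\<lambda>z. f (z + axis i (?h k)))"
      unfolding holo_on_def
    proof
      fix z assume z: "z \<in> ball a r"
      have hk: "cmod (?h k) \<le> 2 * r" using hle[of k] r by linarith
      have "z + axis i (?h k) \<in> U" using sc[OF z hk] r0 ax[of "?h k"] by auto
      then obtain D where D: "(f has_derivative D) (at (z + axis i (?h k)))" "\<forall>c v. D (c *s v) = c * D v"
        using f unfolding holo_on_def by blast
      have "((\<lambda>z. z + axis i (?h k)) has_derivative (\<lambda>v. v)) (at z)" by (auto intro!: derivative_eq_intros)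
      from has_derivative_compose[OF this D(1)] D(2)
      show "\<exists>D. ((\<lambda>z. f (z + axis i (?h k))) has_derivative D) (at z) \<and> (\<forall>c v. D (c *s v) = c * D v)" by blast
    qed
    then have "holo_on (ball a r) (\<lambda>z. (1 / ?h k) * (f (z + axis i (?h k)) - f z))"
      by (intro holo_on_cmult holo_on_diff holo_on_subset[OF f sub])
    then show ?thesis by (simp only: times_divide_eq_left mult_1)
  qed
  then show "\<exists>r>0. \<exists>F. uniform_limit (ball a r) F (partial_deriv i f) sequentially \<and> (\<forall>k. holo_on (ball a r) (F k))"
    using r ul by blast
qed

section \<open>Homogeneous expansions\<close>

lemma Hol_add: "f \<in> Hol \<Longrightarrow> g \<in> Hol \<Longrightarrow> (\<lambda>z. f z + g z) \<in> Hol"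
  by (simp add: Hol_iff_holo_on holo_on_add)

lemma Hol_mult: "f \<in> Hol \<Longrightarrow> g \<in> Hol \<Longrightarrow> (\<lambda>z. f z * g z) \<in> Hol"
  by (simp add: Hol_iff_holo_on holo_on_mult)

lemma Hol_diff: "f \<in> Hol \<Longrightarrow> g \<in> Hol \<Longrightarrow> (\<lambda>z. f z - g z) \<in> Hol"
  by (simp add: Hol_iff_holo_on holo_on_diff)

lemma Hol_cmult: "f \<in> Hol \<Longrightarrow> (\<lambda>z. c * f z) \<in> Hol"
  by (simp add: Hol_iff_holo_on holo_on_cmult)

lemma Hol_sum: "(\<And>i. i \<in> A \<Longrightarrow> f i \<in> Hol) \<Longrightarrow> (\<lambda>z. \<Sum>i\<in>A. f i z) \<in> Hol"
  by (simp add: Hol_iff_holo_on holo_on_sum)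

lemma Hol_const: "(\<lambda>z. c) \<in> Hol"
  by (simp add: Hol_iff_holo_on holo_on_const)

lemma Hol_homogeneous_poly: "homogeneous_poly n p \<Longrightarrow> p \<in> Hol"
  by (simp add: Hol_iff_holo_on holo_on_homogeneous_poly)

lemma Hol_partial_deriv: "f \<in> Hol \<Longrightarrow> partial_deriv i f \<in> Hol"
  by (simp add: Hol_iff_holo_on holo_on_partial_deriv)

lemma Hol_radial_deriv: "f \<in> Hol \<Longrightarrow> radial_deriv f \<in> Hol"
  unfolding radial_deriv_def[abs_def]
  by (intro Hol_sum Hol_mult Hol_partial_deriv) (simp_all add: Hol_iff_holo_on holo_on_vec_nth)

lemma Hol_radial_deriv_funpow: "f \<in> Hol \<Longrightarrow> (radial_deriv ^^ N) f \<in> Hol"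
  by (induction N) (auto intro: Hol_radial_deriv)

lemma continuous_on_Hol: "f \<in> Hol \<Longrightarrow> continuous_on unit_ball f"
  by (simp add: Hol_iff_holo_on continuous_on_holo_on)

text \<open>This is n! times the homogeneous part of degree n: the n-fold derivative of
  \<open>f\<close> at 0 in direction \<open>z\<close>. Recursion on the partial derivatives makes
  homogeneity in \<open>z\<close> evident.\<close>

primrec taylor_part :: "nat \<Rightarrow> (complex ^ 'd::finite \<Rightarrow> complex) \<Rightarrow> complex ^ 'd \<Rightarrow> complex"
  where
    "taylor_part 0 f z = f 0"
  | "taylor_part (Suc n) f z = (\<Sum>i\<in>UNIV. z $ i * taylor_part n (partial_deriv i f) z)"

declare taylor_part.simps [simp del]

lemma homogeneous_poly_taylor_part: "homogeneous_poly n (taylor_part n f)"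
proof (induction n arbitrary: f)
  case 0
  show ?case unfolding taylor_part.simps[abs_def] by (rule homogeneous_poly_const)
next
  case (Suc n)
  show ?case unfolding taylor_part.simps[abs_def]
    by (intro homogeneous_poly_sum homogeneous_poly_vec_nth_mult Suc)
qed

lemma open_line_preimage: "open {t. norm (t *s (z :: complex ^ 'd::finite)) < 1}"
  by (intro open_Collect_less continuous_intros linear_continuous_on bounded_linear_vector_smult_left)

lemma holomorphic_on_line:
  fixes f :: "complex ^ 'd::finite \<Rightarrow> complex"
  assumes "f \<in> Hol"
  shows "(\<lambda>t. f (t *s z)) holomorphic_on {t. norm (t *s z) < 1}"
    and "norm (t *s z) < 1 \<Longrightarrow> deriv (\<lambda>t. f (t *s z)) t = (\<Sum>i\<in>UNIV. z $ i * partial_deriv i f (t *s z))"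
proof -
  have der: "((\<lambda>t. f (t *s z)) has_field_derivative (\<Sum>i\<in>UNIV. z $ i * partial_deriv i f (t *s z))) (at t)"
    if "norm (t *s z) < 1" for t
    using holo_on_has_field_derivative_line[of unit_ball f 0 t z] assms that by (simp add: Hol_iff_holo_on)
  show "(\<lambda>t. f (t *s z)) holomorphic_on {t. norm (t *s z) < 1}"
    unfolding holomorphic_on_def field_differentiable_def
    by (intro ballI exI, rule has_field_derivative_at_within, rule der) simp
  show "norm (t *s z) < 1 \<Longrightarrow> deriv (\<lambda>t. f (t *s z)) t = (\<Sum>i\<in>UNIV. z $ i * partial_deriv i f (t *s z))"
    by (rule DERIV_imp_deriv) (rule der)
qed

lemma higher_deriv_sum_cmult:
  assumes "open S" "z \<in> S" "\<And>i. i \<in> A \<Longrightarrow> f i holomorphic_on S"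
  shows "(deriv ^^ n) (\<lambda>w. \<Sum>i\<in>A. c i * f i w) z = (\<Sum>i\<in>A. c i * (deriv ^^ n) (f i) z)"
  using assms(3)
proof (induction A rule: infinite_finite_induct)
  case (insert i A)
  have "(deriv ^^ n) (\<lambda>w. c i * f i w + (\<Sum>i\<in>A. c i * f i w)) z
     = (deriv ^^ n) (\<lambda>w. c i * f i w) z + (deriv ^^ n) (\<lambda>w. \<Sum>i\<in>A. c i * f i w) z"
    using insert.prems by (intro higher_deriv_add[OF _ _ assms(1,2)] holomorphic_intros) auto
  also have "(deriv ^^ n) (\<lambda>w. c i * f i w) z = c i * (deriv ^^ n) (f i) z"
    using insert.prems by (intro higher_deriv_cmult[OF _ assms(2,1)]) auto
  finally show ?case using insert by simp
qed (simp_all)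

text \<open>One derivative in \<open>t\<close> turns \<open>f\<close> into the combination of its
  partial derivatives with coefficients \<open>z $ i\<close>, restricted to the same line; these are
  holomorphic again, so the induction is over all \<open>f\<close>.\<close>

lemma higher_deriv_line:
  fixes f :: "complex ^ 'd::finite \<Rightarrow> complex"
  assumes "f \<in> Hol"
  shows "(deriv ^^ n) (\<lambda>t. f (t *s z)) 0 = taylor_part n f z"
  using assms
proof (induction n arbitrary: f)
  case 0
  then show ?case by (simp add: taylor_part.simps)
next
  case (Suc n)
  let ?S = "{t. norm (t *s z) < 1}"
  have "\<forall>\<^sub>F t in nhds 0. t \<in> ?S"
    by (rule eventually_nhds_in_open[OF open_line_preimage]) simp
  then have "\<forall>\<^sub>F t in nhds 0. deriv (\<lambda>t. f (t *s z)) t = (\<Sum>i\<in>UNIV. z $ i * partial_deriv i f (t *s z))"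
    by eventually_elim (use holomorphic_on_line(2)[OF Suc.prems] in auto)
  then have "(deriv ^^ n) (deriv (\<lambda>t. f (t *s z))) 0 = (deriv ^^ n) (\<lambda>t. \<Sum>i\<in>UNIV. z $ i * partial_deriv i f (t *s z)) 0"
    by (rule higher_deriv_cong_ev) simp
  also have "\<dots> = (\<Sum>i\<in>UNIV. z $ i * (deriv ^^ n) (\<lambda>t. partial_deriv i f (t *s z)) 0)"
    by (rule higher_deriv_sum_cmult[OF open_line_preimage[of z]])
       (auto intro: holomorphic_on_line Hol_partial_deriv Suc.prems)
  also have "\<dots> = (\<Sum>i\<in>UNIV. z $ i * taylor_part n (partial_deriv i f) z)"
    by (simp add: Suc.IH Hol_partial_deriv Suc.prems)
  finally show ?case by (simp add: taylor_part.simps funpow_Suc_right del: funpow.simps)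
qed

lemma taylor_part_sums:
  fixes f :: "complex ^ 'd::finite \<Rightarrow> complex"
  assumes f: "f \<in> Hol" and z: "z \<in> unit_ball"
  shows "(\<lambda>n. taylor_part n f z / fact n) sums f z"
proof -
  \<comment> \<open>A radius between 1 and \<open>1 / norm z\<close> that also makes sense for
    \<open>z = 0\<close>; the power series of the restriction to the line is then evaluated at
    1.\<close>
  define r where "r = 2 / (1 + norm z)"
  have "1 + norm z > 0" by (simp add: add_pos_nonneg)
  then have r: "r > 1" "r * norm z < 1" using z by (auto simp: r_def field_simps)
  have "ball 0 r \<subseteq> {t. norm (t *s z) < 1}"
  proof clarify
    fix t assume "t \<in> ball (0::complex) r"
    then have "cmod t * norm z \<le> r * norm z" by (intro mult_right_mono) auto
    then show "norm (t *s z) < 1" using r by (simp add: norm_vector_smult_complex)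
  qed
  then have "(\<lambda>t. f (t *s z)) holomorphic_on ball 0 r"
    using holomorphic_on_line(1)[OF f] holomorphic_on_subset by blast
  from holomorphic_power_series[OF this, of 1] r show ?thesis
    by (simp add: higher_deriv_line[OF f])
qed

text \<open>On a line through 0 the difference of the two series is a power series in
  \<open>t\<close> that vanishes near 0, so all its coefficients vanish. The line may pass through
  any \<open>z\<close>, which gives equality also off the ball.\<close>

lemma homogeneous_poly_series_unique:
  fixes p q :: "nat \<Rightarrow> complex ^ 'd::finite \<Rightarrow> complex"
  assumes p: "\<And>n. homogeneous_poly n (p n)" "\<And>z. z \<in> unit_ball \<Longrightarrow> (\<lambda>n. p n z) sums f z"
    and q: "\<And>n. homogeneous_poly n (q n)" "\<And>z. z \<in> unit_ball \<Longrightarrow> (\<lambda>n. q n z) sums f z"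
  shows "p = q"
proof (intro ext)
  fix n z
  define a where "a n = p n z - q n z" for n
  \<comment> \<open>Small enough for \<open>t *s z\<close> to lie in the ball when
    \<open>cmod t < r\<close>, wherever \<open>z\<close> is.\<close>
  define r where "r = 1 / (1 + norm z)"
  have r: "r > 0" by (simp add: r_def add_pos_nonneg)
  have s: "(\<lambda>n. a n * (t - 0) ^ n) sums 0" if t: "cmod (t - 0) < r" for t
  proof -
    have "cmod t * (1 + norm z) < 1" using t by (simp add: r_def field_simps add_pos_nonneg)
    then have "norm (t *s z) < 1"
      by (simp add: norm_vector_smult_complex) (smt (verit) mult_left_mono norm_ge_zero distrib_left mult.right_neutral)
    then have "(\<lambda>n. p n (t *s z) - q n (t *s z)) sums (f (t *s z) - f (t *s z))"
      by (intro sums_diff p q) simp_all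
    then show ?thesis
      by (simp add: homogeneous_poly_smult[OF p(1)] homogeneous_poly_smult[OF q(1)] a_def algebra_simps)
  qed
  have "(\<lambda>n. a n * 0 ^ n) sums 0" using s[of 0] r by simp
  then have a0: "a 0 = 0" using sums_unique2 powser_sums_zero by blast
  have "a n = 0" 
  proof (rule ccontr)
    assume n: "a n \<noteq> 0"
    then have "n > 0" using a0 by (cases n) auto
    \<comment> \<open>A nonzero coefficient would make 0 an isolated zero of the sum, yet the sum is
      identically 0.\<close>
    obtain t where t: "0 < t" "\<And>z::complex. z \<in> cball 0 t - {0} \<Longrightarrow> (0::complex) \<noteq> 0"
      by (rule powser_0_nonzero[of r 0 a "\<lambda>_. 0", OF r s _ n \<open>n > 0\<close>]) auto
    from t(2)[of "of_real t"] t(1) show False by simp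
  qed
  then show "p n z = q n z" by (simp add: a_def)
qed

text \<open>Uniqueness makes the definite description computable; every expansion below is found
  through this rule.\<close>

lemma hom_expansionI:
  fixes p :: "nat \<Rightarrow> complex ^ 'd::finite \<Rightarrow> complex"
  assumes "\<And>n. homogeneous_poly n (p n)" "\<And>z. z \<in> unit_ball \<Longrightarrow> (\<lambda>n. p n z) sums f z"
  shows "hom_expansion f = p"
  unfolding hom_expansion_def using assms homogeneous_poly_series_unique
  by (intro the_equality) (blast+)

lemma hom_expansion_taylor:
  "f \<in> Hol \<Longrightarrow> hom_expansion f = (\<lambda>n z. taylor_part n f z / fact n)"
  using homogeneous_poly_cmult[OF homogeneous_poly_taylor_part, of _ "1 / fact _" f]
  by (intro hom_expansionI taylor_part_sums) simp_all

lemma homogeneous_poly_hom_expansion: "f \<in> Hol \<Longrightarrow> homogeneous_poly n (hom_expansion f n)"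
  using homogeneous_poly_cmult[OF homogeneous_poly_taylor_part, of n "1 / fact n" f]
  by (simp add: hom_expansion_taylor)

lemma hom_expansion_sums: "f \<in> Hol \<Longrightarrow> z \<in> unit_ball \<Longrightarrow> (\<lambda>n. hom_expansion f n z) sums f z"
  by (simp add: hom_expansion_taylor taylor_part_sums)

lemma hom_expansion_cong: "(\<And>z. z \<in> unit_ball \<Longrightarrow> f z = g z) \<Longrightarrow> hom_expansion f = hom_expansion g"
  unfolding hom_expansion_def by (metis (no_types, lifting))

lemma hom_expansion_0: "f \<in> Hol \<Longrightarrow> hom_expansion f 0 z = f 0"
  by (simp add: hom_expansion_taylor taylor_part.simps)

lemma hom_expansion_add:
  "f \<in> Hol \<Longrightarrow> g \<in> Hol \<Longrightarrow> hom_expansion (\<lambda>z. f z + g z) = (\<lambda>n z. hom_expansion f n z + hom_expansion g n z)"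
  by (intro hom_expansionI homogeneous_poly_add homogeneous_poly_hom_expansion sums_add hom_expansion_sums)

lemma hom_expansion_cmult:
  "f \<in> Hol \<Longrightarrow> hom_expansion (\<lambda>z. c * f z) = (\<lambda>n z. c * hom_expansion f n z)"
  by (intro hom_expansionI homogeneous_poly_cmult homogeneous_poly_hom_expansion sums_mult hom_expansion_sums)

lemma hom_expansion_sum:
  "(\<And>i. i \<in> A \<Longrightarrow> f i \<in> Hol) \<Longrightarrow> hom_expansion (\<lambda>z. \<Sum>i\<in>A. f i z) = (\<lambda>n z. \<Sum>i\<in>A. hom_expansion (f i) n z)"
  by (intro hom_expansionI homogeneous_poly_sum homogeneous_poly_hom_expansion sums_sum hom_expansion_sums)

lemma hom_expansion_homogeneous_poly:
  assumes "homogeneous_poly m p"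
  shows "hom_expansion p = (\<lambda>n z. if n = m then p z else 0)"
proof (rule hom_expansionI)
  show "homogeneous_poly n (\<lambda>z. if n = m then p z else 0)" for n
    using assms by (cases "n = m") (simp_all add: homogeneous_poly_zero)
  show "(\<lambda>n. if n = m then p z else 0) sums p z" for z
    using sums_single[of m "\<lambda>_. p z"] by simp
qed

text \<open>The partial derivatives are holomorphic, so their own expansions converge; summing
  \<open>z $ i\<close> times these takes the place of termwise differentiation.\<close>

lemma hom_expansion_radial_deriv:
  assumes f: "f \<in> Hol"
  shows "hom_expansion (radial_deriv f) = (\<lambda>n z. of_nat n * hom_expansion f n z)"
proof (rule hom_expansionI)
  show "homogeneous_poly n (\<lambda>z. of_nat n * hom_expansion f n z)" for n
    by (intro homogeneous_poly_cmult homogeneous_poly_hom_expansion f)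
  fix z :: "complex ^ 'a" assume z: "z \<in> unit_ball"
  \<comment> \<open>The recursion of \<open>taylor_part\<close> meets n! where (n + 1)! would be
    expected, which leaves the factor n + 1.\<close>
  have eq: "(\<Sum>i\<in>UNIV. z $ i * hom_expansion (partial_deriv i f) n z) = of_nat (Suc n) * hom_expansion f (Suc n) z" for n
    by (simp add: hom_expansion_taylor f Hol_partial_deriv taylor_part.simps sum_divide_distrib[symmetric] del: of_nat_Suc)
  have "(\<lambda>n. \<Sum>i\<in>UNIV. z $ i * hom_expansion (partial_deriv i f) n z) sums radial_deriv f z"
    unfolding radial_deriv_def by (intro sums_sum sums_mult hom_expansion_sums Hol_partial_deriv f z)
  then have "(\<lambda>n. of_nat (Suc n) * hom_expansion f (Suc n) z) sums radial_deriv f z"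
    unfolding eq .
  from sums_Suc[OF this] show "(\<lambda>n. of_nat n * hom_expansion f n z) sums radial_deriv f z" by simp
qed

lemma hom_expansion_radial_deriv_funpow:
  "f \<in> Hol \<Longrightarrow> hom_expansion ((radial_deriv ^^ N) f) = (\<lambda>n z. of_nat n ^ N * hom_expansion f n z)"
  by (induction N) (simp_all add: hom_expansion_radial_deriv Hol_radial_deriv_funpow mult.assoc)

lemma bounded_Hol_cball:
  assumes "f \<in> Hol" "R < 1"
  obtains M where "M \<ge> 0" "\<And>z. norm z \<le> R \<Longrightarrow> cmod (f z) \<le> M"
proof -
  have "compact (f ` cball 0 R)"
    using continuous_on_Hol[OF assms(1)] assms(2)
    by (intro compact_continuous_image) (auto intro: continuous_on_subset)
  then obtain B where "\<And>w. w \<in> cball 0 R \<Longrightarrow> cmod (f w) \<le> B"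
    by (metis bounded_iff compact_imp_bounded imageI)
  then show ?thesis by (intro that[of "max 0 B"]) (auto simp: le_max_iff_disj)
qed

text \<open>Cauchy's inequality on the disc of radius \<open>R / norm z\<close> in the line through
  \<open>z\<close>. The component is a polynomial, so the estimate extends to every
  \<open>z\<close>.\<close>

lemma hom_expansion_cauchy_bound:
  fixes f :: "complex ^ 'd::finite \<Rightarrow> complex"
  assumes f: "f \<in> Hol" and R: "0 < R" "R < 1" and M: "\<And>z. norm z \<le> R \<Longrightarrow> cmod (f z) \<le> M"
  shows "cmod (hom_expansion f n z) \<le> M * (norm z / R) ^ n"
proof (cases "z = 0")
  case True
  show ?thesis
  proof (cases n)
    case 0
    then show ?thesis using M[of 0] R f by (simp add: hom_expansion_0)
  next
    case (Suc k)
    then show ?thesis using homogeneous_poly_smult[OF homogeneous_poly_hom_expansion[OF f, of n], of 0 0] True by simp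
  qed
next
  case False
  define r where "r = R / norm z"
  have r: "r > 0" using False R by (simp add: r_def)
  have le: "norm (t *s z) \<le> R" if "cmod t \<le> r" for t
    using that False by (simp add: norm_vector_smult_complex r_def field_simps)
  have sub: "cball 0 r \<subseteq> {t. norm (t *s z) < 1}" using le R by force
  have "cmod ((deriv ^^ n) (\<lambda>t. f (t *s z)) 0) \<le> fact n * M / r ^ n"
  proof (rule Cauchy_inequality)
    show "(\<lambda>t. f (t *s z)) holomorphic_on ball 0 r"
      using holomorphic_on_line(1)[OF f] sub holomorphic_on_subset ball_subset_cball by (meson order_trans)
    show "continuous_on (cball 0 r) (\<lambda>t. f (t *s z))"
      using holomorphic_on_line(1)[OF f] sub holomorphic_on_imp_continuous_on holomorphic_on_subset by blast
  qed (use M le r in auto)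
  then show ?thesis
    by (simp add: higher_deriv_line f hom_expansion_taylor norm_divide r_def field_simps)
qed

lemma hom_expansion_bound:
  fixes f :: "complex ^ 'd::finite \<Rightarrow> complex"
  assumes f: "f \<in> Hol" and R: "0 < R" "R < 1"
  obtains M where "M \<ge> 0" "\<And>n z. cmod (hom_expansion f n z) \<le> M * (norm z / R) ^ n"
  using bounded_Hol_cball[OF f R(2)] hom_expansion_cauchy_bound[OF f R] by metis

lemma summable_norm_hom_expansion:
  assumes f: "f \<in> Hol" and z: "norm z < 1"
  shows "summable (\<lambda>n. norm (hom_expansion f n z))"
proof -
  define R where "R = (1 + norm z) / 2"
  have R: "0 < R" "R < 1" "norm z < R" using z by (auto simp: R_def add_pos_nonneg)
  obtain M where M: "M \<ge> 0" "\<And>n z. cmod (hom_expansion f n z) \<le> M * (norm z / R) ^ n"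
    using hom_expansion_bound[OF f R(1,2)] by blast
  show ?thesis
  proof (rule summable_comparison_test'[of "\<lambda>n. M * (norm z / R) ^ n" 0])
    show "summable (\<lambda>n. M * (norm z / R) ^ n)"
      using R by (intro summable_mult summable_geometric) (simp add: norm_divide)
  qed (use M in auto)
qed

lemma hom_expansion_mult:
  assumes f: "f \<in> Hol" and g: "g \<in> Hol"
  shows "hom_expansion (\<lambda>z. f z * g z) = (\<lambda>n z. \<Sum>i\<le>n. hom_expansion f i z * hom_expansion g (n - i) z)"
proof (rule hom_expansionI)
  show "homogeneous_poly n (\<lambda>z. \<Sum>i\<le>n. hom_expansion f i z * hom_expansion g (n - i) z)" for n
  proof (intro homogeneous_poly_sum)
    fix i assume "i \<in> {..n}"
    then show "homogeneous_poly n (\<lambda>z. hom_expansion f i z * hom_expansion g (n - i) z)"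
      using homogeneous_poly_mult[OF homogeneous_poly_hom_expansion[OF f, of i] homogeneous_poly_hom_expansion[OF g, of "n - i"]]
      by simp
  qed
  fix z :: "complex ^ 'a" assume z: "z \<in> unit_ball"
  have "(\<lambda>n. \<Sum>i\<le>n. hom_expansion f i z * hom_expansion g (n - i) z) sums
      ((\<Sum>n. hom_expansion f n z) * (\<Sum>n. hom_expansion g n z))"
    using z by (intro Cauchy_product_sums summable_norm_hom_expansion f g) simp_all
  then show "(\<lambda>n. \<Sum>i\<le>n. hom_expansion f i z * hom_expansion g (n - i) z) sums (f z * g z)"
    using sums_unique[OF hom_expansion_sums[OF f z]] sums_unique[OF hom_expansion_sums[OF g z]] by simp
qed

section \<open>Radial weights\<close>

lemma space_V: "space V = unit_ball"
  by (simp add: V_def space_restrict_space)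

lemma sets_V: "sets V = sets (lebesgue_on unit_ball)"
  by (simp add: V_def)

lemma measurable_V_eq: "measurable V N = measurable (lebesgue_on unit_ball) N"
  by (rule measurable_cong_sets) (simp_all add: sets_V)

definition ball_volume :: "'d::finite itself \<Rightarrow> real"
  where "ball_volume _ = measure lborel (unit_ball :: (complex ^ 'd) set)"

lemma ball_volume_pos: "ball_volume TYPE('d::finite) > 0"
  unfolding ball_volume_def using content_ball_pos[of 1 "0 :: complex ^ 'd"] by simp

lemma emeasure_unit_ball: "emeasure lborel (unit_ball :: (complex ^ 'd::finite) set) = ennreal (ball_volume TYPE('d))"
  unfolding ball_volume_def using emeasure_lborel_ball_finite[of "0 :: complex ^ 'd" 1]
  by (subst emeasure_eq_ennreal_measure) auto

lemma emeasure_lebesgue_on_unit_ball: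
  "emeasure (lebesgue_on unit_ball) (unit_ball :: (complex ^ 'd::finite) set) = ennreal (ball_volume TYPE('d))"
  by (simp add: emeasure_restrict_space emeasure_unit_ball)

lemma emeasure_V_space: "emeasure V (space V :: (complex ^ 'd::finite) set) = 1"
  unfolding space_V unfolding V_def using ball_volume_pos[where 'd = 'd]
  by (intro emeasure_uniform_measure_1) (simp_all add: emeasure_lebesgue_on_unit_ball)

lemma finite_measure_V: "finite_measure (V :: (complex ^ 'd::finite) measure)"
  by (rule finite_measureI) (simp add: emeasure_V_space)

lemma borel_measurable_V: "g \<in> borel_measurable borel \<Longrightarrow> g \<in> borel_measurable V"
  unfolding measurable_V_eq by (intro measurable_restrict_space1 measurable_completion) simp

lemma borel_measurable_V_continuous_on: "continuous_on unit_ball g \<Longrightarrow> g \<in> borel_measurable V"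
  unfolding measurable_V_eq by (rule continuous_imp_measurable_on_sets_lebesgue) auto

lemma borel_measurable_V_id: "(\<lambda>z. z) \<in> borel_measurable V"
  by (rule borel_measurable_V) simp

lemma nn_integral_V:
  fixes g :: "complex ^ 'd::finite \<Rightarrow> ennreal"
  assumes "g \<in> borel_measurable V"
  shows "(\<integral>\<^sup>+z. g z \<partial>V) = (\<integral>\<^sup>+z. g z * indicator unit_ball z \<partial>lborel) / ennreal (ball_volume TYPE('d))"
  using assms unfolding V_def
  by (subst nn_integral_uniform_measure)
     (auto simp: measurable_V_eq[unfolded V_def] emeasure_lebesgue_on_unit_ball nn_integral_restrict_space nn_integral_completion sets_restrict_space
        intro!: arg_cong2[where f = "(/)"] nn_integral_cong split: split_indicator)

lemma integral_V:
  fixes g :: "complex ^ 'd::finite \<Rightarrow> 'b :: {banach, second_countable_topology}"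
  assumes "g \<in> borel_measurable borel"
  shows "(LINT z|V. g z) = (1 / ball_volume TYPE('d)) *\<^sub>R (LINT z|lborel. indicator unit_ball z *\<^sub>R g z)"
proof -
  let ?v = "ball_volume TYPE('d)"
  have eq: "(V :: (complex ^ 'd) measure) = density (lebesgue_on unit_ball) (\<lambda>z. ennreal (indicator unit_ball z / ?v))"
    unfolding V_def uniform_measure_def emeasure_lebesgue_on_unit_ball
    by (intro arg_cong2[where f = density] ext refl)
       (auto split: split_indicator simp: divide_ennreal[OF _ ball_volume_pos] simp flip: ennreal_1)
  have gm: "g \<in> borel_measurable (lebesgue_on unit_ball)"
    using borel_measurable_V[OF assms] by (simp add: measurable_V_eq)
  have im: "(\<lambda>z. indicator unit_ball z / ?v) \<in> borel_measurable (lebesgue_on unit_ball)"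
    by (intro borel_measurable_divide borel_measurable_indicator borel_measurable_const) (auto simp: sets_restrict_space)
  have "(LINT z|V. g z) = (LINT z|lebesgue_on unit_ball. (indicator unit_ball z / ?v) *\<^sub>R g z)"
    unfolding eq using ball_volume_pos[where 'd = 'd] by (intro integral_density gm im) auto
  also have "\<dots> = (LINT z|lebesgue. indicator unit_ball z *\<^sub>R ((indicator unit_ball z / ?v) *\<^sub>R g z))"
    by (rule integral_restrict_space) auto
  also have "\<dots> = (LINT z|lborel. indicator unit_ball z *\<^sub>R ((indicator unit_ball z / ?v) *\<^sub>R g z))"
  proof (rule integral_completion)
    have [measurable]: "(unit_ball :: (complex ^ 'd) set) \<in> sets borel" by simp
    note [measurable] = assms
    show "(\<lambda>z. indicator unit_ball z *\<^sub>R (indicator unit_ball z / ?v) *\<^sub>R g z) \<in> borel_measurable lborel"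
      by measurable
  qed
  also have "\<dots> = (LINT z|lborel. (1 / ?v) *\<^sub>R (indicator unit_ball z *\<^sub>R g z))"
    by (rule Bochner_Integration.integral_cong) (auto split: split_indicator)
  finally show ?thesis by (simp only: integral_scaleR_right)
qed

lemma integrable_V_bounded:
  fixes g :: "complex ^ 'd::finite \<Rightarrow> 'b :: {banach, second_countable_topology}"
  assumes "g \<in> borel_measurable V" "\<And>z. z \<in> unit_ball \<Longrightarrow> norm (g z) \<le> B"
  shows "integrable V g"
proof -
  interpret finite_measure "V :: (complex ^ 'd) measure" by (rule finite_measure_V)
  show ?thesis by (rule integrable_const_bound[of _ B]) (use assms in \<open>auto simp: space_V\<close>)
qed

lemma integrable_V_continuous:
  fixes g :: "complex ^ 'd::finite \<Rightarrow> 'b :: {banach, second_countable_topology}"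
  assumes "continuous_on UNIV g"
  shows "integrable V g"
proof -
  have "compact (g ` cball 0 1)" using assms by (intro compact_continuous_image) (auto intro: continuous_on_subset)
  then obtain B where "\<And>z. z \<in> cball 0 1 \<Longrightarrow> norm (g z) \<le> B" by (metis bounded_iff compact_imp_bounded imageI)
  then show ?thesis
    by (intro integrable_V_bounded[where B = B] borel_measurable_V borel_measurable_continuous_onI assms) auto
qed

text \<open>A dilation of real dimension \<open>2 * CARD('d)\<close>; the normalising volume
  cancels.\<close>

lemma nn_integral_V_scale:
  fixes g :: "complex ^ 'd::finite \<Rightarrow> ennreal"
  assumes [measurable]: "g \<in> borel_measurable borel" and r: "0 < r" "r \<le> 1"
  shows "(\<integral>\<^sup>+z. g z * indicator (ball 0 r) z \<partial>V) = ennreal (r ^ (2 * CARD('d))) * (\<integral>\<^sup>+z. g (r *\<^sub>R z) \<partial>V)"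
proof -
  have "(\<integral>\<^sup>+z. g z * indicator (ball 0 r) z * indicator unit_ball z \<partial>lborel) = (\<integral>\<^sup>+z. g z * indicator (ball 0 r) z \<partial>lborel)"
    using r by (intro nn_integral_cong) (auto split: split_indicator)
  also have "\<dots> = (\<integral>\<^sup>+z. g z * indicator (ball 0 r) z
      \<partial>density (distr lborel borel (\<lambda>x. 0 + r *\<^sub>R x)) (\<lambda>_. \<bar>r\<bar> ^ DIM(complex ^ 'd)))"
    using r by (subst lborel_affine[of r "0 :: complex ^ 'd"]) simp_all
  also have "\<dots> = ennreal (r ^ (2 * CARD('d))) * (\<integral>\<^sup>+z. g (r *\<^sub>R z) * indicator (ball 0 r) (r *\<^sub>R z) \<partial>lborel)"
  proof -
    have [measurable]: "(\<lambda>x. 0 + r *\<^sub>R x) \<in> borel_measurable (lborel :: (complex ^ 'd) measure)" by simp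
    have [measurable]: "ball (0 :: complex ^ 'd) r \<in> sets borel" by simp
    show ?thesis
      using r by (subst nn_integral_density; (subst nn_integral_distr | measurable)?)
        (auto simp: nn_integral_cmult mult.commute)
  qed
  also have "(\<integral>\<^sup>+z. g (r *\<^sub>R z) * indicator (ball 0 r) (r *\<^sub>R z) \<partial>lborel)
    = (\<integral>\<^sup>+z. g (r *\<^sub>R z) * indicator unit_ball z \<partial>lborel)"
    using r by (intro nn_integral_cong) (auto split: split_indicator simp: field_simps)
  finally have eq: "(\<integral>\<^sup>+z. g z * indicator (ball 0 r) z * indicator unit_ball z \<partial>lborel)
    = ennreal (r ^ (2 * CARD('d))) * (\<integral>\<^sup>+z. g (r *\<^sub>R z) * indicator unit_ball z \<partial>lborel)" .
  have [measurable]: "ball (0 :: complex ^ 'd) r \<in> sets borel" by simp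
  have "(\<lambda>z. g z * indicator (ball 0 r) z) \<in> borel_measurable V" "(\<lambda>z. g (r *\<^sub>R z)) \<in> borel_measurable V"
    by (rule borel_measurable_V; measurable)+
  then show ?thesis by (simp add: nn_integral_V eq ennreal_times_divide)
qed

definition radial_weight :: "real \<Rightarrow> complex ^ 'd::finite \<Rightarrow> real"
  where "radial_weight \<beta> z = (1 - (norm z)\<^sup>2) powr \<beta>"

lemma radial_weight_nonneg: "radial_weight \<beta> z \<ge> 0"
  by (simp add: radial_weight_def)

lemma radial_weight_pos: "z \<in> unit_ball \<Longrightarrow> radial_weight \<beta> z > 0"
  using power_strict_mono[of "norm z" 1 2] by (simp add: radial_weight_def)

lemma radial_weight_le_1: "\<beta> \<ge> 0 \<Longrightarrow> z \<in> unit_ball \<Longrightarrow> radial_weight \<beta> z \<le> 1"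
  using power_strict_mono[of "norm z" 1 2] by (simp add: radial_weight_def powr_le1)

lemma borel_measurable_radial_weight [measurable]: "radial_weight \<beta> \<in> borel_measurable borel"
  unfolding radial_weight_def[abs_def] by measurable

section \<open>Layer-cake integration and the moments of radial weights\<close>

lemma nn_integral_beta_tail:
  fixes \<beta> r :: real
  assumes b: "\<beta> > 0" and r: "0 \<le> r" "r < 1"
  shows "(\<integral>\<^sup>+u. ennreal (\<beta> * (1 - u) powr (\<beta> - 1)) * indicator {r<..<1} u \<partial>lborel) = ennreal ((1 - r) powr \<beta>)"
proof -
  have "((\<lambda>u. \<beta> * (1 - u) powr (\<beta> - 1)) has_integral (- ((1 - 1) powr \<beta>) - (- ((1 - r) powr \<beta>)))) {r..1}"
  \<comment> \<open>For \<open>\<beta> < 1\<close> the integrand is unbounded at 1, but the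
    antiderivative is continuous up to that end point.\<close>
  proof (rule fundamental_theorem_of_calculus_interior)
    show "continuous_on {r..1} (\<lambda>u. - ((1 - u) powr \<beta>))"
      using b by (intro continuous_intros continuous_on_powr') auto
    show "((\<lambda>u. - ((1 - u) powr \<beta>)) has_vector_derivative \<beta> * (1 - u) powr (\<beta> - 1)) (at u)" if "u \<in> {r<..<1}" for u
      unfolding has_real_derivative_iff_has_vector_derivative[symmetric]
      using that by (auto intro!: derivative_eq_intros)
  qed (use r in auto)
  then have "((\<lambda>u. \<beta> * (1 - u) powr (\<beta> - 1)) has_integral (1 - r) powr \<beta>) {r<..<1}"
    by (simp add: has_integral_Icc_iff_Ioo)
  then have "((\<lambda>u. if u \<in> {r<..<1} then \<beta> * (1 - u) powr (\<beta> - 1) else 0) has_integral (1 - r) powr \<beta>) UNIV"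
    by (simp only: has_integral_restrict_UNIV)
  then have "(\<integral>\<^sup>+u. ennreal (if u \<in> {r<..<1} then \<beta> * (1 - u) powr (\<beta> - 1) else 0) \<partial>lborel) = ennreal ((1 - r) powr \<beta>)"
    using b by (intro nn_integral_has_integral_lborel) auto
  also have "(\<integral>\<^sup>+u. ennreal (if u \<in> {r<..<1} then \<beta> * (1 - u) powr (\<beta> - 1) else 0) \<partial>lborel)
    = (\<integral>\<^sup>+u. ennreal (\<beta> * (1 - u) powr (\<beta> - 1)) * indicator {r<..<1} u \<partial>lborel)"
    by (intro nn_integral_cong) (auto split: split_indicator)
  finally show ?thesis .
qed

text \<open>Layer-cake formula: the superlevel sets of a radial weight are balls.\<close>

lemma nn_integral_V_radial_weight:
  fixes g :: "complex ^ 'd::finite \<Rightarrow> ennreal"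
  assumes [measurable]: "g \<in> borel_measurable borel" and b: "\<beta> > 0"
  shows "(\<integral>\<^sup>+z. g z * ennreal (radial_weight \<beta> z) \<partial>V) =
    (\<integral>\<^sup>+u. ennreal (\<beta> * (1 - u) powr (\<beta> - 1)) * indicator {0<..<1} u *
        (\<integral>\<^sup>+z. g z * indicator (ball 0 (sqrt u)) z \<partial>V) \<partial>lborel)"
proof -
  interpret finite_measure "V :: (complex ^ 'd) measure" by (rule finite_measure_V)
  interpret pair_sigma_finite "V :: (complex ^ 'd) measure" "lborel :: real measure" ..
  note [measurable] = borel_measurable_V[OF assms(1)] borel_measurable_V_id
  let ?h = "\<lambda>z u. ennreal (\<beta> * (1 - u) powr (\<beta> - 1)) * indicator {0<..<1} u * (g z * (if (norm z)\<^sup>2 < u then 1 else 0))"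
  have w: "ennreal (radial_weight \<beta> z) =
      (\<integral>\<^sup>+u. ennreal (\<beta> * (1 - u) powr (\<beta> - 1)) * indicator {(norm z)\<^sup>2<..<1} u \<partial>lborel)"
    if "z \<in> unit_ball" for z :: "complex ^ 'd"
    using that b power_strict_mono[of "norm z" 1 2] by (subst nn_integral_beta_tail) (auto simp: radial_weight_def)
  have "(\<integral>\<^sup>+z. g z * ennreal (radial_weight \<beta> z) \<partial>V) = (\<integral>\<^sup>+z. (\<integral>\<^sup>+u. ?h z u \<partial>lborel) \<partial>V)"
  proof (rule nn_integral_cong)
    fix z :: "complex ^ 'd" assume "z \<in> space V"
    then have "g z * ennreal (radial_weight \<beta> z) =
      (\<integral>\<^sup>+u. g z * (ennreal (\<beta> * (1 - u) powr (\<beta> - 1)) * indicator {(norm z)\<^sup>2<..<1} u) \<partial>lborel)"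
      using w by (subst nn_integral_cmult) (auto simp: space_V)
    also have "\<dots> = (\<integral>\<^sup>+u. ?h z u \<partial>lborel)"
    proof (rule nn_integral_cong)
      fix u :: real
      have "0 \<le> (norm z)\<^sup>2" by simp
      then have "u > 0" if "(norm z)\<^sup>2 < u" using that by linarith
      then show "g z * (ennreal (\<beta> * (1 - u) powr (\<beta> - 1)) * indicator {(norm z)\<^sup>2<..<1} u) = ?h z u"
        by (auto split: split_indicator simp: mult_ac)
    qed
    finally show "g z * ennreal (radial_weight \<beta> z) = (\<integral>\<^sup>+u. ?h z u \<partial>lborel)" .
  qed
  also have "\<dots> = (\<integral>\<^sup>+u. (\<integral>\<^sup>+z. ?h z u \<partial>V) \<partial>lborel)"
    by (rule Fubini'[symmetric]) measurable
  also have "\<dots> = (\<integral>\<^sup>+u. ennreal (\<beta> * (1 - u) powr (\<beta> - 1)) * indicator {0<..<1} u *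
        (\<integral>\<^sup>+z. g z * indicator (ball 0 (sqrt u)) z \<partial>V) \<partial>lborel)"
  proof (rule nn_integral_cong)
    fix u :: real
    have "(\<integral>\<^sup>+z. g z * (if (norm z)\<^sup>2 < u then 1 else 0) \<partial>V) = (\<integral>\<^sup>+z. g z * indicator (ball 0 (sqrt u)) z \<partial>V)"
      if "0 < u"
    proof (rule nn_integral_cong)
      fix z :: "complex ^ 'd"
      show "g z * (if (norm z)\<^sup>2 < u then 1 else 0) = g z * indicator (ball 0 (sqrt u)) z"
        using real_sqrt_less_iff[of "(norm z)\<^sup>2" u] by (auto split: split_indicator)
    qed
    then show "(\<integral>\<^sup>+z. ?h z u \<partial>V) = ennreal (\<beta> * (1 - u) powr (\<beta> - 1)) * indicator {0<..<1} u *
        (\<integral>\<^sup>+z. g z * indicator (ball 0 (sqrt u)) z \<partial>V)"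
      by (subst nn_integral_cmult) (auto split: split_indicator)
  qed
  finally show ?thesis .
qed

text \<open>The layer-cake formula produces the density
  \<open>\<beta> * (1 - u) powr (\<beta> - 1)\<close> on (0, 1), a probability density for
  \<open>\<beta> > 0\<close>. This is a moment of the radius \<open>sqrt u\<close> under it.\<close>

definition radial_moment :: "real \<Rightarrow> nat \<Rightarrow> real"
  where "radial_moment \<beta> k = enn2real (\<integral>\<^sup>+u. ennreal (\<beta> * (1 - u) powr (\<beta> - 1)) * indicator {0<..<1} u * ennreal (sqrt u ^ k) \<partial>lborel)"

lemma radial_moment_ennreal:
  assumes b: "\<beta> > 0"
  shows "(\<integral>\<^sup>+u. ennreal (\<beta> * (1 - u) powr (\<beta> - 1)) * indicator {0<..<1} u * ennreal (sqrt u ^ k) \<partial>lborel) = ennreal (radial_moment \<beta> k)"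
proof -
  have "(\<integral>\<^sup>+u. ennreal (\<beta> * (1 - u) powr (\<beta> - 1)) * indicator {0<..<1} u * ennreal (sqrt u ^ k) \<partial>lborel)
     \<le> (\<integral>\<^sup>+u. ennreal (\<beta> * (1 - u) powr (\<beta> - 1)) * indicator {0<..<1} u \<partial>lborel)"
    by (intro nn_integral_mono) (auto split: split_indicator intro!: mult_left_le power_le_one simp: ennreal_le_1)
  also have "\<dots> < top" by (subst nn_integral_beta_tail) (use b in auto)
  finally show ?thesis unfolding radial_moment_def by (simp add: ennreal_enn2real)
qed

text \<open>A Beta integral, \<beta> B(m + 1, \<beta>), rewritten by Gamma functions. Even orders
  are those that arise from squared norms of homogeneous polynomials.\<close>

lemma radial_moment_even:
  assumes b: "\<beta> > 0"
  shows "radial_moment \<beta> (2 * m) = fact m / pochhammer (\<beta> + 1) m"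
proof -
  have "((\<lambda>t. t powr (real m + 1 - 1) * (1 - t) powr (\<beta> - 1)) has_integral Beta (real m + 1) \<beta>) {0..1}"
    using b by (intro has_integral_Beta_real) auto
  from has_integral_mult_right[OF this, of \<beta>]
  have "((\<lambda>t. \<beta> * (t powr real m * (1 - t) powr (\<beta> - 1))) has_integral \<beta> * Beta (real m + 1) \<beta>) {0<..<1}"
    by (simp add: has_integral_Icc_iff_Ioo)
  then have "((\<lambda>u. if u \<in> {0<..<1} then \<beta> * (u powr real m * (1 - u) powr (\<beta> - 1)) else 0) has_integral \<beta> * Beta (real m + 1) \<beta>) UNIV"
    by (simp only: has_integral_restrict_UNIV)
  then have I: "(\<integral>\<^sup>+u. ennreal (if u \<in> {0<..<1} then \<beta> * (u powr real m * (1 - u) powr (\<beta> - 1)) else 0) \<partial>lborel) = ennreal (\<beta> * Beta (real m + 1) \<beta>)"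
    using b by (intro nn_integral_has_integral_lborel) auto
  have sq: "sqrt u ^ (2 * m) = u powr real m" if "u > 0" for u
    using that by (subst power_mult) (simp add: powr_realpow)
  have sq': "sqrt u ^ (m * 2) = u powr real m" if "u > 0" for u
    using sq[OF that] by (simp only: mult.commute)
  have "(\<integral>\<^sup>+u. ennreal (\<beta> * (1 - u) powr (\<beta> - 1)) * indicator {0<..<1} u * ennreal (sqrt u ^ (2 * m)) \<partial>lborel) =
      (\<integral>\<^sup>+u. ennreal (if u \<in> {0<..<1} then \<beta> * (u powr real m * (1 - u) powr (\<beta> - 1)) else 0) \<partial>lborel)"
    by (intro nn_integral_cong)
       (use b in \<open>auto split: split_indicator simp: sq' ennreal_mult''[symmetric] mult_ac\<close>)
  then have e: "radial_moment \<beta> (2 * m) = \<beta> * Beta (real m + 1) \<beta>"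
    unfolding radial_moment_def I using b
    by (simp add: Beta_def Gamma_real_pos less_imp_le)
  have G: "Gamma (real m + 1) = fact m" using Gamma_fact[of m, where 'a = real] by (simp add: add.commute)
  have "pochhammer (\<beta> + 1) m = Gamma (\<beta> + 1 + real m) / Gamma (\<beta> + 1)"
    by (rule pochhammer_Gamma) (use b in \<open>auto elim!: nonpos_Ints_cases\<close>)
  moreover have "Gamma (\<beta> + 1) = \<beta> * Gamma \<beta>" using b by (intro Gamma_plus1) (auto elim!: nonpos_Ints_cases)
  moreover have "Gamma \<beta> > 0" "Gamma (\<beta> + 1 + real m) > 0" using b by (auto intro!: Gamma_real_pos)
  ultimately show ?thesis unfolding e Beta_def G using b by (simp add: field_simps)
qed

text \<open>By homogeneity the integral over each layer \<open>ball 0 (sqrt u)\<close> is a power of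
  \<open>sqrt u\<close> times the integral over the unit ball, so the latter factors out of the
  layer-cake formula.\<close>

lemma nn_integral_V_homogeneous_weight:
  fixes g :: "complex ^ 'd::finite \<Rightarrow> real"
  assumes [measurable]: "g \<in> borel_measurable borel" and b: "\<beta> > 0"
    and hom: "\<And>r z. 0 < r \<Longrightarrow> g (r *\<^sub>R z) = r ^ k * g z"
  shows "(\<integral>\<^sup>+z. ennreal (g z * radial_weight \<beta> z) \<partial>V) = ennreal (radial_moment \<beta> (k + 2 * CARD('d))) * (\<integral>\<^sup>+z. ennreal (g z) \<partial>V)"
proof -
  let ?I = "\<integral>\<^sup>+z. ennreal (g z) \<partial>V"
  have "(\<integral>\<^sup>+z. ennreal (g z * radial_weight \<beta> z) \<partial>V) = (\<integral>\<^sup>+z. ennreal (g z) * ennreal (radial_weight \<beta> z) \<partial>V)"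
    by (simp add: ennreal_mult'' radial_weight_nonneg)
  also have "\<dots> = (\<integral>\<^sup>+u. ennreal (\<beta> * (1 - u) powr (\<beta> - 1)) * indicator {0<..<1} u *
        (\<integral>\<^sup>+z. ennreal (g z) * indicator (ball 0 (sqrt u)) z \<partial>V) \<partial>lborel)"
    by (rule nn_integral_V_radial_weight) (use b in auto)
  also have "\<dots> = (\<integral>\<^sup>+u. ennreal (\<beta> * (1 - u) powr (\<beta> - 1)) * indicator {0<..<1} u * ennreal (sqrt u ^ (k + 2 * CARD('d))) * ?I \<partial>lborel)"
  proof (rule nn_integral_cong)
    fix u :: real
    have "(\<integral>\<^sup>+z. ennreal (g z) * indicator (ball 0 (sqrt u)) z \<partial>V) = ennreal (sqrt u ^ (k + 2 * CARD('d))) * ?I"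
      if u: "0 < u" "u < 1"
    proof -
      have "(\<integral>\<^sup>+z. ennreal (g z) * indicator (ball 0 (sqrt u)) z \<partial>V) = ennreal (sqrt u ^ (2 * CARD('d))) * (\<integral>\<^sup>+z. ennreal (g (sqrt u *\<^sub>R z)) \<partial>V)"
        by (rule nn_integral_V_scale) (use u in auto)
      also have "(\<integral>\<^sup>+z. ennreal (g (sqrt u *\<^sub>R z)) \<partial>V) = (\<integral>\<^sup>+z. ennreal (sqrt u ^ k) * ennreal (g z) \<partial>V)"
        using u by (simp add: hom ennreal_mult')
      also have "\<dots> = ennreal (sqrt u ^ k) * ?I"
        by (rule nn_integral_cmult) (rule borel_measurable_V, measurable)
      finally show ?thesis using u by (simp add: power_add ennreal_mult mult_ac)
    qed
    then show "ennreal (\<beta> * (1 - u) powr (\<beta> - 1)) * indicator {0<..<1} u *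
        (\<integral>\<^sup>+z. ennreal (g z) * indicator (ball 0 (sqrt u)) z \<partial>V) =
       ennreal (\<beta> * (1 - u) powr (\<beta> - 1)) * indicator {0<..<1} u * ennreal (sqrt u ^ (k + 2 * CARD('d))) * ?I"
      by (auto split: split_indicator simp: mult_ac)
  qed
  also have "\<dots> = ennreal (radial_moment \<beta> (k + 2 * CARD('d))) * ?I"
    unfolding radial_moment_ennreal[OF b, symmetric] by (rule nn_integral_multc) measurable
  finally show ?thesis .
qed

lemma integral_V_homogeneous_weight:
  fixes g :: "complex ^ 'd::finite \<Rightarrow> real"
  assumes cont: "continuous_on UNIV g" and b: "\<beta> > 0"
    and hom: "\<And>r z. 0 < r \<Longrightarrow> g (r *\<^sub>R z) = r ^ k * g z"
  shows "(LINT z|V. g z * radial_weight \<beta> z) = radial_moment \<beta> (k + 2 * CARD('d)) * (LINT z|V. g z)"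
    and "integrable V (\<lambda>z. g z * radial_weight \<beta> z)"
proof -
  have g[measurable]: "g \<in> borel_measurable borel" by (rule borel_measurable_continuous_onI[OF cont])
  have int: "integrable V g" by (rule integrable_V_continuous[OF cont])
  show intw: "integrable V (\<lambda>z. g z * radial_weight \<beta> z)"
  proof (rule Bochner_Integration.integrable_bound[OF int])
    show "(\<lambda>z. g z * radial_weight \<beta> z) \<in> borel_measurable V" by (rule borel_measurable_V) measurable
    show "AE z in V. norm (g z * radial_weight \<beta> z) \<le> norm (g z)"
      using b by (auto intro!: AE_I2 mult_left_le radial_weight_le_1 simp: space_V abs_mult abs_of_nonneg radial_weight_nonneg)
  qed
  have m: "radial_moment \<beta> (k + 2 * CARD('d)) \<ge> 0" by (simp add: radial_moment_def)
  \<comment> \<open>\<open>ennreal\<close> truncates at 0, so the identities for \<open>- g\<close>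
    and \<open>g\<close> treat the negative and the positive part separately.\<close>
  have "(\<integral>\<^sup>+z. ennreal (- (g z * radial_weight \<beta> z)) \<partial>V) = ennreal (radial_moment \<beta> (k + 2 * CARD('d))) * (\<integral>\<^sup>+z. ennreal (- g z) \<partial>V)"
    using nn_integral_V_homogeneous_weight[of "\<lambda>z. - g z" \<beta> k] b hom by simp
  moreover have "(\<integral>\<^sup>+z. ennreal (g z * radial_weight \<beta> z) \<partial>V) = ennreal (radial_moment \<beta> (k + 2 * CARD('d))) * (\<integral>\<^sup>+z. ennreal (g z) \<partial>V)"
    by (rule nn_integral_V_homogeneous_weight[OF g b hom])
  ultimately show "(LINT z|V. g z * radial_weight \<beta> z) = radial_moment \<beta> (k + 2 * CARD('d)) * (LINT z|V. g z)"
    unfolding real_lebesgue_integral_def[OF intw] real_lebesgue_integral_def[OF int]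
    using m by (simp add: enn2real_mult right_diff_distrib)
qed

section \<open>Integration by parts\<close>

text \<open>Translation invariance makes every difference quotient of \<open>G\<close> integrate to
  0, and the quotients converge dominatedly to the derivative.\<close>

lemma integral_directional_derivative_eq_0:
  fixes G G' :: "'a::euclidean_space \<Rightarrow> complex"
  assumes der: "\<And>x t. ((\<lambda>t. G (x + t *\<^sub>R e)) has_vector_derivative G' (x + t *\<^sub>R e)) (at t)"
    and cont: "continuous_on UNIV G" and cont': "continuous_on UNIV G'"
    and supp: "\<And>x. norm x \<ge> 1 \<Longrightarrow> G x = 0" and supp': "\<And>x. norm x \<ge> 1 \<Longrightarrow> G' x = 0"
    and e: "norm e = 1"
  shows "(LINT x|lborel. G' x) = 0"
proof -
  have Gm[measurable]: "G \<in> borel_measurable borel" "G' \<in> borel_measurable borel"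
    using cont cont' by (auto intro: borel_measurable_continuous_onI)
  have "compact (G' ` cball 0 1)" using cont' by (intro compact_continuous_image) (auto intro: continuous_on_subset)
  then obtain B0 where B0: "\<And>x. x \<in> cball 0 1 \<Longrightarrow> norm (G' x) \<le> B0"
    by (metis bounded_iff compact_imp_bounded imageI)
  define B where "B = max 0 B0"
  have B: "norm (G' x) \<le> B" for x
    using B0[of x] supp'[of x] by (cases "norm x \<le> 1") (auto simp: B_def)
  define h where "h k = 1 / real (Suc k)" for k
  have h: "0 < h k" "h k \<le> 1" for k by (auto simp: h_def)
  let ?q = "\<lambda>k x. (1 / h k) *\<^sub>R (G (x + h k *\<^sub>R e) - G x)"
  have "(\<lambda>k. LINT x|lborel. ?q k x) \<longlonglongrightarrow> (LINT x|lborel. G' x)"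
  \<comment> \<open>Shifts have length at most 1, so the quotients live on \<open>cball 0 2\<close>;
    the mean value inequality bounds them there by \<open>B\<close>.\<close>
  proof (rule integral_dominated_convergence[where w = "\<lambda>x. B * indicator (cball 0 2) x"])
    have "emeasure lborel (cball (0::'a) 2) < \<infinity>" by (rule emeasure_lborel_cball_finite)
    then show "integrable lborel (\<lambda>x. B * indicator (cball (0::'a) 2) x)"
      by (intro integrable_mult_right integrable_real_indicator) auto
    show "AE x in lborel. (\<lambda>k. ?q k x) \<longlonglongrightarrow> G' x"
    proof (rule AE_I2)
      fix x
      have "((\<lambda>t. G (x + t *\<^sub>R e)) has_vector_derivative G' x) (at 0)" using der[of x 0] by simp
      then have "((\<lambda>t. norm (G (x + t *\<^sub>R e) - G x - t *\<^sub>R G' x) / norm t) \<longlongrightarrow> 0) (at 0)"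
        by (simp add: has_vector_derivative_def has_derivative_at)
      moreover have "\<forall>\<^sub>F t in at 0. norm (G (x + t *\<^sub>R e) - G x - t *\<^sub>R G' x) / norm t
          = norm ((1 / t) *\<^sub>R (G (x + t *\<^sub>R e) - G x) - G' x)"
        unfolding eventually_at_filter
      proof (intro always_eventually allI impI)
        fix t :: real assume t: "t \<noteq> 0"
        then have "(1 / t) *\<^sub>R (G (x + t *\<^sub>R e) - G x) - G' x = (1 / t) *\<^sub>R (G (x + t *\<^sub>R e) - G x - t *\<^sub>R G' x)"
          by (simp add: scaleR_diff_right)
        then show "norm (G (x + t *\<^sub>R e) - G x - t *\<^sub>R G' x) / norm t
          = norm ((1 / t) *\<^sub>R (G (x + t *\<^sub>R e) - G x) - G' x)"
          by (simp add: divide_inverse mult.commute)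
      qed
      ultimately have "((\<lambda>t. norm ((1 / t) *\<^sub>R (G (x + t *\<^sub>R e) - G x) - G' x)) \<longlongrightarrow> 0) (at 0)"
        by (rule Lim_transform_eventually)
      then have "((\<lambda>t. (1 / t) *\<^sub>R (G (x + t *\<^sub>R e) - G x)) \<longlongrightarrow> G' x) (at 0)"
        by (rule LIM_zero_cancel[OF tendsto_norm_zero_cancel])
      moreover have "filterlim h (at 0) sequentially"
        unfolding filterlim_at h_def using LIMSEQ_Suc[OF lim_inverse_n'] by (auto simp: eventually_sequentially)
      ultimately show "(\<lambda>k. ?q k x) \<longlonglongrightarrow> G' x" by (rule filterlim_compose)
    qed
    show "AE x in lborel. norm (?q k x) \<le> B * indicator (cball 0 2) x" for k
    proof (rule AE_I2)
      fix x
      show "norm (?q k x) \<le> B * indicator (cball 0 2) x"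
      proof (cases "norm x \<le> 2")
        case True
        have "norm (G (x + h k *\<^sub>R e) - G (x + 0 *\<^sub>R e)) \<le> B * norm (h k - 0)"
        proof (rule differentiable_bound[where S = UNIV and f = "\<lambda>t. G (x + t *\<^sub>R e)" and f' = "\<lambda>t s. s *\<^sub>R G' (x + t *\<^sub>R e)"])
          show "((\<lambda>t. G (x + t *\<^sub>R e)) has_derivative (\<lambda>s. s *\<^sub>R G' (x + t *\<^sub>R e))) (at t)" for t
            using der by (simp add: has_vector_derivative_def)
          show "onorm (\<lambda>s. s *\<^sub>R G' (x + t *\<^sub>R e)) \<le> B" for t
            using B[of "x + t *\<^sub>R e"] by (intro onorm_le) (simp add: mult.commute[of B] mult_left_mono)
        qed auto
        then have dq: "norm (G (x + h k *\<^sub>R e) - G x) \<le> B * h k" using h[of k] by simp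
        have nq: "norm (?q k x) = norm (G (x + h k *\<^sub>R e) - G x) / h k"
          unfolding norm_scaleR using h[of k] by simp
        have "norm (?q k x) \<le> B" unfolding nq using dq h(1)[of k] by (simp add: divide_le_eq)
        then show ?thesis using True by simp
      next
        case False
        have "norm (x + h k *\<^sub>R e) \<ge> norm x - norm (h k *\<^sub>R e)" by (metis add.commute norm_diff_ineq)
        then have "norm (x + h k *\<^sub>R e) \<ge> 1" using h[of k] e False by simp
        then show ?thesis using False supp by simp
      qed
    qed
  qed measurable
  moreover have "(LINT x|lborel. ?q k x) = 0" for k
  proof -
    have intG: "integrable lborel G"
    proof -
      have "compact (G ` cball 0 1)" using cont by (intro compact_continuous_image) (auto intro: continuous_on_subset)
      then obtain C where C: "\<And>x. x \<in> cball 0 1 \<Longrightarrow> norm (G x) \<le> C"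
        by (metis bounded_iff compact_imp_bounded imageI)
      have "integrable lborel (\<lambda>x. max 0 C * indicator (cball (0::'a) 1) x)"
        using emeasure_lborel_cball_finite[of "0::'a" 1] by (intro integrable_mult_right integrable_real_indicator) auto
      then show ?thesis
        by (rule Bochner_Integration.integrable_bound) (use C supp in \<open>auto intro!: AE_I2 split: split_indicator simp: le_max_iff_disj\<close>)
    qed
    have d: "lborel = distr lborel borel ((+) (h k *\<^sub>R e))" by (rule lborel_distr_plus[symmetric])
    have "(LINT x|lborel. G x) = (LINT x|distr lborel borel ((+) (h k *\<^sub>R e)). G x)" using d by metis
    also have "\<dots> = (LINT x|lborel. G (h k *\<^sub>R e + x))" by (rule integral_distr) measurable
    finally have i: "(LINT x|lborel. G (x + h k *\<^sub>R e)) = (LINT x|lborel. G x)" by (simp add: add.commute)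
    have "integrable (distr lborel borel ((+) (h k *\<^sub>R e))) G" using intG d by metis
    then have "integrable lborel (\<lambda>x. G (h k *\<^sub>R e + x))" by (subst (asm) integrable_distr_eq) auto
    then have "(LINT x|lborel. G (x + h k *\<^sub>R e) - G x) = 0"
      using intG i by (subst Bochner_Integration.integral_diff) (auto simp: add.commute)
    then show ?thesis by simp
  qed
  ultimately have "(\<lambda>k. 0 :: complex) \<longlonglongrightarrow> (LINT x|lborel. G' x)" by (simp only:)
  then show ?thesis by (rule LIMSEQ_unique[OF _ tendsto_const])
qed

definition weighted_ip :: "real \<Rightarrow> (complex ^ 'd::finite \<Rightarrow> complex) \<Rightarrow> (complex ^ 'd \<Rightarrow> complex) \<Rightarrow> complex"
  where "weighted_ip \<beta> p q = (LINT z|V. p z * cnj (q z) * complex_of_real (radial_weight \<beta> z))"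

definition bergman_ip :: "(complex ^ 'd::finite \<Rightarrow> complex) \<Rightarrow> (complex ^ 'd \<Rightarrow> complex) \<Rightarrow> complex"
  where "bergman_ip p q = (LINT z|V. p z * cnj (q z))"

lemma continuous_on_homogeneous_poly: "homogeneous_poly n p \<Longrightarrow> continuous_on S p"
  by (rule continuous_on_holo_on) (rule holo_on_homogeneous_poly)

text \<open>The squared positive part is continuously differentiable across 0. Hence (1 - |z|^2)^2
  may be extended by zero beyond the sphere and still be differentiated.\<close>

lemma has_real_derivative_max_square:
  "((\<lambda>x::real. (max 0 x)\<^sup>2) has_real_derivative 2 * max 0 x) (at x)"
proof -
  consider "x > 0" | "x < 0" | "x = 0" by linarith
  then show ?thesis
  proof cases
    case 1
    have "((\<lambda>x::real. x\<^sup>2) has_real_derivative 2 * max 0 x) (at x)"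
      using 1 by (auto intro!: derivative_eq_intros)
    then show ?thesis
      by (rule has_field_derivative_transform_within_open[of _ _ _ "{0<..}"]) (use 1 in auto)
  next
    case 2
    have "((\<lambda>x::real. 0) has_real_derivative 2 * max 0 x) (at x)" using 2 by simp
    then show ?thesis
      by (rule has_field_derivative_transform_within_open[of _ _ _ "{..<0}"]) (use 2 in auto)
  next
    case 3
    have "(\<lambda>h. ((max 0 (0 + h))\<^sup>2 - (max 0 0)\<^sup>2) / h) = (\<lambda>h::real. max 0 h)"
      by (auto simp: fun_eq_iff max_def power2_eq_square)
    moreover have "((\<lambda>h::real. max 0 h) \<longlongrightarrow> max 0 0) (at 0)" by (intro tendsto_intros)
    ultimately have "((\<lambda>h. ((max 0 (0 + h))\<^sup>2 - (max 0 0)\<^sup>2) / h) \<longlongrightarrow> 0) (at (0::real))" by simp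
    then show ?thesis using 3 by (simp add: DERIV_def)
  qed
qed

lemma has_vector_derivative_homogeneous_poly_line:
  assumes p: "homogeneous_poly n p"
  shows "((\<lambda>t. p (x + t *\<^sub>R axis i c)) has_vector_derivative c * partial_deriv i p (x + t *\<^sub>R axis i c)) (at t)"
proof -
  have "((\<lambda>t. x + t *\<^sub>R axis i c) has_derivative (\<lambda>s. s *\<^sub>R axis i c)) (at t)"
    by (auto intro!: derivative_eq_intros)
  from has_derivative_compose[OF this holo_on_has_derivative[OF holo_on_homogeneous_poly[OF p, of UNIV] UNIV_I]]
  have "((\<lambda>t. p (x + t *\<^sub>R axis i c)) has_derivative (\<lambda>s. \<Sum>j\<in>UNIV. s *\<^sub>R (axis i c $ j * partial_deriv j p (x + t *\<^sub>R axis i c)))) (at t)"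
    by simp
  then show ?thesis
    unfolding has_vector_derivative_def scaleR_sum_right[symmetric] sum_axis_mult .
qed

text \<open>The Wirtinger derivative in \<open>z $ i\<close> annihilates \<open>cnj (q z)\<close>
  and sends (1 - |z|^2)^2 to -2 \<open>cnj (z $ i)\<close> (1 - |z|^2). Moving it from
  \<open>p\<close> to the remaining factors gives the identity.\<close>

lemma weighted_ip_adjoint:
  assumes p: "homogeneous_poly n p" and q: "homogeneous_poly m q"
  shows "weighted_ip 2 (partial_deriv i p) q = 2 * weighted_ip 1 p (\<lambda>z. z $ i * q z)"
proof -
  \<comment> \<open>\<open>?W\<close> is (1 - |z|^2)^2 extended by zero, and \<open>?w\<close> is
    the positive part that appears in its derivative. On the ball they are the radial weights of
    exponents 2 and 1.\<close>
  let ?W = "\<lambda>z :: complex ^ 'a. (max 0 (1 - (norm z)\<^sup>2))\<^sup>2"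
  let ?w = "\<lambda>z :: complex ^ 'a. max 0 (1 - (norm z)\<^sup>2)"
  let ?p' = "partial_deriv i p" and ?q' = "partial_deriv i q"
  have p': "homogeneous_poly (n - 1) ?p'" and q': "homogeneous_poly (m - 1) ?q'"
    by (rule homogeneous_poly_partial_deriv[OF p], rule homogeneous_poly_partial_deriv[OF q])
  note cont = continuous_on_homogeneous_poly[OF p] continuous_on_homogeneous_poly[OF q]
    continuous_on_homogeneous_poly[OF p'] continuous_on_homogeneous_poly[OF q']
  let ?G = "\<lambda>z. p z * cnj (q z) * complex_of_real (?W z)"
  \<comment> \<open>The real directional derivative of \<open>?G\<close> along
    \<open>axis i c\<close>; only c = 1 and c = \<i> are used.\<close>
  let ?G' = "\<lambda>c z. (c * ?p' z * cnj (q z) + p z * cnj (c * ?q' z)) * complex_of_real (?W z)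
     + p z * cnj (q z) * complex_of_real (- 4 * ?w z * (z $ i \<bullet> c))"
  have zero: "(LINT z|V. ?G' c z) = 0" if c: "cmod c = 1" for c
  proof -
    have contG': "continuous_on UNIV (?G' c)" by (intro continuous_intros cont)
    have "(LINT z|lborel. ?G' c z) = 0"
    proof (rule integral_directional_derivative_eq_0[where G = ?G and e = "axis i c"])
      show "((\<lambda>t. ?G (x + t *\<^sub>R axis i c)) has_vector_derivative ?G' c (x + t *\<^sub>R axis i c)) (at t)" for x t
      proof -
        let ?y = "\<lambda>t. x + t *\<^sub>R axis i c"
        have "((\<lambda>t. 1 - ?y t \<bullet> ?y t) has_real_derivative - 2 * (?y t \<bullet> axis i c)) (at t)"
          unfolding inner_add_left inner_add_right inner_scaleR_left inner_scaleR_right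
          by (auto intro!: derivative_eq_intros simp: algebra_simps inner_commute)
        then have "((\<lambda>t. 1 - (norm (?y t))\<^sup>2) has_real_derivative - 2 * (?y t $ i \<bullet> c)) (at t)"
          by (simp add: power2_norm_eq_inner inner_axis)
        from DERIV_chain2[OF has_real_derivative_max_square this]
        have "((\<lambda>t. ?W (?y t)) has_real_derivative - 4 * ?w (?y t) * (?y t $ i \<bullet> c)) (at t)"
          by (simp add: algebra_simps)
        then have W: "((\<lambda>t. complex_of_real (?W (?y t))) has_vector_derivative complex_of_real (- 4 * ?w (?y t) * (?y t $ i \<bullet> c))) (at t)"
          unfolding has_real_derivative_iff_has_vector_derivative by (rule bounded_linear.has_vector_derivative[OF bounded_linear_of_real])
        have Q: "((\<lambda>t. cnj (q (?y t))) has_vector_derivative cnj (c * ?q' (?y t))) (at t)"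
          by (rule has_vector_derivative_cnj) (rule has_vector_derivative_homogeneous_poly_line[OF q])
        note has_vector_derivative_mult[OF has_vector_derivative_mult[OF has_vector_derivative_homogeneous_poly_line[OF p, of x i c t] Q] W]
        then show ?thesis by (rule has_vector_derivative_eq_rhs) (simp add: algebra_simps)
      qed
      show "continuous_on UNIV ?G" by (intro continuous_intros cont)
      show "norm (axis i c) = 1" using c by (simp add: norm_axis_complex)
      fix x :: "complex ^ 'a" assume "norm x \<ge> 1"
      then have "(norm x)\<^sup>2 \<ge> 1" by simp
      then have "?w x = 0" by simp
      then show "?G x = 0" "?G' c x = 0" by simp_all
    qed (rule contG')
    also have "(LINT z|lborel. ?G' c z) = (LINT z|lborel. indicator unit_ball z *\<^sub>R ?G' c z)"
    proof (rule Bochner_Integration.integral_cong[OF refl])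
      fix z :: "complex ^ 'a"
      show "?G' c z = indicator unit_ball z *\<^sub>R ?G' c z"
      proof (cases "norm z < 1")
        case False
        then have "(norm z)\<^sup>2 \<ge> 1" by simp
        then have "?w z = 0" by simp
        then show ?thesis by simp
      qed simp
    qed
    finally show ?thesis
      using integral_V[OF borel_measurable_continuous_onI[OF contG']] by simp
  qed
  have int: "integrable V (?G' c)" for c
    by (rule integrable_V_continuous) (intro continuous_intros cont)
  \<comment> \<open>Twice the Wirtinger derivative: the terms with \<open>?q'\<close> cancel, and
    the two inner products from the weight combine to \<open>cnj (z $ i)\<close>.\<close>
  have "?G' 1 z - \<i> * ?G' \<i> z = 2 * (?p' z * cnj (q z) * complex_of_real (?W z)) - 4 * (p z * cnj (z $ i * q z) * complex_of_real (?w z))" for z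
  proof -
    have "complex_of_real (z $ i \<bullet> 1) - \<i> * complex_of_real (z $ i \<bullet> \<i>) = cnj (z $ i)"
      by (simp add: complex_eq_iff inner_complex_def)
    then have "- 4 * (p z * cnj (q z) * complex_of_real (?w z)) * (complex_of_real (z $ i \<bullet> 1) - \<i> * complex_of_real (z $ i \<bullet> \<i>))
       = - 4 * (p z * cnj (z $ i * q z) * complex_of_real (?w z))" by simp
    then show ?thesis by (simp add: algebra_simps)
  qed
  then have "(LINT z|V. 2 * (?p' z * cnj (q z) * complex_of_real (?W z)) - 4 * (p z * cnj (z $ i * q z) * complex_of_real (?w z)))
     = (LINT z|V. ?G' 1 z - \<i> * ?G' \<i> z)" by simp
  also have "\<dots> = (LINT z|V. ?G' 1 z) - (LINT z|V. \<i> * ?G' \<i> z)"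
    by (rule Bochner_Integration.integral_diff) (intro int integrable_mult_right)+
  also have "\<dots> = 0" using zero[of 1] zero[of \<i>] by simp
  finally have "(LINT z|V. 2 * (?p' z * cnj (q z) * complex_of_real (?W z)) - 4 * (p z * cnj (z $ i * q z) * complex_of_real (?w z))) = 0" .
  moreover have "(LINT z|V. 2 * (?p' z * cnj (q z) * complex_of_real (?W z)) - 4 * (p z * cnj (z $ i * q z) * complex_of_real (?w z)))
    = 2 * (LINT z|V. ?p' z * cnj (q z) * complex_of_real (?W z)) - 4 * (LINT z|V. p z * cnj (z $ i * q z) * complex_of_real (?w z))"
    by (subst Bochner_Integration.integral_diff)
       (auto intro!: integrable_V_continuous continuous_intros cont)
  moreover have "(LINT z|V. ?p' z * cnj (q z) * complex_of_real (?W z)) = weighted_ip 2 ?p' q"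
    unfolding weighted_ip_def
  proof (rule Bochner_Integration.integral_cong[OF refl])
    fix z :: "complex ^ 'a" assume "z \<in> space V"
    then have "(norm z)\<^sup>2 < 1" by (simp add: space_V power_less_one_iff)
    then show "?p' z * cnj (q z) * complex_of_real (?W z) = ?p' z * cnj (q z) * complex_of_real (radial_weight 2 z)"
      by (simp add: radial_weight_def powr_numeral)
  qed
  moreover have "(LINT z|V. p z * cnj (z $ i * q z) * complex_of_real (?w z)) = weighted_ip 1 p (\<lambda>z. z $ i * q z)"
    unfolding weighted_ip_def
  proof (rule Bochner_Integration.integral_cong[OF refl])
    fix z :: "complex ^ 'a" assume "z \<in> space V"
    then have "(norm z)\<^sup>2 < 1" by (simp add: space_V power_less_one_iff)
    then show "p z * cnj (z $ i * q z) * complex_of_real (?w z) = p z * cnj (z $ i * q z) * complex_of_real (radial_weight 1 z)"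
      by (simp add: radial_weight_def)
  qed
  ultimately have "2 * weighted_ip 2 ?p' q - 4 * weighted_ip 1 p (\<lambda>z. z $ i * q z) = 0" by (simp only:)
  then show ?thesis by simp
qed

section \<open>The Bergman norm on homogeneous polynomials\<close>

definition bergman_norm2 :: "(complex ^ 'd::finite \<Rightarrow> complex) \<Rightarrow> real"
  where "bergman_norm2 p = (LINT z|V. (cmod (p z))\<^sup>2)"

lemma bergman_norm2_nonneg: "bergman_norm2 p \<ge> 0"
  by (simp add: bergman_norm2_def)

lemma L2_norm_1_power2: "(L2_norm (\<lambda>_. 1) p)\<^sup>2 = bergman_norm2 p"
  by (simp add: L2_norm_def bergman_norm2_def)

lemma bergman_ip_self: "bergman_ip p p = complex_of_real (bergman_norm2 p)"
  unfolding bergman_ip_def bergman_norm2_def by (simp add: complex_norm_square[symmetric] flip: integral_complex_of_real)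

lemma bergman_ip_commute: "bergman_ip q p = cnj (bergman_ip p q)"
  unfolding bergman_ip_def Bochner_Integration.integral_cnj[symmetric] by (simp add: mult.commute)

lemma weighted_ip_commute: "weighted_ip \<beta> q p = cnj (weighted_ip \<beta> p q)"
  unfolding weighted_ip_def Bochner_Integration.integral_cnj[symmetric] by (simp add: mult_ac)

lemma homogeneous_poly_scaleR: "homogeneous_poly n p \<Longrightarrow> p (r *\<^sub>R z) = of_real (r ^ n) * p z"
proof -
  have "r *\<^sub>R z = complex_of_real r *s z"
    unfolding vec_eq_iff vector_scaleR_component vector_smult_component by (simp add: scaleR_conv_of_real)
  then show "homogeneous_poly n p \<Longrightarrow> p (r *\<^sub>R z) = of_real (r ^ n) * p z"
    by (simp add: homogeneous_poly_smult)
qed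

lemma integrable_poly_product:
  "homogeneous_poly n p \<Longrightarrow> homogeneous_poly m q \<Longrightarrow> integrable V (\<lambda>z. p z * cnj (q z))"
  by (rule integrable_V_continuous) (intro continuous_intros continuous_on_homogeneous_poly)

lemma integrable_poly_sq:
  "homogeneous_poly n p \<Longrightarrow> integrable V (\<lambda>z. (cmod (p z))\<^sup>2)"
  by (rule integrable_V_continuous) (intro continuous_intros continuous_on_homogeneous_poly)

lemma integrable_complexI:
  "integrable M (\<lambda>z. Re (f z)) \<Longrightarrow> integrable M (\<lambda>z. Im (f z)) \<Longrightarrow> integrable M f"
proof -
  assume "integrable M (\<lambda>z. Re (f z))" "integrable M (\<lambda>z. Im (f z))"
  then have "integrable M (\<lambda>z. complex_of_real (Re (f z)) + \<i> * complex_of_real (Im (f z)))" by simp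
  then show ?thesis by (simp add: complex_eq[symmetric])
qed

lemma weighted_ip_eq_moment:
  fixes p q :: "complex ^ 'd::finite \<Rightarrow> complex"
  assumes p: "homogeneous_poly n p" and q: "homogeneous_poly m q" and b: "\<beta> > 0"
  shows "weighted_ip \<beta> p q = of_real (radial_moment \<beta> (n + m + 2 * CARD('d))) * bergman_ip p q"
    and "integrable V (\<lambda>z. p z * cnj (q z) * complex_of_real (radial_weight \<beta> z))"
proof -
  note cont = continuous_on_homogeneous_poly[OF p] continuous_on_homogeneous_poly[OF q]
  have re: "Re (p (r *\<^sub>R z) * cnj (q (r *\<^sub>R z))) = r ^ (n + m) * Re (p z * cnj (q z))"
    and im: "Im (p (r *\<^sub>R z) * cnj (q (r *\<^sub>R z))) = r ^ (n + m) * Im (p z * cnj (q z))" for r z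
    unfolding homogeneous_poly_scaleR[OF p] homogeneous_poly_scaleR[OF q]
    by (simp_all add: algebra_simps power_add flip: of_real_power)
  note R = integral_V_homogeneous_weight[of "\<lambda>z. Re (p z * cnj (q z))" \<beta> "n + m", OF _ b re]
  note I = integral_V_homogeneous_weight[of "\<lambda>z. Im (p z * cnj (q z))" \<beta> "n + m", OF _ b im]
  have cR: "continuous_on UNIV (\<lambda>z. Re (p z * cnj (q z)))" and cI: "continuous_on UNIV (\<lambda>z. Im (p z * cnj (q z)))"
    by (intro continuous_intros cont)+
  show int: "integrable V (\<lambda>z. p z * cnj (q z) * complex_of_real (radial_weight \<beta> z))"
    using R(2)[OF cR] I(2)[OF cI] by (intro integrable_complexI) simp_all
  note int0 = integrable_poly_product[OF p q]
  have Re_mult_real: "Re (c * complex_of_real r) = Re c * r" and Im_mult_real: "Im (c * complex_of_real r) = Im c * r" for c r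
    by simp_all
  have "Re (weighted_ip \<beta> p q) = (LINT z|V. Re (p z * cnj (q z)) * radial_weight \<beta> z)"
    unfolding weighted_ip_def integral_bounded_linear[OF bounded_linear_Re int, symmetric] by (simp only: Re_mult_real)
  moreover have "Im (weighted_ip \<beta> p q) = (LINT z|V. Im (p z * cnj (q z)) * radial_weight \<beta> z)"
    unfolding weighted_ip_def integral_bounded_linear[OF bounded_linear_Im int, symmetric] by (simp only: Im_mult_real)
  moreover have "Re (bergman_ip p q) = (LINT z|V. Re (p z * cnj (q z)))" "Im (bergman_ip p q) = (LINT z|V. Im (p z * cnj (q z)))"
    unfolding bergman_ip_def integral_bounded_linear[OF bounded_linear_Re int0, symmetric]
      integral_bounded_linear[OF bounded_linear_Im int0, symmetric] by simp_all
  ultimately show "weighted_ip \<beta> p q = of_real (radial_moment \<beta> (n + m + 2 * CARD('d))) * bergman_ip p q"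
    using R(1)[OF cR] I(1)[OF cI] by (simp add: complex_eq_iff)
qed

text \<open>Powers of \<open>sqrt u\<close> decrease with the exponent on (0, 1), so the moment of
  order \<open>k\<close> dominates the explicit one of order \<open>2 * k\<close>. Odd orders occur
  for products of polynomials of different degrees.\<close>

lemma radial_moment_pos:
  assumes b: "\<beta> > 0"
  shows "radial_moment \<beta> k > 0"
proof -
  have "ennreal (radial_moment \<beta> (2 * k)) \<le> ennreal (radial_moment \<beta> k)"
    unfolding radial_moment_ennreal[OF b, symmetric]
    by (intro nn_integral_mono) (auto split: split_indicator intro!: mult_left_mono ennreal_leI power_decreasing)
  moreover have "radial_moment \<beta> (2 * k) > 0"
    unfolding radial_moment_even[OF b] using b by (intro divide_pos_pos pochhammer_pos) auto
  ultimately show ?thesis by (smt (verit) ennreal_le_iff2)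
qed

lemma pochhammer_2: "pochhammer (2::real) m = fact (Suc m)"
  using pochhammer_rec[of "1::real" m] by (simp add: pochhammer_fact one_add_one)

lemma pochhammer_3: "2 * pochhammer (3::real) m = fact (Suc (Suc m))"
  using pochhammer_rec[of "2::real" m] by (simp add: pochhammer_2 del: fact_Suc)

lemma radial_moment_1: "radial_moment 1 (2 * m) = 1 / (real m + 1)"
  by (simp add: radial_moment_even pochhammer_2)

lemma radial_moment_2: "radial_moment 2 (2 * m) = 2 / ((real m + 1) * (real m + 2))"
proof -
  have "radial_moment 2 (2 * m) = 2 * fact m / (2 * pochhammer (3::real) m)"
    by (simp add: radial_moment_even)
  also have "\<dots> = 2 / ((real m + 1) * (real m + 2))"
  proof -
    have f: "fact (Suc (Suc m)) = ((real m + 1) * (real m + 2)) * fact m" by (simp add: algebra_simps)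
    show ?thesis unfolding pochhammer_3 f by simp
  qed
  finally show ?thesis .
qed

lemma weighted_ip_sum_left:
  assumes "\<And>i. i \<in> A \<Longrightarrow> homogeneous_poly n (p i)" "homogeneous_poly m q" "\<beta> > 0"
  shows "weighted_ip \<beta> (\<lambda>z. \<Sum>i\<in>A. p i z) q = (\<Sum>i\<in>A. weighted_ip \<beta> (p i) q)"
  unfolding weighted_ip_def sum_distrib_right
  by (rule Bochner_Integration.integral_sum) (rule weighted_ip_eq_moment(2)[OF assms(1) assms(2,3)])

lemma weighted_ip_cmult_left: "weighted_ip \<beta> (\<lambda>z. c * p z) q = c * weighted_ip \<beta> p q"
  unfolding weighted_ip_def by (simp add: mult.assoc)

lemma weighted_ip_euler_left:
  assumes p: "homogeneous_poly n p" and q: "homogeneous_poly m q"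
  shows "of_nat n * weighted_ip 1 p q = (\<Sum>i\<in>UNIV. weighted_ip 1 (\<lambda>z. z $ i * partial_deriv i p z) q)"
proof -
  have "homogeneous_poly (Suc (n - 1)) (\<lambda>z. z $ i * partial_deriv i p z)" for i
    by (intro homogeneous_poly_vec_nth_mult homogeneous_poly_partial_deriv p)
  then show ?thesis
    unfolding weighted_ip_cmult_left[symmetric] homogeneous_poly_euler[OF p, symmetric]
    by (intro weighted_ip_sum_left[OF _ q]) auto
qed

text \<open>For the weight 1 - |z|^2 each \<open>z $ i\<close> times \<open>partial_deriv i\<close>
  is symmetric, since both pairings equal half the weighted pairing of the derivatives. So the
  degree operator is symmetric, and \<open>n\<close> and \<open>m\<close> are distinct
  eigenvalues.\<close>

lemma bergman_ip_orthogonal: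
  fixes p q :: "complex ^ 'd::finite \<Rightarrow> complex"
  assumes p: "homogeneous_poly n p" and q: "homogeneous_poly m q" and nm: "n \<noteq> m"
  shows "bergman_ip p q = 0"
proof -
  have eq: "weighted_ip 1 (\<lambda>z. z $ i * partial_deriv i p z) q = cnj (weighted_ip 1 (\<lambda>z. z $ i * partial_deriv i q z) p)" for i
  proof -
    have "2 * weighted_ip 1 (\<lambda>z. z $ i * partial_deriv i p z) q = cnj (weighted_ip 2 (partial_deriv i q) (partial_deriv i p))"
      unfolding weighted_ip_adjoint[OF q homogeneous_poly_partial_deriv[OF p]] by (simp flip: weighted_ip_commute)
    also have "\<dots> = 2 * weighted_ip 1 p (\<lambda>z. z $ i * partial_deriv i q z)"
      unfolding weighted_ip_commute[symmetric] by (rule weighted_ip_adjoint[OF p homogeneous_poly_partial_deriv[OF q]])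
    finally show ?thesis by (simp flip: weighted_ip_commute)
  qed
  have "of_nat n * weighted_ip 1 p q = cnj (of_nat m * weighted_ip 1 q p)"
    unfolding weighted_ip_euler_left[OF p q] weighted_ip_euler_left[OF q p] by (simp add: eq)
  also have "\<dots> = of_nat m * weighted_ip 1 p q" by (simp flip: weighted_ip_commute)
  finally have "weighted_ip 1 p q = 0" using nm by simp
  then show ?thesis using weighted_ip_eq_moment(1)[OF p q, of 1] radial_moment_pos[of 1 "n + m + 2 * CARD('d)"] by simp
qed

text \<open>The moments turn both sides of \<open>weighted_ip_adjoint\<close> into unweighted inner
  products: 2 / ((n + d + 1) (n + d + 2)) on the left against 2 / (n + d + 2) on the right.\<close>

lemma bergman_ip_adjoint:
  fixes p q :: "complex ^ 'd::finite \<Rightarrow> complex"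
  assumes p: "homogeneous_poly (Suc n) p" and q: "homogeneous_poly n q"
  shows "bergman_ip (partial_deriv i p) q = of_nat (n + CARD('d) + 1) * bergman_ip p (\<lambda>z. z $ i * q z)"
proof -
  have p': "homogeneous_poly n (partial_deriv i p)" using homogeneous_poly_partial_deriv[OF p] by simp
  have m1: "radial_moment 1 (Suc n + Suc n + 2 * CARD('d)) = 1 / (real (n + CARD('d)) + 2)"
    using radial_moment_1[of "Suc (n + CARD('d))"] by (simp add: mult_2 algebra_simps)
  have m2: "radial_moment 2 (n + n + 2 * CARD('d)) = 2 / ((real (n + CARD('d)) + 1) * (real (n + CARD('d)) + 2))"
    using radial_moment_2[of "n + CARD('d)"] by (simp add: mult_2 algebra_simps)
  have "complex_of_real (2 / ((real (n + CARD('d)) + 1) * (real (n + CARD('d)) + 2))) * bergman_ip (partial_deriv i p) q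
     = 2 * (complex_of_real (1 / (real (n + CARD('d)) + 2)) * bergman_ip p (\<lambda>z. z $ i * q z))"
    using weighted_ip_adjoint[OF p q, of i]
    unfolding weighted_ip_eq_moment(1)[OF p' q zero_less_numeral] weighted_ip_eq_moment(1)[OF p homogeneous_poly_vec_nth_mult[OF q] zero_less_one] m1 m2 .
  moreover have gen: "x = (c + 1) * y"
    if "2 / ((c + 1) * (c + 2)) * x = 2 * (1 / (c + 2) * y)" "c + 1 \<noteq> 0" "c + 2 \<noteq> 0" for c x y :: complex
  proof -
    have "x = ((c + 1) * (c + 2) / 2) * (2 / ((c + 1) * (c + 2)) * x)" using that(2,3) by simp
    also have "\<dots> = (c + 1) * y" unfolding that(1) using that(3) by simp
    finally show ?thesis .
  qed
  moreover define N where "N = real (n + CARD('d))"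
  moreover have "N + 1 \<noteq> 0" "N + 2 \<noteq> 0" by (simp_all add: N_def add_nonneg_eq_0_iff)
  then have "complex_of_real N + 1 \<noteq> 0" "complex_of_real N + 2 \<noteq> 0"
    by (metis of_real_1 of_real_add of_real_eq_0_iff, metis of_real_numeral of_real_add of_real_eq_0_iff)
  ultimately have "bergman_ip (partial_deriv i p) q = (complex_of_real N + 1) * bergman_ip p (\<lambda>z. z $ i * q z)"
    by (intro gen) simp_all
  then show ?thesis by (simp add: N_def add_ac)
qed

lemma bergman_ip_sum_left:
  assumes "\<And>i. i \<in> A \<Longrightarrow> homogeneous_poly n (p i)" "homogeneous_poly m q"
  shows "bergman_ip (\<lambda>z. \<Sum>i\<in>A. p i z) q = (\<Sum>i\<in>A. bergman_ip (p i) q)"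
  unfolding bergman_ip_def sum_distrib_right
  by (rule Bochner_Integration.integral_sum) (rule integrable_poly_product[OF assms(1) assms(2)])

lemma bergman_ip_sum_right:
  assumes "\<And>i. i \<in> A \<Longrightarrow> homogeneous_poly n (p i)" "homogeneous_poly m q"
  shows "bergman_ip q (\<lambda>z. \<Sum>i\<in>A. p i z) = (\<Sum>i\<in>A. bergman_ip q (p i))"
  using bergman_ip_sum_left[OF assms] by (simp add: bergman_ip_commute[of q] flip: cnj_sum)

lemma bergman_ip_cmult_left: "bergman_ip (\<lambda>z. c * p z) q = c * bergman_ip p q"
  unfolding bergman_ip_def by (simp add: mult.assoc)

lemma bergman_ip_cmult_right: "bergman_ip p (\<lambda>z. c * q z) = cnj c * bergman_ip p q"
  by (simp add: bergman_ip_commute[of p] bergman_ip_cmult_left)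

text \<open>Cauchy-Schwarz in arithmetic-geometric form; the free parameter \<open>t\<close> is
  tuned so that one term can be absorbed in \<open>bergman_norm2_row_mult\<close>.\<close>

lemma norm_bergman_ip_le:
  assumes p: "homogeneous_poly n p" and q: "homogeneous_poly m q" and t: "t > 0"
  shows "cmod (bergman_ip p q) \<le> (t * bergman_norm2 p + bergman_norm2 q / t) / 2"
proof -
  have "cmod (bergman_ip p q) \<le> (LINT z|V. cmod (p z * cnj (q z)))"
    unfolding bergman_ip_def by (rule integral_norm_bound)
  also have "\<dots> \<le> (LINT z|V. (t * (cmod (p z))\<^sup>2 + (cmod (q z))\<^sup>2 / t) / 2)"
  proof (rule integral_mono)
    show "integrable V (\<lambda>z. cmod (p z * cnj (q z)))" by (intro integrable_norm integrable_poly_product[OF p q])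
    show "integrable V (\<lambda>z. (t * (cmod (p z))\<^sup>2 + (cmod (q z))\<^sup>2 / t) / 2)"
      using integrable_poly_sq[OF p] integrable_poly_sq[OF q] by simp
    fix z
    have "0 \<le> (t * cmod (p z) - cmod (q z))\<^sup>2 / t" using t by simp
    also have "\<dots> = t * (cmod (p z))\<^sup>2 + (cmod (q z))\<^sup>2 / t - 2 * cmod (p z) * cmod (q z)"
      using t by (simp add: field_simps power2_eq_square)
    finally show "cmod (p z * cnj (q z)) \<le> (t * (cmod (p z))\<^sup>2 + (cmod (q z))\<^sup>2 / t) / 2"
      by (simp add: norm_mult)
  qed
  also have "\<dots> = (t * bergman_norm2 p + bergman_norm2 q / t) / 2"
    unfolding bergman_norm2_def using integrable_poly_sq[OF p] integrable_poly_sq[OF q] by simp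
  finally show ?thesis .
qed

text \<open>Up to the factor \<open>n + d\<close>, \<open>\<partial>\<^sub>i\<close> is the adjoint of multiplication by \<open>z\<^sub>i\<close>; combined with
  Euler's identity this replaces the explicit norms of the monomials.\<close>

lemma sum_bergman_norm2_partial_deriv:
  fixes p :: "complex ^ 'd::finite \<Rightarrow> complex"
  assumes p: "homogeneous_poly (Suc n) p"
  shows "(\<Sum>i\<in>UNIV. bergman_norm2 (partial_deriv i p)) = real (Suc n) * real (n + CARD('d) + 1) * bergman_norm2 p"
proof -
  have p': "homogeneous_poly n (partial_deriv i p)" for i using homogeneous_poly_partial_deriv[OF p, of i] by simp
  have "complex_of_real (\<Sum>i\<in>UNIV. bergman_norm2 (partial_deriv i p)) = (\<Sum>i\<in>UNIV. bergman_ip (partial_deriv i p) (partial_deriv i p))"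
    by (simp add: bergman_ip_self)
  also have "\<dots> = of_nat (n + CARD('d) + 1) * (\<Sum>i\<in>UNIV. bergman_ip p (\<lambda>z. z $ i * partial_deriv i p z))"
    unfolding bergman_ip_adjoint[OF p p'] sum_distrib_left ..
  also have "(\<Sum>i\<in>UNIV. bergman_ip p (\<lambda>z. z $ i * partial_deriv i p z)) = bergman_ip p (\<lambda>z. \<Sum>i\<in>UNIV. z $ i * partial_deriv i p z)"
    by (rule bergman_ip_sum_right[symmetric]) (use homogeneous_poly_vec_nth_mult[OF p'] p in auto)
  also have "\<dots> = of_nat (Suc n) * bergman_ip p p"
    unfolding homogeneous_poly_euler[OF p] by (simp add: bergman_ip_cmult_right)
  finally have "complex_of_real (\<Sum>i\<in>UNIV. bergman_norm2 (partial_deriv i p)) = complex_of_real (real (Suc n) * real (n + CARD('d) + 1) * bergman_norm2 p)"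
    by (simp add: bergman_ip_self mult_ac)
  then show ?thesis by (simp only: of_real_eq_iff)
qed

text \<open>Pairing the row product with itself and applying the adjoint relation leaves its partial
  derivatives against the \<open>p i\<close>. Their norms sum to a multiple of the norm of the
  product, so they can be absorbed on the left.\<close>

lemma bergman_norm2_row_mult:
  fixes p :: "'d::finite \<Rightarrow> complex ^ 'd \<Rightarrow> complex"
  assumes p: "\<And>i. homogeneous_poly n (p i)"
  shows "real (n + CARD('d) + 1) * bergman_norm2 (\<lambda>z. \<Sum>i\<in>UNIV. z $ i * p i z) \<le> real (Suc n) * (\<Sum>i\<in>UNIV. bergman_norm2 (p i))"
proof -
  define g where "g = (\<lambda>z. \<Sum>i\<in>UNIV. z $ i * p i z)"
  have zp: "homogeneous_poly (Suc n) (\<lambda>z. z $ i * p i z)" for i by (intro homogeneous_poly_vec_nth_mult p)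
  have g: "homogeneous_poly (Suc n) g" unfolding g_def by (intro homogeneous_poly_sum zp)
  have g': "homogeneous_poly n (partial_deriv i g)" for i using homogeneous_poly_partial_deriv[OF g, of i] by simp
  let ?N = "real (n + CARD('d) + 1)" and ?n = "real (Suc n)"
  have "complex_of_real (?N * bergman_norm2 g) = of_nat (n + CARD('d) + 1) * bergman_ip g (\<lambda>z. \<Sum>i\<in>UNIV. z $ i * p i z)"
    by (simp add: bergman_ip_self flip: g_def)
  also have "\<dots> = (\<Sum>i\<in>UNIV. bergman_ip (partial_deriv i g) (p i))"
    unfolding bergman_ip_adjoint[OF g p] bergman_ip_sum_right[OF zp g] sum_distrib_left ..
  finally have "?N * bergman_norm2 g = cmod (\<Sum>i\<in>UNIV. bergman_ip (partial_deriv i g) (p i))"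
    using bergman_norm2_nonneg[of g] by (metis norm_of_real abs_of_nonneg mult_nonneg_nonneg of_nat_0_le_iff)
  \<comment> \<open>The parameter \<open>t = 1 / ?n\<close> makes the derivative term equal to
    \<open>?N * bergman_norm2 g\<close>, and half of it is subtracted afterwards.\<close>
  also have "\<dots> \<le> (\<Sum>i\<in>UNIV. (1 / ?n * bergman_norm2 (partial_deriv i g) + bergman_norm2 (p i) / (1 / ?n)) / 2)"
    by (rule order_trans[OF norm_sum sum_mono]) (rule norm_bergman_ip_le[OF g' p], simp)
  also have "\<dots> = (1 / ?n * (\<Sum>i\<in>UNIV. bergman_norm2 (partial_deriv i g)) + ?n * (\<Sum>i\<in>UNIV. bergman_norm2 (p i))) / 2"
    by (simp add: sum.distrib sum_divide_distrib sum_distrib_left mult.commute add_divide_distrib)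
  also have "1 / ?n * (\<Sum>i\<in>UNIV. bergman_norm2 (partial_deriv i g)) = ?N * bergman_norm2 g"
    unfolding sum_bergman_norm2_partial_deriv[OF g] by simp
  finally have "?N * bergman_norm2 g \<le> (?N * bergman_norm2 g + ?n * (\<Sum>i\<in>UNIV. bergman_norm2 (p i))) / 2" .
  moreover have "x \<le> y" if "x \<le> (x + y) / 2" for x y :: real using that by simp
  ultimately have "?N * bergman_norm2 g \<le> ?n * (\<Sum>i\<in>UNIV. bergman_norm2 (p i))" by blast
  then show ?thesis unfolding g_def .
qed

text \<open>The Taylor coefficients of \<open>(1 - x) powr (-a)\<close>.\<close>

definition kernel_coeff :: "real \<Rightarrow> nat \<Rightarrow> real"
  where "kernel_coeff a n = pochhammer a n / fact n"

lemma kernel_coeff_0 [simp]: "kernel_coeff a 0 = 1"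
  by (simp add: kernel_coeff_def)

lemma kernel_coeff_pos: "a > 0 \<Longrightarrow> kernel_coeff a n > 0"
  by (simp add: kernel_coeff_def pochhammer_pos)

lemma kernel_coeff_Suc: "kernel_coeff a (Suc n) = kernel_coeff a n * (a + real n) / real (Suc n)"
  by (simp add: kernel_coeff_def pochhammer_Suc)

lemma sum_cauchy_schwarz_complex:
  fixes a b :: "'i \<Rightarrow> complex"
  shows "(cmod (\<Sum>i\<in>A. a i * b i))\<^sup>2 \<le> (\<Sum>i\<in>A. (cmod (a i))\<^sup>2) * (\<Sum>i\<in>A. (cmod (b i))\<^sup>2)"
proof -
  have "(cmod (\<Sum>i\<in>A. a i * b i))\<^sup>2 \<le> (\<Sum>i\<in>A. cmod (a i) * cmod (b i))\<^sup>2"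
    by (intro power_mono order_trans[OF norm_sum]) (simp_all add: norm_mult)
  also have "\<dots> \<le> (\<Sum>i\<in>A. (cmod (a i))\<^sup>2) * (\<Sum>i\<in>A. (cmod (b i))\<^sup>2)"
    by (rule Cauchy_Schwarz_ineq_sum)
  finally show ?thesis .
qed

text \<open>The constant is the coefficient of <z, w>^n in the Bergman kernel, so the bound is
  sharp. The induction reaches it through Euler's identity, Cauchy-Schwarz and the norm formula for
  the derivatives.\<close>

lemma homogeneous_poly_pointwise_bound:
  fixes p :: "complex ^ 'd::finite \<Rightarrow> complex"
  shows "homogeneous_poly n p \<Longrightarrow> (cmod (p z))\<^sup>2 \<le> kernel_coeff (real CARD('d) + 1) n * bergman_norm2 p * (norm z) ^ (2 * n)"
proof (induction n arbitrary: p)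
  case 0
  have "measure V (space V :: (complex ^ 'd) set) = 1" by (simp add: measure_def emeasure_V_space)
  moreover have "p = (\<lambda>z. p 0)" using homogeneous_poly_0_const[OF 0] by blast
  then have "bergman_norm2 p = (LINT z|(V :: (complex ^ 'd) measure). (cmod (p 0))\<^sup>2)" unfolding bergman_norm2_def by metis
  ultimately have "bergman_norm2 p = (cmod (p 0))\<^sup>2" by simp
  then show ?case using homogeneous_poly_0_const[OF 0, of z] by simp
next
  case (Suc n)
  let ?k = "kernel_coeff (real CARD('d) + 1) n"
  have p': "homogeneous_poly n (partial_deriv i p)" for i using homogeneous_poly_partial_deriv[OF Suc.prems, of i] by simp
  have "(real (Suc n))\<^sup>2 * (cmod (p z))\<^sup>2 = (cmod (\<Sum>i\<in>UNIV. z $ i * partial_deriv i p z))\<^sup>2"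
    unfolding homogeneous_poly_euler[OF Suc.prems] by (simp only: norm_mult power_mult_distrib norm_of_nat)
  also have "\<dots> \<le> (norm z)\<^sup>2 * (\<Sum>i\<in>UNIV. (cmod (partial_deriv i p z))\<^sup>2)"
    unfolding norm_vec_power2 by (rule sum_cauchy_schwarz_complex)
  also have "\<dots> \<le> (norm z)\<^sup>2 * (\<Sum>i\<in>UNIV. ?k * bergman_norm2 (partial_deriv i p) * norm z ^ (2 * n))"
    by (intro mult_left_mono sum_mono Suc.IH p') simp
  also have "\<dots> = (norm z)\<^sup>2 * (?k * (\<Sum>i\<in>UNIV. bergman_norm2 (partial_deriv i p)) * norm z ^ (2 * n))"
    by (simp only: sum_distrib_left sum_distrib_right)
  also have "\<dots> = (real (Suc n))\<^sup>2 * (kernel_coeff (real CARD('d) + 1) (Suc n) * bergman_norm2 p * norm z ^ (2 * Suc n))"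
    unfolding sum_bergman_norm2_partial_deriv[OF Suc.prems] kernel_coeff_Suc
    by (simp add: power2_eq_square field_simps)
  finally show ?case by (simp del: of_nat_Suc)
qed

section \<open>Parseval's identity\<close>

lemma bergman_norm2_sum_homogeneous:
  fixes p :: "nat \<Rightarrow> complex ^ 'd::finite \<Rightarrow> complex"
  assumes p: "\<And>n. homogeneous_poly n (p n)"
  shows "(LINT z|V. (cmod (\<Sum>n<T. p n z))\<^sup>2) = (\<Sum>n<T. bergman_norm2 (p n))"
proof -
  have int: "integrable V (\<lambda>z. p n z * cnj (p m z))" for n m
    by (rule integrable_poly_product[OF p p])
  have "complex_of_real (LINT z|V. (cmod (\<Sum>n<T. p n z))\<^sup>2) = (LINT z|V. (\<Sum>n<T. p n z) * cnj (\<Sum>n<T. p n z))"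
    unfolding integral_complex_of_real[symmetric] complex_norm_square ..
  also have "\<dots> = (LINT z|V. (\<Sum>n<T. \<Sum>m<T. p n z * cnj (p m z)))"
    by (simp add: sum_product)
  also have "\<dots> = (\<Sum>n<T. \<Sum>m<T. bergman_ip (p n) (p m))"
    unfolding bergman_ip_def by (simp add: Bochner_Integration.integral_sum Bochner_Integration.integrable_sum int)
  also have "\<dots> = (\<Sum>n<T. \<Sum>m<T. if m = n then bergman_ip (p n) (p n) else 0)"
    using bergman_ip_orthogonal[OF p p] by (intro sum.cong refl) auto
  also have "\<dots> = (\<Sum>n<T. bergman_ip (p n) (p n))" by (intro sum.cong refl) simp
  also have "\<dots> = complex_of_real (\<Sum>n<T. bergman_norm2 (p n))" by (simp add: bergman_ip_self)
  finally show ?thesis by (simp only: of_real_eq_iff)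
qed

lemma bergman_norm2_cmult: "bergman_norm2 (\<lambda>z. c * p z) = (cmod c)\<^sup>2 * bergman_norm2 p"
  by (simp add: bergman_norm2_def norm_mult power_mult_distrib)

lemma continuous_on_scaled_Hol:
  fixes f :: "complex ^ 'd::finite \<Rightarrow> complex"
  assumes f: "f \<in> Hol" and r: "0 < r" "r < 1"
  shows "continuous_on (cball 0 1) (\<lambda>z. f (r *\<^sub>R z))"
proof -
  have lt: "r *\<^sub>R z \<in> unit_ball" if "z \<in> cball 0 1" for z :: "complex ^ 'd"
  proof -
    have n: "norm z \<le> 1" using that by simp
    have "norm (r *\<^sub>R z) \<le> r * 1" using mult_left_mono[OF n, of r] r by (simp only: norm_scaleR abs_of_pos)
    then show ?thesis using r(2) by simp
  qed
  show ?thesis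
    by (rule continuous_on_compose2[OF continuous_on_Hol[OF f], of _ "\<lambda>z. r *\<^sub>R z"])
       (intro continuous_intros image_subsetI lt; assumption)+
qed

text \<open>After a dilation by \<open>r < 1\<close> the partial sums are bounded by a geometric
  series on the ball, so dominated convergence applies to the orthogonal sums.\<close>

lemma parseval_scaled:
  fixes f :: "complex ^ 'd::finite \<Rightarrow> complex"
  assumes f: "f \<in> Hol" and r: "0 < r" "r < 1"
  shows "(\<lambda>n. r ^ (2 * n) * bergman_norm2 (hom_expansion f n)) sums (LINT z|V. (cmod (f (r *\<^sub>R z)))\<^sup>2)"
    and "integrable V (\<lambda>z. (cmod (f (r *\<^sub>R z)))\<^sup>2)"
proof -
  \<comment> \<open>Cauchy's bound at a radius strictly between \<open>r\<close> and 1 gives the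
    ratio \<open>r / R < 1\<close>.\<close>
  define R where "R = (1 + r) / 2"
  have R: "0 < R" "R < 1" "r < R" using r by (auto simp: R_def)
  obtain M where M: "M \<ge> 0" "\<And>n z. cmod (hom_expansion f n z) \<le> M * (norm z / R) ^ n"
    using hom_expansion_bound[OF f R(1,2)] by blast
  let ?p = "\<lambda>n z. of_real (r ^ n) * hom_expansion f n z"
  have p: "homogeneous_poly n (?p n)" for n by (intro homogeneous_poly_cmult homogeneous_poly_hom_expansion f)
  have sp: "hom_expansion f n (r *\<^sub>R z) = ?p n z" for n z
    by (rule homogeneous_poly_scaleR[OF homogeneous_poly_hom_expansion[OF f]])
  define B where "B = M * (1 / (1 - r / R))"
  have fm: "(\<lambda>z. (cmod (f (r *\<^sub>R z)))\<^sup>2) \<in> borel_measurable V"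
    by (rule borel_measurable_V_continuous_on)
       (intro continuous_intros continuous_on_subset[OF continuous_on_scaled_Hol[OF f r] ball_subset_cball])
  have bound: "cmod (\<Sum>n<T. ?p n z) \<le> B" if "norm z < 1" for T z
  proof -
    have "cmod (\<Sum>n<T. ?p n z) \<le> (\<Sum>n<T. M * (r / R) ^ n)"
    proof (rule sum_norm_le)
      fix n
      have "cmod (?p n z) \<le> M * (norm (r *\<^sub>R z) / R) ^ n" unfolding sp[symmetric] by (rule M)
      also have "\<dots> \<le> M * (r / R) ^ n"
        using r R M that mult_left_mono[of "norm z" 1 r]
        by (intro mult_left_mono power_mono divide_right_mono) auto
      finally show "cmod (?p n z) \<le> M * (r / R) ^ n" .
    qed
    also have "\<dots> = M * (\<Sum>n<T. (r / R) ^ n)" by (simp add: sum_distrib_left)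
    also have "\<dots> \<le> M * (\<Sum>n. (r / R) ^ n)"
      using r R by (intro mult_left_mono sum_le_suminf M summable_geometric) auto
    also have "(\<Sum>n. (r / R) ^ n) = 1 / (1 - r / R)" using r R by (intro suminf_geometric) auto
    finally show ?thesis by (simp add: B_def)
  qed
  interpret finite_measure "V :: (complex ^ 'd) measure" by (rule finite_measure_V)
  have w: "integrable (V :: (complex ^ 'd) measure) (\<lambda>_. B\<^sup>2)" by simp
  have m: "(\<lambda>z. (cmod (\<Sum>n<T. ?p n z))\<^sup>2) \<in> borel_measurable V" for T
    by (rule borel_measurable_V_continuous_on)
       (intro continuous_intros continuous_on_homogeneous_poly[OF homogeneous_poly_hom_expansion[OF f]])
  have b: "AE z in V. norm ((cmod (\<Sum>n<T. ?p n z))\<^sup>2) \<le> B\<^sup>2" for T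
  proof (rule AE_I2)
    fix z :: "complex ^ 'd" assume "z \<in> space V"
    then have "norm z < 1" by (simp add: space_V)
    from power_mono[OF bound[OF this, of T], of 2]
    show "norm ((cmod (\<Sum>n<T. ?p n z))\<^sup>2) \<le> B\<^sup>2" by simp
  qed
  have c: "AE z in V. (\<lambda>T. (cmod (\<Sum>n<T. ?p n z))\<^sup>2) \<longlonglongrightarrow> (cmod (f (r *\<^sub>R z)))\<^sup>2"
  proof (rule AE_I2)
    fix z :: "complex ^ 'd" assume "z \<in> space V"
    then have "r *\<^sub>R z \<in> unit_ball" using r mult_strict_mono[of r 1 "norm z" 1] by (simp add: space_V)
    from hom_expansion_sums[OF f this] show "(\<lambda>T. (cmod (\<Sum>n<T. ?p n z))\<^sup>2) \<longlonglongrightarrow> (cmod (f (r *\<^sub>R z)))\<^sup>2"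
      unfolding sums_def sp by (intro tendsto_power tendsto_norm)
  qed
  have "(\<lambda>T. LINT z|V. (cmod (\<Sum>n<T. ?p n z))\<^sup>2) \<longlonglongrightarrow> (LINT z|V. (cmod (f (r *\<^sub>R z)))\<^sup>2)"
    by (rule integral_dominated_convergence[OF fm m w c b])
  moreover have "integrable V (\<lambda>z. (cmod (f (r *\<^sub>R z)))\<^sup>2)"
    by (rule integrable_dominated_convergence[OF fm m w c b])
  moreover have "(LINT z|V. (cmod (\<Sum>n<T. ?p n z))\<^sup>2) = (\<Sum>n<T. r ^ (2 * n) * bergman_norm2 (hom_expansion f n))" for T
    unfolding bergman_norm2_sum_homogeneous[OF p] bergman_norm2_cmult norm_of_real
    by (intro sum.cong refl) (simp add: power_mult[symmetric] mult.commute)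
  ultimately show "(\<lambda>n. r ^ (2 * n) * bergman_norm2 (hom_expansion f n)) sums (LINT z|V. (cmod (f (r *\<^sub>R z)))\<^sup>2)"
     "integrable V (\<lambda>z. (cmod (f (r *\<^sub>R z)))\<^sup>2)"
    unfolding sums_def by simp_all
qed

lemma parseval_ball:
  fixes f :: "complex ^ 'd::finite \<Rightarrow> complex"
  assumes f: "f \<in> Hol" and r: "0 < r" "r < 1"
  shows "(\<integral>\<^sup>+z. ennreal ((cmod (f z))\<^sup>2) * indicator (ball 0 r) z \<partial>V) =
    (\<Sum>n. ennreal (r ^ (2 * (n + CARD('d))) * bergman_norm2 (hom_expansion f n)))"
proof -
  \<comment> \<open>Values of \<open>f\<close> off the ball are arbitrary; cutting them off gives a
    Borel function on the whole space, to which the scaling rule applies.\<close>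
  let ?g = "\<lambda>z. ennreal ((cmod (indicator unit_ball z *\<^sub>R f z))\<^sup>2)"
  have m: "?g \<in> borel_measurable borel"
    using borel_measurable_continuous_on_indicator[OF _ continuous_on_Hol[OF f]] by measurable
  have "(\<integral>\<^sup>+z. ennreal ((cmod (f z))\<^sup>2) * indicator (ball 0 r) z \<partial>V) = (\<integral>\<^sup>+z. ?g z * indicator (ball 0 r) z \<partial>V)"
    by (intro nn_integral_cong) (simp add: space_V)
  also have "\<dots> = ennreal (r ^ (2 * CARD('d))) * (\<integral>\<^sup>+z. ?g (r *\<^sub>R z) \<partial>V)"
    by (rule nn_integral_V_scale[OF m]) (use r in auto)
  also have "(\<integral>\<^sup>+z. ?g (r *\<^sub>R z) \<partial>V) = (\<integral>\<^sup>+z. ennreal ((cmod (f (r *\<^sub>R z)))\<^sup>2) \<partial>V)"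
  proof (rule nn_integral_cong)
    fix z :: "complex ^ 'd" assume "z \<in> space V"
    then have "r *\<^sub>R z \<in> unit_ball" using r mult_strict_mono[of r 1 "norm z" 1] by (simp add: space_V)
    then show "?g (r *\<^sub>R z) = ennreal ((cmod (f (r *\<^sub>R z)))\<^sup>2)" by simp
  qed
  also have "\<dots> = ennreal (LINT z|V. (cmod (f (r *\<^sub>R z)))\<^sup>2)"
    by (rule nn_integral_eq_integral[OF parseval_scaled(2)[OF f r]]) simp
  also have "\<dots> = (\<Sum>n. ennreal (r ^ (2 * n) * bergman_norm2 (hom_expansion f n)))"
    using parseval_scaled(1)[OF f r] r
    by (subst suminf_ennreal2) (auto simp: sums_iff bergman_norm2_nonneg)
  also have "ennreal (r ^ (2 * CARD('d))) * \<dots> = (\<Sum>n. ennreal (r ^ (2 * (n + CARD('d))) * bergman_norm2 (hom_expansion f n)))"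
    using r
    by (simp add: bergman_norm2_nonneg ennreal_suminf_cmult[symmetric] ennreal_mult[symmetric] power_add mult_ac distrib_left)
  finally show ?thesis .
qed

text \<open>Each layer of the layer-cake formula is already diagonal by
  \<open>parseval_ball\<close>. The identity lives in the extended non-negative numbers, so it
  decides integrability and gives the value at once.\<close>

lemma parseval_radial_weight:
  fixes f :: "complex ^ 'd::finite \<Rightarrow> complex"
  assumes f: "f \<in> Hol" and b: "\<beta> > 0"
  shows "(\<integral>\<^sup>+z. ennreal ((cmod (f z))\<^sup>2 * radial_weight \<beta> z) \<partial>V) =
    (\<Sum>n. ennreal (radial_moment \<beta> (2 * (n + CARD('d))) * bergman_norm2 (hom_expansion f n)))"
proof -
  let ?g = "\<lambda>z. ennreal ((cmod (indicator unit_ball z *\<^sub>R f z))\<^sup>2)"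
  let ?w = "\<lambda>u. ennreal (\<beta> * (1 - u) powr (\<beta> - 1)) * indicator {0<..<1} u"
  have m: "?g \<in> borel_measurable borel"
    using borel_measurable_continuous_on_indicator[OF _ continuous_on_Hol[OF f]] by measurable
  have "(\<integral>\<^sup>+z. ennreal ((cmod (f z))\<^sup>2 * radial_weight \<beta> z) \<partial>V) = (\<integral>\<^sup>+z. ?g z * ennreal (radial_weight \<beta> z) \<partial>V)"
    by (intro nn_integral_cong) (simp add: space_V ennreal_mult radial_weight_nonneg)
  also have "\<dots> = (\<integral>\<^sup>+u. ?w u * (\<integral>\<^sup>+z. ?g z * indicator (ball 0 (sqrt u)) z \<partial>V) \<partial>lborel)"
    by (rule nn_integral_V_radial_weight[OF m b])
  also have "\<dots> = (\<integral>\<^sup>+u. (\<Sum>n. ennreal (bergman_norm2 (hom_expansion f n)) * (?w u * ennreal (sqrt u ^ (2 * (n + CARD('d)))))) \<partial>lborel)"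
  proof (rule nn_integral_cong)
    fix u :: real
    have "(\<integral>\<^sup>+z. ?g z * indicator (ball 0 (sqrt u)) z \<partial>V) = (\<integral>\<^sup>+z. ennreal ((cmod (f z))\<^sup>2) * indicator (ball 0 (sqrt u)) z \<partial>V)"
      by (intro nn_integral_cong) (simp add: space_V)
    then have "(\<integral>\<^sup>+z. ?g z * indicator (ball 0 (sqrt u)) z \<partial>V) = (\<Sum>n. ennreal (bergman_norm2 (hom_expansion f n)) * ennreal (sqrt u ^ (2 * (n + CARD('d)))))"
      if "0 < u" "u < 1"
      using parseval_ball[OF f, of "sqrt u"] that by (simp add: bergman_norm2_nonneg ennreal_mult mult.commute)
    then show "?w u * (\<integral>\<^sup>+z. ?g z * indicator (ball 0 (sqrt u)) z \<partial>V) =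
      (\<Sum>n. ennreal (bergman_norm2 (hom_expansion f n)) * (?w u * ennreal (sqrt u ^ (2 * (n + CARD('d))))))"
      by (auto split: split_indicator simp: ennreal_suminf_cmult[symmetric] mult.left_commute)
  qed
  also have "\<dots> = (\<Sum>n. \<integral>\<^sup>+u. ennreal (bergman_norm2 (hom_expansion f n)) * (?w u * ennreal (sqrt u ^ (2 * (n + CARD('d))))) \<partial>lborel)"
    by (rule nn_integral_suminf) measurable
  also have "\<dots> = (\<Sum>n. ennreal (bergman_norm2 (hom_expansion f n)) * ennreal (radial_moment \<beta> (2 * (n + CARD('d)))))"
    unfolding radial_moment_ennreal[OF b, symmetric] by (intro arg_cong[of _ _ suminf] ext nn_integral_cmult) measurable
  also have "\<dots> = (\<Sum>n. ennreal (radial_moment \<beta> (2 * (n + CARD('d))) * bergman_norm2 (hom_expansion f n)))"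
    by (simp add: ennreal_mult less_imp_le[OF radial_moment_pos[OF b]] bergman_norm2_nonneg mult.commute)
  finally show ?thesis .
qed

lemma borel_measurable_V_weighted_Hol:
  "f \<in> Hol \<Longrightarrow> (\<lambda>z. (cmod (f z))\<^sup>2 * radial_weight \<beta> z) \<in> borel_measurable V"
  using borel_measurable_V_continuous_on[OF continuous_on_Hol] borel_measurable_V[OF borel_measurable_radial_weight]
  by measurable

lemma L2a_radial_weight_iff:
  fixes f :: "complex ^ 'd::finite \<Rightarrow> complex"
  assumes f: "f \<in> Hol" and b: "\<beta> > 0"
  shows "f \<in> L2a (radial_weight \<beta>) \<longleftrightarrow> summable (\<lambda>n. radial_moment \<beta> (2 * (n + CARD('d))) * bergman_norm2 (hom_expansion f n))"
    and "f \<in> L2a (radial_weight \<beta>) \<Longrightarrow>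
      (LINT z|V. (cmod (f z))\<^sup>2 * radial_weight \<beta> z) = (\<Sum>n. radial_moment \<beta> (2 * (n + CARD('d))) * bergman_norm2 (hom_expansion f n))"
proof -
  let ?a = "\<lambda>n. radial_moment \<beta> (2 * (n + CARD('d))) * bergman_norm2 (hom_expansion f n)"
  have a: "?a n \<ge> 0" for n by (intro mult_nonneg_nonneg less_imp_le[OF radial_moment_pos[OF b]] bergman_norm2_nonneg)
  have "f \<in> L2a (radial_weight \<beta>) \<longleftrightarrow> integrable V (\<lambda>z. (cmod (f z))\<^sup>2 * radial_weight \<beta> z)"
    using f borel_measurable_V_continuous_on[OF continuous_on_Hol[OF f]] by (simp add: L2a_def L2_def)
  also have "\<dots> \<longleftrightarrow> (\<integral>\<^sup>+z. ennreal ((cmod (f z))\<^sup>2 * radial_weight \<beta> z) \<partial>V) < \<infinity>"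
    unfolding integrable_iff_bounded using borel_measurable_V_weighted_Hol[OF f]
    by (simp add: radial_weight_nonneg abs_mult)
  also have "\<dots> \<longleftrightarrow> summable ?a"
    unfolding parseval_radial_weight[OF f b]
  proof
    assume "(\<Sum>n. ennreal (?a n)) < \<infinity>"
    then have "(\<Sum>n. ennreal (?a n)) \<noteq> top" unfolding infinity_ennreal_def by (rule less_imp_neq)
    then show "summable ?a" by (rule summable_suminf_not_top[OF a])
  next
    assume "summable ?a"
    then show "(\<Sum>n. ennreal (?a n)) < \<infinity>" by (subst suminf_ennreal2[OF a]) simp_all
  qed
  finally show iff: "f \<in> L2a (radial_weight \<beta>) \<longleftrightarrow> summable ?a" .
  assume L: "f \<in> L2a (radial_weight \<beta>)"
  with iff have "summable ?a" by blast
  then have e: "(\<integral>\<^sup>+z. ennreal ((cmod (f z))\<^sup>2 * radial_weight \<beta> z) \<partial>V) = ennreal (\<Sum>n. ?a n)"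
    unfolding parseval_radial_weight[OF f b] by (rule suminf_ennreal2[OF a])
  have "(LINT z|V. (cmod (f z))\<^sup>2 * radial_weight \<beta> z) = enn2real (\<integral>\<^sup>+z. ennreal ((cmod (f z))\<^sup>2 * radial_weight \<beta> z) \<partial>V)"
    by (rule integral_eq_nn_integral[OF borel_measurable_V_weighted_Hol[OF f]]) (simp add: radial_weight_nonneg)
  also have "\<dots> = (\<Sum>n. ?a n)"
    unfolding e by (rule enn2real_ennreal) (rule suminf_nonneg[OF \<open>summable ?a\<close> a])
  finally show "(LINT z|V. (cmod (f z))\<^sup>2 * radial_weight \<beta> z) = (\<Sum>n. ?a n)" .
qed

section \<open>Spaces defined by weighting the homogeneous components\<close>

definition component_space :: "(nat \<Rightarrow> real) \<Rightarrow> 'd::finite fn_space"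
  where "component_space w = \<lparr>funs = {f \<in> Hol. summable (\<lambda>n. w n * bergman_norm2 (hom_expansion f n))},
     fnorm = (\<lambda>f. sqrt (\<Sum>n. w n * bergman_norm2 (hom_expansion f n)))\<rparr>"

text \<open>The summability condition says that the reproducing kernel is finite on the ball.\<close>

definition kernel_weight :: "'d::finite itself \<Rightarrow> (nat \<Rightarrow> real) \<Rightarrow> bool"
  where "kernel_weight _ w \<longleftrightarrow> (\<forall>n. w n > 0) \<and>
    (\<forall>x. 0 \<le> x \<longrightarrow> x < 1 \<longrightarrow> summable (\<lambda>n. kernel_coeff (real CARD('d) + 1) n / w n * x ^ n))"

lemma funs_component_space_iff: "f \<in> funs (component_space w) \<longleftrightarrow> f \<in> Hol \<and> summable (\<lambda>n. w n * bergman_norm2 (hom_expansion f n))"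
  by (simp add: component_space_def)

lemma fnorm_component_space: "fnorm (component_space w) f = sqrt (\<Sum>n. w n * bergman_norm2 (hom_expansion f n))"
  by (simp add: component_space_def)

lemma component_space_Hol: "f \<in> funs (component_space w) \<Longrightarrow> f \<in> Hol"
  by (simp add: funs_component_space_iff)

lemma weighted_bergman_norm2_nonneg: "(\<And>n. w n > 0) \<Longrightarrow> 0 \<le> w n * bergman_norm2 p" for w :: "nat \<Rightarrow> real"
  by (intro mult_nonneg_nonneg bergman_norm2_nonneg less_imp_le)

lemma fnorm_component_space_power2:
  assumes "\<And>n. w n > 0" "f \<in> funs (component_space w)"
  shows "(fnorm (component_space w) f)\<^sup>2 = (\<Sum>n. w n * bergman_norm2 (hom_expansion f n))"
  unfolding fnorm_component_space using assms
  by (intro real_sqrt_pow2 suminf_nonneg weighted_bergman_norm2_nonneg) (auto simp: funs_component_space_iff)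

lemma fnorm_component_space_nonneg:
  assumes "\<And>n. w n > 0" "f \<in> funs (component_space w)"
  shows "0 \<le> fnorm (component_space w) f"
  unfolding fnorm_component_space using assms
  by (intro real_sqrt_ge_zero suminf_nonneg weighted_bergman_norm2_nonneg) (auto simp: funs_component_space_iff)

lemma bergman_norm2_add_le:
  assumes p: "homogeneous_poly n p" and q: "homogeneous_poly n q"
  shows "bergman_norm2 (\<lambda>z. p z + q z) \<le> 2 * bergman_norm2 p + 2 * bergman_norm2 q"
proof -
  have "bergman_norm2 (\<lambda>z. p z + q z) \<le> (LINT z|V. 2 * (cmod (p z))\<^sup>2 + 2 * (cmod (q z))\<^sup>2)"
    unfolding bergman_norm2_def
  proof (rule integral_mono)
    show "integrable V (\<lambda>z. (cmod (p z + q z))\<^sup>2)" by (rule integrable_poly_sq[OF homogeneous_poly_add[OF p q]])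
    show "integrable V (\<lambda>z. 2 * (cmod (p z))\<^sup>2 + 2 * (cmod (q z))\<^sup>2)"
      using integrable_poly_sq[OF p] integrable_poly_sq[OF q] by simp
    fix z
    have "(cmod (p z + q z))\<^sup>2 \<le> (cmod (p z) + cmod (q z))\<^sup>2" by (intro power_mono norm_triangle_ineq) simp
    also have "\<dots> \<le> 2 * (cmod (p z))\<^sup>2 + 2 * (cmod (q z))\<^sup>2"
      using zero_le_power2[of "cmod (p z) - cmod (q z)"] by (simp add: power2_eq_square algebra_simps)
    finally show "(cmod (p z + q z))\<^sup>2 \<le> 2 * (cmod (p z))\<^sup>2 + 2 * (cmod (q z))\<^sup>2" .
  qed
  also have "\<dots> = 2 * bergman_norm2 p + 2 * bergman_norm2 q"
    unfolding bergman_norm2_def using integrable_poly_sq[OF p] integrable_poly_sq[OF q] by simp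
  finally show ?thesis .
qed

lemma bergman_norm2_le_bound:
  fixes p :: "complex ^ 'd::finite \<Rightarrow> complex"
  assumes p: "homogeneous_poly n p" and B: "\<And>z. norm z < 1 \<Longrightarrow> cmod (p z) \<le> B"
  shows "bergman_norm2 p \<le> B\<^sup>2"
proof -
  interpret finite_measure "V :: (complex ^ 'd) measure" by (rule finite_measure_V)
  have "bergman_norm2 p \<le> (LINT z|(V :: (complex ^ 'd) measure). B\<^sup>2)"
    unfolding bergman_norm2_def
    by (rule integral_mono[OF integrable_poly_sq[OF p]]) (use B in \<open>auto simp: space_V intro!: power_mono\<close>)
  also have "\<dots> = B\<^sup>2" by (simp add: measure_def emeasure_V_space)
  finally show ?thesis .
qed

lemma hom_expansion_add': "f \<in> Hol \<Longrightarrow> g \<in> Hol \<Longrightarrow> hom_expansion (\<lambda>z. f z + g z) n = (\<lambda>z. hom_expansion f n z + hom_expansion g n z)"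
  by (simp add: hom_expansion_add)

lemma component_space_cmult:
  assumes "f \<in> funs (component_space w)"
  shows "(\<lambda>z. c * f z) \<in> funs (component_space w)"
    and "fnorm (component_space w) (\<lambda>z. c * f z) = cmod c * fnorm (component_space w) f"
proof -
  have eq: "(\<lambda>n. w n * bergman_norm2 (hom_expansion (\<lambda>z. c * f z) n)) = (\<lambda>n. (cmod c)\<^sup>2 * (w n * bergman_norm2 (hom_expansion f n)))"
    using assms by (simp add: fun_eq_iff funs_component_space_iff hom_expansion_cmult bergman_norm2_cmult)
  show "(\<lambda>z. c * f z) \<in> funs (component_space w)"
    using assms by (simp add: funs_component_space_iff Hol_cmult eq summable_mult)
  show "fnorm (component_space w) (\<lambda>z. c * f z) = cmod c * fnorm (component_space w) f"
    unfolding fnorm_component_space eq using assms by (simp add: funs_component_space_iff suminf_mult real_sqrt_mult)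
qed

lemma component_space_add:
  assumes w: "\<And>n. w n > 0" and f: "f \<in> funs (component_space w)" and g: "g \<in> funs (component_space w)"
  shows "(\<lambda>z. f z + g z) \<in> funs (component_space w)"
proof -
  have "summable (\<lambda>n. w n * bergman_norm2 (hom_expansion (\<lambda>z. f z + g z) n))"
  proof (rule summable_comparison_test'[of "\<lambda>n. 2 * (w n * bergman_norm2 (hom_expansion f n)) + 2 * (w n * bergman_norm2 (hom_expansion g n))" 0])
    show "summable (\<lambda>n. 2 * (w n * bergman_norm2 (hom_expansion f n)) + 2 * (w n * bergman_norm2 (hom_expansion g n)))"
      using f g by (intro summable_add summable_mult) (auto simp: funs_component_space_iff)
    fix n
    have "w n * bergman_norm2 (hom_expansion (\<lambda>z. f z + g z) n) \<le> w n * (2 * bergman_norm2 (hom_expansion f n) + 2 * bergman_norm2 (hom_expansion g n))"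
      unfolding hom_expansion_add'[OF component_space_Hol[OF f] component_space_Hol[OF g]]
      using w[of n] by (intro mult_left_mono bergman_norm2_add_le[OF homogeneous_poly_hom_expansion[OF component_space_Hol[OF f]]
            homogeneous_poly_hom_expansion[OF component_space_Hol[OF g]]]) auto
    then show "norm (w n * bergman_norm2 (hom_expansion (\<lambda>z. f z + g z) n)) \<le> 2 * (w n * bergman_norm2 (hom_expansion f n)) + 2 * (w n * bergman_norm2 (hom_expansion g n))"
      using w[of n] bergman_norm2_nonneg[of "hom_expansion (\<lambda>z. f z + g z) n"] by (simp add: algebra_simps)
  qed
  then show ?thesis using Hol_add component_space_Hol[OF f] component_space_Hol[OF g] by (simp add: funs_component_space_iff)
qed

lemma component_space_diff:
  assumes w: "\<And>n. w n > 0" and f: "f \<in> funs (component_space w)" and g: "g \<in> funs (component_space w)"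
  shows "(\<lambda>z. f z - g z) \<in> funs (component_space w)"
  using component_space_add[OF w f component_space_cmult(1)[OF g, of "-1"]] by simp

text \<open>Cauchy-Schwarz over the degrees. The first factor is the square root of the reproducing
  kernel on the diagonal at radius \<open>r\<close>, so the bound is uniform on the closed ball of
  that radius.\<close>

lemma component_space_pointwise_bound:
  fixes f :: "complex ^ 'd::finite \<Rightarrow> complex"
  assumes w: "kernel_weight TYPE('d) w" and f: "f \<in> funs (component_space w)" and z: "norm z \<le> r" "r < 1"
  shows "cmod (f z) \<le> sqrt (\<Sum>n. kernel_coeff (real CARD('d) + 1) n / w n * (r\<^sup>2) ^ n) * fnorm (component_space w) f"
proof -
  let ?k = "\<lambda>n. kernel_coeff (real CARD('d) + 1) n / w n * (r\<^sup>2) ^ n"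
  let ?t = "\<lambda>n. w n * bergman_norm2 (hom_expansion f n)"
  have wp: "w n > 0" for n using w by (simp add: kernel_weight_def)
  have fH: "f \<in> Hol" and sf: "summable ?t" using f by (auto simp: funs_component_space_iff)
  have r: "0 \<le> r" using z norm_ge_zero[of z] by linarith
  have "r\<^sup>2 < 1" using r z by (simp add: power_less_one_iff)
  then have sk: "summable ?k" using w by (simp add: kernel_weight_def)
  have kp: "?k n \<ge> 0" for n using wp[of n] kernel_coeff_pos[of "real CARD('d) + 1" n] by (simp add: less_imp_le)
  have tp: "?t n \<ge> 0" for n using wp[of n] by (simp add: bergman_norm2_nonneg less_imp_le)
  have tb: "cmod (hom_expansion f n z) \<le> sqrt (?k n) * sqrt (?t n)" for n
  proof -
    have "(cmod (hom_expansion f n z))\<^sup>2 \<le> kernel_coeff (real CARD('d) + 1) n * bergman_norm2 (hom_expansion f n) * norm z ^ (2 * n)"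
      by (rule homogeneous_poly_pointwise_bound[OF homogeneous_poly_hom_expansion[OF fH]])
    also have "\<dots> \<le> kernel_coeff (real CARD('d) + 1) n * bergman_norm2 (hom_expansion f n) * r ^ (2 * n)"
      using kernel_coeff_pos[of "real CARD('d) + 1" n] z by (intro mult_left_mono power_mono) (auto simp: bergman_norm2_nonneg less_imp_le)
    also have "\<dots> = ?k n * ?t n" unfolding power_mult using wp[of n] by simp
    finally show ?thesis unfolding real_sqrt_mult[symmetric] by (rule real_le_rsqrt)
  qed
  have "(cmod (\<Sum>n<T. hom_expansion f n z))\<^sup>2 \<le> (\<Sum>n. ?k n) * (\<Sum>n. ?t n)" for T
  proof -
    have "(cmod (\<Sum>n<T. hom_expansion f n z))\<^sup>2 \<le> (\<Sum>n<T. sqrt (?k n) * sqrt (?t n))\<^sup>2"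
      by (intro power_mono sum_norm_le tb) simp
    also have "\<dots> \<le> (\<Sum>n<T. (sqrt (?k n))\<^sup>2) * (\<Sum>n<T. (sqrt (?t n))\<^sup>2)" by (rule Cauchy_Schwarz_ineq_sum)
    also have "\<dots> = (\<Sum>n<T. ?k n) * (\<Sum>n<T. ?t n)" by (simp only: real_sqrt_pow2[OF kp] real_sqrt_pow2[OF tp])
    also have "\<dots> \<le> (\<Sum>n. ?k n) * (\<Sum>n. ?t n)"
      by (intro mult_mono sum_le_suminf sk sf kp tp suminf_nonneg sum_nonneg) auto
    finally show ?thesis .
  qed
  then have "cmod (\<Sum>n<T. hom_expansion f n z) \<le> sqrt ((\<Sum>n. ?k n) * (\<Sum>n. ?t n))" for T by (rule real_le_rsqrt)
  moreover have "(\<lambda>T. cmod (\<Sum>n<T. hom_expansion f n z)) \<longlonglongrightarrow> cmod (f z)"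
    using hom_expansion_sums[OF fH, of z] z unfolding sums_def by (intro tendsto_norm) simp
  ultimately have "cmod (f z) \<le> sqrt ((\<Sum>n. ?k n) * (\<Sum>n. ?t n))" by (intro Lim_bounded) auto
  then show ?thesis by (simp add: real_sqrt_mult fnorm_component_space)
qed

lemma component_space_eq_0_iff:
  fixes f :: "complex ^ 'd::finite \<Rightarrow> complex"
  assumes w: "kernel_weight TYPE('d) w" and f: "f \<in> funs (component_space w)"
  shows "fnorm (component_space w) f = 0 \<longleftrightarrow> (\<forall>z\<in>unit_ball. f z = 0)"
proof
  assume "fnorm (component_space w) f = 0"
  then show "\<forall>z\<in>unit_ball. f z = 0" using component_space_pointwise_bound[OF w f order_refl] by fastforce
next
  assume "\<forall>z\<in>unit_ball. f z = 0"
  then have "hom_expansion f = hom_expansion (\<lambda>z. 0)" by (intro hom_expansion_cong) auto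
  also have "\<dots> = (\<lambda>n z. 0)"
    using hom_expansion_homogeneous_poly[OF homogeneous_poly_zero[of 0]] by (simp add: fun_eq_iff)
  finally show "fnorm (component_space w) f = 0" by (simp add: fnorm_component_space bergman_norm2_def)
qed

text \<open>The limit is found first as a locally uniform limit of functions, hence holomorphic.
  Cauchy's bound then gives convergence of each component, and finite partial sums carry the norm
  estimate to the limit.\<close>

lemma component_space_complete:
  fixes F :: "nat \<Rightarrow> complex ^ 'd::finite \<Rightarrow> complex"
  assumes w: "kernel_weight TYPE('d) w" and F: "\<And>k. F k \<in> funs (component_space w)"
    and C: "\<And>e. e > 0 \<Longrightarrow> \<exists>M. \<forall>k\<ge>M. \<forall>l\<ge>M. fnorm (component_space w) (\<lambda>z. F k z - F l z) < e"
  shows "\<exists>f\<in>funs (component_space w). (\<lambda>k. fnorm (component_space w) (\<lambda>z. F k z - f z)) \<longlonglongrightarrow> 0"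
proof -
  have wp: "w n > 0" for n using w by (simp add: kernel_weight_def)
  have FH: "F k \<in> Hol" for k using F by (rule component_space_Hol)
  have FD: "(\<lambda>z. F k z - F l z) \<in> funs (component_space w)" for k l by (rule component_space_diff[OF wp F F])
  define f where "f z = lim (\<lambda>k. F k z)" for z
  have ul: "uniform_limit (cball 0 r) F f sequentially" if r: "r < 1" for r
  proof -
    define K where "K = sqrt (\<Sum>n. kernel_coeff (real CARD('d) + 1) n / w n * (r\<^sup>2) ^ n)"
    have "uniformly_Cauchy_on (cball 0 r) F"
    proof (rule uniformly_Cauchy_onI)
      fix e :: real assume e: "e > 0"
      then have "e / (\<bar>K\<bar> + 1) > 0" by (simp add: add_nonneg_pos)
      from C[OF this] obtain M where M: "\<And>k l. k \<ge> M \<Longrightarrow> l \<ge> M \<Longrightarrow> fnorm (component_space w) (\<lambda>z. F k z - F l z) < e / (\<bar>K\<bar> + 1)" by blast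
      have "dist (F k z) (F l z) < e" if "z \<in> cball 0 r" "k \<ge> M" "l \<ge> M" for z k l
      proof -
        have "dist (F k z) (F l z) \<le> K * fnorm (component_space w) (\<lambda>z. F k z - F l z)"
          unfolding dist_norm K_def by (rule component_space_pointwise_bound[OF w FD]) (use that r in auto)
        also have "\<dots> \<le> (\<bar>K\<bar> + 1) * fnorm (component_space w) (\<lambda>z. F k z - F l z)"
          using fnorm_component_space_nonneg[OF wp FD] by (intro mult_right_mono) auto
        also have "\<dots> < (\<bar>K\<bar> + 1) * (e / (\<bar>K\<bar> + 1))"
          using M[OF that(2,3)] by (intro mult_strict_left_mono) auto
        also have "\<dots> = e" by (simp add: add_nonneg_eq_0_iff)
        finally show ?thesis .
      qed
      then show "\<exists>M. \<forall>x\<in>cball 0 r. \<forall>m\<ge>M. \<forall>n\<ge>M. dist (F m x) (F n x) < e" by blast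
    qed
    then have "uniformly_convergent_on (cball 0 r) F" by (rule Cauchy_uniformly_convergent)
    then obtain g where g: "uniform_limit (cball 0 r) F g sequentially" by (auto simp: uniformly_convergent_on_def)
    have "f z = g z" if "z \<in> cball 0 r" for z
      unfolding f_def by (rule limI[OF tendsto_uniform_limitI[OF g that]])
    then show ?thesis using g by (subst uniform_limit_cong'[of _ _ F]) auto
  qed
  have fH: "f \<in> Hol" unfolding Hol_iff_holo_on
  proof (rule holo_on_uniform_limit)
    fix a :: "complex ^ 'd" assume a: "a \<in> unit_ball"
    define \<rho> where "\<rho> = (1 - norm a) / 2"
    have \<rho>: "\<rho> > 0" using a by (simp add: \<rho>_def)
    have n: "norm z \<le> norm a + \<rho>" if "z \<in> ball a \<rho>" for z
      using that norm_triangle_ineq2[of z a] by (simp add: dist_norm norm_minus_commute)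
    have le: "norm a + \<rho> < 1" using a by (simp add: \<rho>_def field_simps)
    have "uniform_limit (ball a \<rho>) F f sequentially"
      by (rule uniform_limit_on_subset[OF ul[OF le]]) (use n in auto)
    moreover have "holo_on (ball a \<rho>) (F k)" for k
    proof (rule holo_on_subset)
      show "holo_on unit_ball (F k)" using FH[of k] by (simp add: Hol_iff_holo_on)
      show "ball a \<rho> \<subseteq> unit_ball" using n le by fastforce
    qed
    ultimately show "\<exists>r>0. \<exists>F. uniform_limit (ball a r) F f sequentially \<and> (\<forall>k. holo_on (ball a r) (F k))"
      using \<rho> by blast
  qed
  have conv: "(\<lambda>l. bergman_norm2 (hom_expansion (\<lambda>z. F l z - f z) n)) \<longlonglongrightarrow> 0" for n
  proof (rule LIMSEQ_I)
    fix e :: real assume e: "e > 0"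
    \<comment> \<open>Cauchy's bound at radius 1/2 costs a factor \<open>2 ^ n\<close> on the ball;
      after squaring, \<open>e / 2\<close> remains.\<close>
    define \<delta> where "\<delta> = sqrt (e / 2) / 2 ^ n"
    have \<delta>: "\<delta> > 0" using e by (simp add: \<delta>_def)
    have "\<forall>\<^sub>F l in sequentially. \<forall>z\<in>cball 0 (1/2). dist (F l z) (f z) < \<delta>"
      using uniform_limitD[OF ul[of "1/2"] \<delta>] by simp
    then obtain M where M: "\<And>l z. l \<ge> M \<Longrightarrow> norm z \<le> 1/2 \<Longrightarrow> cmod (F l z - f z) \<le> \<delta>"
      unfolding eventually_sequentially by (metis dist_norm mem_cball_0 less_imp_le)
    have "norm (bergman_norm2 (hom_expansion (\<lambda>z. F l z - f z) n) - 0) < e" if l: "l \<ge> M" for l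
    proof -
      have H: "(\<lambda>z. F l z - f z) \<in> Hol" by (intro Hol_diff FH fH)
      have "cmod (hom_expansion (\<lambda>z. F l z - f z) n z) \<le> \<delta> * 2 ^ n" if "norm z < 1" for z
      proof -
        have "cmod (hom_expansion (\<lambda>z. F l z - f z) n z) \<le> \<delta> * (norm z / (1/2)) ^ n"
          by (rule hom_expansion_cauchy_bound[OF H]) (use M[OF l] in auto)
        also have "\<dots> \<le> \<delta> * 2 ^ n" using that \<delta> by (intro mult_left_mono power_mono) auto
        finally show ?thesis .
      qed
      then have "bergman_norm2 (hom_expansion (\<lambda>z. F l z - f z) n) \<le> (\<delta> * 2 ^ n)\<^sup>2"
        by (rule bergman_norm2_le_bound[OF homogeneous_poly_hom_expansion[OF H]])
      also have "\<dots> = e / 2" using e by (simp add: \<delta>_def)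
      finally show ?thesis using e bergman_norm2_nonneg[of "hom_expansion (\<lambda>z. F l z - f z) n"] by simp
    qed
    then show "\<exists>M. \<forall>l\<ge>M. norm (bergman_norm2 (hom_expansion (\<lambda>z. F l z - f z) n) - 0) < e" by blast
  qed
  \<comment> \<open>A Fatou argument: the number of components is kept finite while \<open>l\<close>
    tends to infinity. The factor 2 comes from \<open>bergman_norm2_add_le\<close>.\<close>
  have key: "(\<Sum>n<T. w n * bergman_norm2 (hom_expansion (\<lambda>z. F k z - f z) n)) \<le> 2 * e\<^sup>2"
    if kl: "\<And>l. l \<ge> M \<Longrightarrow> fnorm (component_space w) (\<lambda>z. F k z - F l z) < e" for T k M e
  proof (rule tendsto_lowerbound)
    let ?R = "\<lambda>l. 2 * e\<^sup>2 + 2 * (\<Sum>n<T. w n * bergman_norm2 (hom_expansion (\<lambda>z. F l z - f z) n))"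
    have "?R \<longlonglongrightarrow> 2 * e\<^sup>2 + 2 * (\<Sum>n<T. w n * 0)" by (intro tendsto_intros conv)
    then show "?R \<longlonglongrightarrow> 2 * e\<^sup>2" by simp
    have "(\<Sum>n<T. w n * bergman_norm2 (hom_expansion (\<lambda>z. F k z - f z) n)) \<le> ?R l" if l: "l \<ge> M" for l
    proof -
      have "hom_expansion (\<lambda>z. F k z - f z) n = (\<lambda>z. hom_expansion (\<lambda>z. F k z - F l z) n z + hom_expansion (\<lambda>z. F l z - f z) n z)" for n
        using hom_expansion_add'[OF Hol_diff[OF FH FH] Hol_diff[OF FH fH], of k l l n] by simp
      then have "(\<Sum>n<T. w n * bergman_norm2 (hom_expansion (\<lambda>z. F k z - f z) n))
         \<le> (\<Sum>n<T. w n * (2 * bergman_norm2 (hom_expansion (\<lambda>z. F k z - F l z) n) + 2 * bergman_norm2 (hom_expansion (\<lambda>z. F l z - f z) n)))"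
        using wp by (intro sum_mono mult_left_mono) (auto simp: less_imp_le intro!: bergman_norm2_add_le homogeneous_poly_hom_expansion Hol_diff FH fH)
      also have "\<dots> = 2 * (\<Sum>n<T. w n * bergman_norm2 (hom_expansion (\<lambda>z. F k z - F l z) n)) + 2 * (\<Sum>n<T. w n * bergman_norm2 (hom_expansion (\<lambda>z. F l z - f z) n))"
        by (simp add: distrib_left sum.distrib sum_distrib_left mult.left_commute)
      also have "(\<Sum>n<T. w n * bergman_norm2 (hom_expansion (\<lambda>z. F k z - F l z) n)) \<le> (fnorm (component_space w) (\<lambda>z. F k z - F l z))\<^sup>2"
        unfolding fnorm_component_space_power2[OF wp FD]
        using FD[of k l] wp by (intro sum_le_suminf) (auto simp: funs_component_space_iff bergman_norm2_nonneg less_imp_le)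
      also have "\<dots> \<le> e\<^sup>2"
        using kl[OF l] fnorm_component_space_nonneg[OF wp FD] by (intro power_mono) auto
      finally show ?thesis by simp
    qed
    then show "\<forall>\<^sub>F l in sequentially. (\<Sum>n<T. w n * bergman_norm2 (hom_expansion (\<lambda>z. F k z - f z) n)) \<le> ?R l"
      unfolding eventually_sequentially by blast
  qed simp
  have dif: "(\<lambda>z. F k z - f z) \<in> funs (component_space w) \<and> fnorm (component_space w) (\<lambda>z. F k z - f z) \<le> sqrt 2 * e"
    if kl: "\<And>l. l \<ge> M \<Longrightarrow> fnorm (component_space w) (\<lambda>z. F k z - F l z) < e" and e: "e > 0" for k M e
  proof -
    have nn: "w n * bergman_norm2 (hom_expansion (\<lambda>z. F k z - f z) n) \<ge> 0" for n using wp[of n] by (simp add: bergman_norm2_nonneg less_imp_le)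
    have s: "summable (\<lambda>n. w n * bergman_norm2 (hom_expansion (\<lambda>z. F k z - f z) n))"
      by (rule summableI_nonneg_bounded[OF nn key[OF kl]])
    have "(\<Sum>n. w n * bergman_norm2 (hom_expansion (\<lambda>z. F k z - f z) n)) \<le> 2 * e\<^sup>2"
      by (rule suminf_le_const[OF s key[OF kl]])
    then have "fnorm (component_space w) (\<lambda>z. F k z - f z) \<le> sqrt (2 * e\<^sup>2)" unfolding fnorm_component_space by (rule real_sqrt_le_mono)
    with s e show ?thesis using Hol_diff[OF FH fH] by (simp add: funs_component_space_iff real_sqrt_mult)
  qed
  \<comment> \<open>Both \<open>F M1\<close> and its difference from \<open>f\<close> lie in the
    space, hence so does \<open>f\<close>.\<close>
  obtain M1 where M1: "\<And>k l. k \<ge> M1 \<Longrightarrow> l \<ge> M1 \<Longrightarrow> fnorm (component_space w) (\<lambda>z. F k z - F l z) < 1" using C[of 1] by auto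
  have "(\<lambda>z. F M1 z - f z) \<in> funs (component_space w)" using dif[of M1 M1 1] M1 by simp
  from component_space_diff[OF wp F[of M1] this] have fD: "f \<in> funs (component_space w)" by simp
  moreover have "(\<lambda>k. fnorm (component_space w) (\<lambda>z. F k z - f z)) \<longlonglongrightarrow> 0"
  proof (rule LIMSEQ_I)
    fix e :: real assume e: "e > 0"
    then obtain M where M: "\<And>k l. k \<ge> M \<Longrightarrow> l \<ge> M \<Longrightarrow> fnorm (component_space w) (\<lambda>z. F k z - F l z) < e / 2" using C[of "e / 2"] by auto
    have "norm (fnorm (component_space w) (\<lambda>z. F k z - f z) - 0) < e" if "k \<ge> M" for k
    proof -
      have "fnorm (component_space w) (\<lambda>z. F k z - f z) \<le> sqrt 2 * (e / 2)" using dif[of M k "e/2"] M[OF that] e by simp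
      also have "\<dots> < e" using e real_sqrt_less_mono[of 2 4] by simp
      finally show ?thesis using fnorm_component_space_nonneg[OF wp component_space_diff[OF wp F fD]] by simp
    qed
    then show "\<exists>M. \<forall>k\<ge>M. norm (fnorm (component_space w) (\<lambda>z. F k z - f z) - 0) < e" by blast
  qed
  ultimately show ?thesis by blast
qed

lemma summable_bergman_ip_components:
  assumes wp: "\<And>n. w n > 0" and f: "f \<in> funs (component_space w)" and g: "g \<in> funs (component_space w)"
  shows "summable (\<lambda>n. complex_of_real (w n) * bergman_ip (hom_expansion f n) (hom_expansion g n))"
proof (rule summable_comparison_test'[of "\<lambda>n. (w n * bergman_norm2 (hom_expansion f n) + w n * bergman_norm2 (hom_expansion g n)) / 2" 0])
  show "summable (\<lambda>n. (w n * bergman_norm2 (hom_expansion f n) + w n * bergman_norm2 (hom_expansion g n)) / 2)"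
    using f g by (intro summable_divide summable_add) (auto simp: funs_component_space_iff)
  fix n
  have "cmod (bergman_ip (hom_expansion f n) (hom_expansion g n)) \<le> (1 * bergman_norm2 (hom_expansion f n) + bergman_norm2 (hom_expansion g n) / 1) / 2"
    using component_space_Hol[OF f] component_space_Hol[OF g] by (intro norm_bergman_ip_le[of n _ n] homogeneous_poly_hom_expansion) auto
  then have "w n * cmod (bergman_ip (hom_expansion f n) (hom_expansion g n)) \<le> w n * ((bergman_norm2 (hom_expansion f n) + bergman_norm2 (hom_expansion g n)) / 2)"
    using wp[of n] by (intro mult_left_mono) auto
  then show "norm (complex_of_real (w n) * bergman_ip (hom_expansion f n) (hom_expansion g n))
      \<le> (w n * bergman_norm2 (hom_expansion f n) + w n * bergman_norm2 (hom_expansion g n)) / 2"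
    using wp[of n] by (simp add: norm_mult algebra_simps)
qed

lemma bergman_ip_add_left:
  assumes "homogeneous_poly n p" "homogeneous_poly n' p'" "homogeneous_poly m q"
  shows "bergman_ip (\<lambda>z. p z + p' z) q = bergman_ip p q + bergman_ip p' q"
  unfolding bergman_ip_def distrib_right
  by (rule Bochner_Integration.integral_add; rule integrable_poly_product) (use assms in auto)

text \<open>Equality of records would be too strong: \<open>fnorm\<close> takes arbitrary values off
  \<open>funs\<close>, and these differ between \<open>besov\<close>, \<open>B1\<close> and
  \<open>component_space\<close>.\<close>

definition same_space :: "'d::finite fn_space \<Rightarrow> 'd fn_space \<Rightarrow> bool"
  where "same_space H K \<longleftrightarrow> funs H = funs K \<and> (\<forall>f\<in>funs K. fnorm H f = fnorm K f)"

lemma agreeD: "same_space H K \<Longrightarrow> funs H = funs K" "same_space H K \<Longrightarrow> f \<in> funs K \<Longrightarrow> fnorm H f = fnorm K f"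
  by (auto simp: same_space_def)

text \<open>The inner product is the weighted sum of the Bergman inner products of components of
  equal degree.\<close>

lemma hilbert_analytic_space_component_space:
  fixes H :: "'d::finite fn_space"
  assumes w: "kernel_weight TYPE('d) w" and H: "same_space H (component_space w)"
  shows "hilbert_analytic_space H"
proof -
  have wp: "w n > 0" for n using w by (simp add: kernel_weight_def)
  note fe = agreeD(1)[OF H] and ne = agreeD(2)[OF H]
  define ip where "ip f g = (\<Sum>n. complex_of_real (w n) * bergman_ip (hom_expansion f n) (hom_expansion g n))"
    for f g :: "complex ^ 'd \<Rightarrow> complex"
  note s = summable_bergman_ip_components[OF wp]
  have 1: "ip (\<lambda>z. f z + g z) h = ip f h + ip g h"
    if "f \<in> funs (component_space w)" "g \<in> funs (component_space w)" "h \<in> funs (component_space w)" for f g h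
  proof -
    note Hl = that[THEN component_space_Hol]
    have "bergman_ip (hom_expansion (\<lambda>z. f z + g z) n) (hom_expansion h n) = bergman_ip (hom_expansion f n) (hom_expansion h n) + bergman_ip (hom_expansion g n) (hom_expansion h n)" for n
      unfolding hom_expansion_add'[OF Hl(1,2)]
      by (rule bergman_ip_add_left[OF homogeneous_poly_hom_expansion[OF Hl(1)] homogeneous_poly_hom_expansion[OF Hl(2)] homogeneous_poly_hom_expansion[OF Hl(3)]])
    then show ?thesis unfolding ip_def
      by (simp add: distrib_left suminf_add[OF s[OF that(1,3)] s[OF that(2,3)]])
  qed
  have 2: "ip (\<lambda>z. c * f z) h = c * ip f h"
    if "f \<in> funs (component_space w)" "h \<in> funs (component_space w)" for c f h
    unfolding ip_def hom_expansion_cmult[OF component_space_Hol[OF that(1)]] bergman_ip_cmult_left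
    by (simp add: mult.left_commute suminf_mult[OF s[OF that]])
  have 3: "ip g f = cnj (ip f g)" if "f \<in> funs (component_space w)" "g \<in> funs (component_space w)" for f g
  proof -
    have "(\<lambda>n. cnj (complex_of_real (w n) * bergman_ip (hom_expansion f n) (hom_expansion g n))) sums cnj (ip f g)"
      unfolding ip_def sums_cnj by (rule summable_sums[OF s[OF that]])
    then show ?thesis unfolding ip_def[of g f] by (simp add: sums_iff flip: bergman_ip_commute)
  qed
  have 4: "ip f f = complex_of_real ((fnorm (component_space w) f)\<^sup>2)" if "f \<in> funs (component_space w)" for f
  proof -
    have "(\<lambda>n. w n * bergman_norm2 (hom_expansion f n)) sums ((fnorm (component_space w) f)\<^sup>2)"
      unfolding fnorm_component_space_power2[OF wp that] using that by (intro summable_sums) (simp add: funs_component_space_iff)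
    from sums_of_real[OF this, where 'a = complex] show ?thesis unfolding ip_def by (simp add: bergman_ip_self sums_iff)
  qed
  have 0: "(\<lambda>z. 0) \<in> funs (component_space w :: 'd fn_space)"
  proof -
    have "hom_expansion (\<lambda>z :: complex ^ 'd. 0) = (\<lambda>n z. 0)"
      using hom_expansion_homogeneous_poly[OF homogeneous_poly_zero[of 0]] by (simp add: fun_eq_iff)
    then show ?thesis by (simp add: funs_component_space_iff Hol_const bergman_norm2_def)
  qed
  show ?thesis unfolding hilbert_analytic_space_def fe
  proof (intro conjI)
    show "funs (component_space w :: 'd fn_space) \<subseteq> Hol" by (auto dest: component_space_Hol)
    show "(\<lambda>z. 0) \<in> funs (component_space w :: 'd fn_space)" by (rule 0)
    show "\<forall>f\<in>funs (component_space w :: 'd fn_space). \<forall>g\<in>funs (component_space w). (\<lambda>z. f z + g z) \<in> funs (component_space w)"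
      by (intro ballI component_space_add[OF wp])
    show "\<forall>c. \<forall>f\<in>funs (component_space w :: 'd fn_space). (\<lambda>z. c * f z) \<in> funs (component_space w)"
      by (intro ballI allI component_space_cmult(1))
    show "\<exists>ip :: (complex ^ 'd \<Rightarrow> complex) \<Rightarrow> (complex ^ 'd \<Rightarrow> complex) \<Rightarrow> complex.
       (\<forall>f\<in>funs (component_space w). \<forall>g\<in>funs (component_space w). \<forall>h\<in>funs (component_space w). ip (\<lambda>z. f z + g z) h = ip f h + ip g h) \<and>
       (\<forall>c. \<forall>f\<in>funs (component_space w). \<forall>h\<in>funs (component_space w). ip (\<lambda>z. c * f z) h = c * ip f h) \<and>
       (\<forall>f\<in>funs (component_space w). \<forall>g\<in>funs (component_space w). ip g f = cnj (ip f g)) \<and>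
       (\<forall>f\<in>funs (component_space w). 0 \<le> fnorm H f \<and> ip f f = complex_of_real ((fnorm H f)\<^sup>2))"
    proof (rule exI[of _ ip], intro conjI ballI allI)
      fix f g h :: "complex ^ 'd \<Rightarrow> complex" and c
      assume f: "f \<in> funs (component_space w)"
      show "0 \<le> fnorm H f" unfolding ne[OF f] by (rule fnorm_component_space_nonneg[OF wp f])
      show "ip f f = complex_of_real ((fnorm H f)\<^sup>2)" unfolding ne[OF f] by (rule 4[OF f])
      show "ip (\<lambda>z. c * f z) h = c * ip f h" if "h \<in> funs (component_space w)" by (rule 2[OF f that])
      assume g: "g \<in> funs (component_space w)"
      show "ip g f = cnj (ip f g)" by (rule 3[OF f g])
      show "ip (\<lambda>z. f z + g z) h = ip f h + ip g h" if "h \<in> funs (component_space w)" by (rule 1[OF f g that])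
    qed
    show "\<forall>f\<in>funs (component_space w). (fnorm H f = 0) = (\<forall>z\<in>unit_ball. f z = 0)"
      using ne component_space_eq_0_iff[OF w] by simp
    show "\<forall>F. (\<forall>k::nat. F k \<in> funs (component_space w)) \<and> (\<forall>e>0. \<exists>M. \<forall>k\<ge>M. \<forall>l\<ge>M. fnorm H (\<lambda>z. F k z - F l z) < e) \<longrightarrow>
        (\<exists>f\<in>funs (component_space w). (\<lambda>k. fnorm H (\<lambda>z. F k z - f z)) \<longlonglongrightarrow> 0)"
    proof (intro allI impI)
      fix F :: "nat \<Rightarrow> complex ^ 'd \<Rightarrow> complex"
      assume F: "(\<forall>k. F k \<in> funs (component_space w)) \<and> (\<forall>e>0. \<exists>M. \<forall>k\<ge>M. \<forall>l\<ge>M. fnorm H (\<lambda>z. F k z - F l z) < e)"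
      have FD: "F k \<in> funs (component_space w)" for k using F by blast
      have e: "fnorm H (\<lambda>z. F k z - g z) = fnorm (component_space w) (\<lambda>z. F k z - g z)" if "g \<in> funs (component_space w)" for k g
        by (rule ne[OF component_space_diff[OF wp FD that]])
      have "\<exists>f\<in>funs (component_space w). (\<lambda>k. fnorm (component_space w) (\<lambda>z. F k z - f z)) \<longlonglongrightarrow> 0"
        by (rule component_space_complete[OF w FD]) (use F in \<open>simp add: e[OF FD]\<close>)
      then show "\<exists>f\<in>funs (component_space w). (\<lambda>k. fnorm H (\<lambda>z. F k z - f z)) \<longlonglongrightarrow> 0"
        using e by auto
    qed
  qed
qed

section \<open>Equivalent weights\<close>

definition equiv_weights :: "(nat \<Rightarrow> real) \<Rightarrow> (nat \<Rightarrow> real) \<Rightarrow> bool"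
  where "equiv_weights u v \<longleftrightarrow> (\<forall>n. u n > 0) \<and> (\<forall>n. v n > 0) \<and> (\<exists>C>0. \<forall>n. u n \<le> C * v n) \<and> (\<exists>C>0. \<forall>n. v n \<le> C * u n)"

lemma equiv_weights_pos: "equiv_weights u v \<Longrightarrow> u n > 0" "equiv_weights u v \<Longrightarrow> v n > 0"
  by (simp_all add: equiv_weights_def)

lemma equiv_weights_refl: "(\<And>n. u n > 0) \<Longrightarrow> equiv_weights u u"
  unfolding equiv_weights_def by (auto intro!: exI[of _ 1])

lemma equiv_weights_sym: "equiv_weights u v \<Longrightarrow> equiv_weights v u"
  unfolding equiv_weights_def by blast

lemma le_mult_trans:
  assumes "\<And>n. u n \<le> C * v n" "\<And>n. v n \<le> D * (w n :: real)" "C > 0"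
  shows "u n \<le> (C * D) * w n"
proof -
  have "u n \<le> C * v n" by (rule assms)
  also have "\<dots> \<le> C * (D * w n)" using assms(2,3) by (intro mult_left_mono) auto
  finally show ?thesis by (simp add: mult.assoc)
qed

lemma equiv_weights_trans [trans]:
  assumes "equiv_weights u v" "equiv_weights v w" shows "equiv_weights u w"
proof -
  obtain A B C D where p: "A > 0" "B > 0" "C > 0" "D > 0" and b: "\<And>n. u n \<le> A * v n" "\<And>n. v n \<le> B * u n"
      "\<And>n. v n \<le> C * w n" "\<And>n. w n \<le> D * v n"
    using assms unfolding equiv_weights_def by blast
  have "\<forall>n. u n \<le> (A * C) * w n" "\<forall>n. w n \<le> (D * B) * u n"
    using le_mult_trans[where u = u and v = v and w = w, OF b(1,3) p(1)]
      le_mult_trans[where u = w and v = v and w = u, OF b(4,2) p(4)] by blast+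
  then show ?thesis using assms mult_pos_pos[OF p(1,3)] mult_pos_pos[OF p(4,2)] unfolding equiv_weights_def by blast
qed

lemma equiv_weights_mult:
  assumes "equiv_weights u v" "equiv_weights u' v'" shows "equiv_weights (\<lambda>n. u n * u' n) (\<lambda>n. v n * v' n)"
proof -
  have *: "\<exists>C>0. \<forall>n. u n * u' n \<le> C * (v n * v' n)" if uv: "equiv_weights u v" "equiv_weights u' v'" for u v u' v'
  proof -
    obtain A B where p: "A > 0" "B > 0" and b: "\<And>n. u n \<le> A * v n" "\<And>n. u' n \<le> B * v' n"
      using uv unfolding equiv_weights_def by blast
    have "u n * u' n \<le> (A * v n) * (B * v' n)" for n
      using uv p b by (intro mult_mono) (auto simp: equiv_weights_def less_imp_le)
    then show ?thesis using p by (intro exI[of _ "A * B"]) (simp add: mult_ac)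
  qed
  show ?thesis using *[OF assms] *[OF assms[THEN equiv_weights_sym]] assms unfolding equiv_weights_def by simp
qed

lemma equiv_weights_inverse:
  assumes "equiv_weights u v" shows "equiv_weights (\<lambda>n. 1 / u n) (\<lambda>n. 1 / v n)"
proof -
  have *: "\<exists>C>0. \<forall>n. 1 / u n \<le> C * (1 / v n)" if uv: "equiv_weights u v" for u v
  proof -
    obtain A where p: "A > 0" and b: "\<And>n. v n \<le> A * u n" using uv unfolding equiv_weights_def by blast
    have "1 / u n \<le> A * (1 / v n)" for n
      using b[of n] uv by (simp add: equiv_weights_def field_simps)
    then show ?thesis using p by blast
  qed
  show ?thesis using *[OF assms] *[OF assms[THEN equiv_weights_sym]] assms unfolding equiv_weights_def by simp
qed

lemma equiv_weights_divide:
  assumes "equiv_weights u v" "equiv_weights u' v'" shows "equiv_weights (\<lambda>n. u n / u' n) (\<lambda>n. v n / v' n)"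
  using equiv_weights_mult[OF assms(1) equiv_weights_inverse[OF assms(2)]] by simp

text \<open>A convergent ratio is bounded, and so is its inverse, because the limit is
  positive.\<close>

lemma equiv_weights_of_limit:
  assumes p: "\<And>n. u n > 0" "\<And>n. v n > 0" and lim: "(\<lambda>n. u n / v n) \<longlonglongrightarrow> L" and L: "L > 0"
  shows "equiv_weights u v"
proof -
  have *: "\<exists>C>0. \<forall>n. u n \<le> C * v n" if uvL: "\<And>n. u n > 0" "\<And>n. v n > 0" "(\<lambda>n. u n / v n) \<longlonglongrightarrow> L" for u v :: "nat \<Rightarrow> real" and L
  proof -
    have "Bseq (\<lambda>n. u n / v n)" using uvL(3) by (intro convergent_imp_Bseq) (auto simp: convergent_def)
    then obtain C where C: "C > 0" "\<And>n. norm (u n / v n) \<le> C" unfolding Bseq_def by blast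
    have "u n \<le> C * v n" for n using C(2)[of n] uvL(1,2)[of n] by (simp add: abs_of_pos divide_le_eq)
    then show ?thesis using C(1) by blast
  qed
  have "(\<lambda>n. 1 / (u n / v n)) \<longlonglongrightarrow> 1 / L" using lim L by (intro tendsto_divide) auto
  then have lim': "(\<lambda>n. v n / u n) \<longlonglongrightarrow> 1 / L" by simp
  show ?thesis unfolding equiv_weights_def
    by (intro conjI allI p *[OF p lim] *[OF p(2,1) lim'])
qed

text \<open>The value at \<open>n = 0\<close> is fixed separately because \<open>0 powr s = 0\<close>.\<close>

definition power_weight :: "real \<Rightarrow> nat \<Rightarrow> real"
  where "power_weight s n = (if n = 0 then 1 else real n powr s)"

lemma power_weight_pos: "power_weight s n > 0"
  by (simp add: power_weight_def)

lemma power_weight_divide: "power_weight s n / power_weight t n = power_weight (s - t) n"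
  by (simp add: power_weight_def powr_diff)

text \<open>The ratio tends to 1 / Gamma(a) by the limit formula for the reciprocal Gamma
  function.\<close>

lemma equiv_weights_kernel_coeff_power_weight:
  assumes a: "a > 0"
  shows "equiv_weights (kernel_coeff a) (power_weight (a - 1))"
proof (rule equiv_weights_of_limit)
  show "kernel_coeff a n > 0" for n by (rule kernel_coeff_pos[OF a])
  show "power_weight (a - 1) n > 0" for n by (rule power_weight_pos)
  have "(\<lambda>n. a / (a + real n)) \<longlonglongrightarrow> 0"
    by (intro tendsto_divide_0[OF tendsto_const] filterlim_at_top_imp_at_infinity
        filterlim_tendsto_add_at_top[OF tendsto_const filterlim_real_sequentially])
  from tendsto_diff[OF tendsto_const this, of 1]
  have l: "(\<lambda>n. 1 - a / (a + real n)) \<longlonglongrightarrow> 1" by simp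
  have e: "1 - a / (a + real n) = real n / (a + real n)" for n using a by (simp add: field_simps)
  \<comment> \<open>\<open>rGamma_series\<close> contains one Pochhammer factor too many;
    \<open>n / (a + n)\<close>, which tends to 1, removes it and supplies the missing power of
    \<open>n\<close>.\<close>
  have "(\<lambda>n. rGamma_series a n * (real n / (a + real n))) \<longlonglongrightarrow> rGamma a * 1"
    using l unfolding e by (intro tendsto_mult rGamma_series_LIMSEQ)
  moreover have "\<forall>\<^sub>F n in sequentially. rGamma_series a n * (real n / (a + real n)) = kernel_coeff a n / power_weight (a - 1) n"
    using eventually_gt_at_top[of 0]
  proof eventually_elim
    case (elim n)
    have "pochhammer a (n + 1) = pochhammer a n * (a + real n)" by (simp add: pochhammer_Suc)
    moreover have "exp (a * ln (real n)) = real n powr a" using elim by (simp add: powr_def)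
    moreover have "real n powr (a - 1) = real n powr a / real n" using elim by (simp add: powr_diff)
    moreover have "P * A / (F * N) * (x / A) = (P / F) / (N / x)" if "A \<noteq> 0" for P A F N x :: real
      using that by simp
    moreover have "a + real n \<noteq> 0" using a by simp
    ultimately show ?case using elim by (simp only: rGamma_series_def kernel_coeff_def power_weight_def of_real_eq_id id_apply) simp
  qed
  ultimately show "(\<lambda>n. kernel_coeff a n / power_weight (a - 1) n) \<longlonglongrightarrow> rGamma a" by (simp add: Lim_transform_eventually)
  show "rGamma a > 0" using Gamma_real_pos[OF a] by (simp add: rGamma_inverse_Gamma)
qed

text \<open>Successive ratios (a + k) / (k + 1) stay between min(a, 1) and max(a, 1). The shift is
  wanted because the moments of radial weights carry the argument n + d.\<close>

lemma equiv_weights_kernel_coeff_shift: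
  assumes a: "a > 0"
  shows "equiv_weights (\<lambda>n. kernel_coeff a (n + m)) (kernel_coeff a)"
proof (induction m)
  case 0
  show ?case using equiv_weights_refl[OF kernel_coeff_pos[OF a]] by simp
next
  case (Suc m)
  have "equiv_weights (\<lambda>n. kernel_coeff a (Suc (n + m))) (\<lambda>n. kernel_coeff a (n + m))"
    unfolding equiv_weights_def
  proof (intro conjI allI exI)
    fix n
    have kp: "kernel_coeff a (n + m) > 0" by (rule kernel_coeff_pos[OF a])
    have "a + real (n + m) \<le> max a 1 + max a 1 * real (n + m)"
      using mult_right_mono[of 1 "max a 1" "real (n + m)"] by (intro add_mono) auto
    then have "(a + real (n + m)) / real (Suc (n + m)) \<le> max a 1"
      by (simp add: divide_le_eq algebra_simps)
    then have "kernel_coeff a (n + m) * ((a + real (n + m)) / real (Suc (n + m))) \<le> kernel_coeff a (n + m) * max a 1"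
      using kp by (intro mult_left_mono) auto
    then show "kernel_coeff a (Suc (n + m)) \<le> max a 1 * kernel_coeff a (n + m)" unfolding kernel_coeff_Suc by (simp add: mult.commute)
    have "real (Suc (n + m)) \<le> max (1 / a) 1 * (a + real (n + m))"
    proof -
      have "1 \<le> max (1 / a) 1 * a" using mult_right_mono[of "1 / a" "max (1 / a) 1" a] a by simp
      moreover have "real (n + m) \<le> max (1 / a) 1 * real (n + m)"
        using mult_right_mono[of 1 "max (1 / a) 1" "real (n + m)"] by simp
      ultimately show ?thesis by (simp only: distrib_left of_nat_Suc add_mono)
    qed
    then have "kernel_coeff a (n + m) * real (Suc (n + m)) \<le> kernel_coeff a (n + m) * (max (1 / a) 1 * (a + real (n + m)))"
      using kp by (intro mult_left_mono) auto
    then show "kernel_coeff a (n + m) \<le> max (1 / a) 1 * kernel_coeff a (Suc (n + m))"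
      unfolding kernel_coeff_Suc by (simp add: field_simps)
  qed (use a in \<open>auto simp: kernel_coeff_pos max_def\<close>)
  from equiv_weights_trans[OF this Suc.IH] show ?case by simp
qed

text \<open>With \<open>D = d\<close>, this is the weight of the space with kernel \<open>(1 - \<langle>z, w\<rangle>) powr (-a)\<close>; the Bergman
  space itself has exponent \<open>D + 1\<close>.\<close>

definition kernel_exponent_weight :: "real \<Rightarrow> real \<Rightarrow> nat \<Rightarrow> real"
  where "kernel_exponent_weight D a n = kernel_coeff (D + 1) n / kernel_coeff a n"

lemma equiv_weights_kernel_exponent_weight:
  assumes "a > 0" "D \<ge> 0"
  shows "equiv_weights (kernel_exponent_weight D a) (power_weight (D + 1 - a))"
  using equiv_weights_divide[OF equiv_weights_kernel_coeff_power_weight[of "D + 1"] equiv_weights_kernel_coeff_power_weight[of a]] assms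
  by (simp add: kernel_exponent_weight_def[abs_def] power_weight_divide algebra_simps)

lemma summable_kernel_coeff_power:
  assumes "0 \<le> x" "x < 1"
  shows "summable (\<lambda>n. kernel_coeff a n * x ^ n)"
proof -
  have "summable (\<lambda>n. ((- a) gchoose n) * (- x) ^ n)"
    using gen_binomial_real[of "- x" "- a"] assms by (simp add: sums_iff)
  moreover have "((- a) gchoose n) * (- x) ^ n = kernel_coeff a n * x ^ n" for n
    by (simp add: gbinomial_pochhammer kernel_coeff_def power_minus[of x] mult_ac)
  ultimately show ?thesis by simp
qed

text \<open>With the positive exponent \<open>a = d + 1 - s\<close>, the quotient in
  \<open>kernel_weight\<close> is comparable with the coefficients of (1 - x)^(-a), whose series
  converges on [0, 1).\<close>

lemma kernel_weightI:
  assumes "equiv_weights w (power_weight s)" "s < real CARD('d) + 1"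
  shows "kernel_weight TYPE('d::finite) w"
proof -
  let ?D = "real CARD('d)"
  define a where "a = ?D + 1 - s"
  have a: "a > 0" using assms(2) by (simp add: a_def)
  have "equiv_weights (kernel_exponent_weight ?D a) (power_weight (?D + 1 - a))"
    by (rule equiv_weights_kernel_exponent_weight[OF a]) simp
  then have "equiv_weights w (kernel_exponent_weight ?D a)"
    using equiv_weights_trans[OF assms(1) equiv_weights_sym] by (simp add: a_def)
  from equiv_weights_divide[OF equiv_weights_refl[of "kernel_coeff (?D + 1)"] this]
  have "equiv_weights (\<lambda>n. kernel_coeff (?D + 1) n / w n) (\<lambda>n. kernel_coeff a n)"
    by (simp add: kernel_coeff_pos kernel_exponent_weight_def less_imp_neq[symmetric, OF kernel_coeff_pos])
  then obtain C where C: "C > 0" "\<And>n. kernel_coeff (?D + 1) n / w n \<le> C * kernel_coeff a n" and p: "\<And>n. kernel_coeff (?D + 1) n / w n > 0"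
    unfolding equiv_weights_def by blast
  have "summable (\<lambda>n. kernel_coeff (?D + 1) n / w n * x ^ n)" if x: "0 \<le> x" "x < 1" for x
  proof (rule summable_comparison_test'[of "\<lambda>n. C * (kernel_coeff a n * x ^ n)" 0])
    show "summable (\<lambda>n. C * (kernel_coeff a n * x ^ n))" by (intro summable_mult summable_kernel_coeff_power x)
    fix n
    have "kernel_coeff (?D + 1) n / w n * x ^ n \<le> C * kernel_coeff a n * x ^ n" using C x by (intro mult_right_mono) auto
    moreover have "0 \<le> kernel_coeff (?D + 1) n / w n * x ^ n" using less_imp_le[OF p[of n]] x by (intro mult_nonneg_nonneg) auto
    ultimately show "norm (kernel_coeff (?D + 1) n / w n * x ^ n) \<le> C * (kernel_coeff a n * x ^ n)"
      unfolding real_norm_def by (simp only: abs_of_nonneg mult.assoc)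
  qed
  then show ?thesis using assms(1) unfolding kernel_weight_def equiv_weights_def by blast
qed

lemma equal_equiv_norms_component_space:
  fixes H K :: "'d::finite fn_space"
  assumes uv: "equiv_weights u v" and H: "same_space H (component_space u)" and K: "same_space K (component_space v)"
  shows "equal_equiv_norms H K"
proof -
  \<comment> \<open>A one-sided comparison of weights gives membership and the norm bound together;
    it is applied in both directions.\<close>
  have *: "summable (\<lambda>n. u n * bergman_norm2 (p n)) \<and> sqrt (\<Sum>n. u n * bergman_norm2 (p n)) \<le> sqrt C * sqrt (\<Sum>n. v n * bergman_norm2 (p n))"
    if C: "C > 0" "\<And>n. u n \<le> C * v n" "\<And>n. u n > 0" and s: "summable (\<lambda>n. v n * bergman_norm2 (p n))"
    for u v C and p :: "nat \<Rightarrow> complex ^ 'd \<Rightarrow> complex"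
  proof -
    have le: "u n * bergman_norm2 (p n) \<le> C * (v n * bergman_norm2 (p n))" for n
      using mult_right_mono[OF C(2) bergman_norm2_nonneg[of "p n"]] by (simp add: mult.assoc)
    have su: "summable (\<lambda>n. u n * bergman_norm2 (p n))"
      by (rule summable_comparison_test'[OF summable_mult[OF s, of C], of 0])
         (use le C in \<open>auto simp: abs_mult bergman_norm2_nonneg abs_of_pos\<close>)
    have "(\<Sum>n. u n * bergman_norm2 (p n)) \<le> (\<Sum>n. C * (v n * bergman_norm2 (p n)))"
      by (rule suminf_le[OF le su summable_mult[OF s]])
    also have "\<dots> = C * (\<Sum>n. v n * bergman_norm2 (p n))" by (rule suminf_mult[OF s])
    finally have "sqrt (\<Sum>n. u n * bergman_norm2 (p n)) \<le> sqrt (C * (\<Sum>n. v n * bergman_norm2 (p n)))" by (rule real_sqrt_le_mono)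
    then show ?thesis using su by (simp add: real_sqrt_mult)
  qed
  have "\<exists>A>0. \<forall>n. u n \<le> A * v n" "\<exists>B>0. \<forall>n. v n \<le> B * u n"
    using uv unfolding equiv_weights_def by simp_all
  then obtain A B where A: "A > 0" "\<And>n. u n \<le> A * v n" and B: "B > 0" "\<And>n. v n \<le> B * u n" by auto
  note p = equiv_weights_pos[OF uv]
  have fe: "f \<in> funs (component_space u) \<longleftrightarrow> f \<in> funs (component_space v)" for f :: "complex ^ 'd \<Rightarrow> complex"
  proof -
    note 1 = conjunct1[OF *[where u = u and v = v, OF A p(1), where p = "hom_expansion f"]]
    note 2 = conjunct1[OF *[where u = v and v = u, OF B p(2), where p = "hom_expansion f"]]
    show ?thesis unfolding funs_component_space_iff using 1 2 by argo
  qed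
  have 1: "fnorm (component_space u) f \<le> sqrt A * fnorm (component_space v) f" if "f \<in> funs (component_space v)" for f :: "complex ^ 'd \<Rightarrow> complex"
    unfolding fnorm_component_space using *[where u = u and v = v, OF A p(1), where p = "hom_expansion f"] that by (simp add: funs_component_space_iff)
  have 2: "fnorm (component_space v) f \<le> sqrt B * fnorm (component_space u) f" if "f \<in> funs (component_space v)" for f :: "complex ^ 'd \<Rightarrow> complex"
    unfolding fnorm_component_space using *[where u = v and v = u, OF B p(2), where p = "hom_expansion f"] that fe[of f] by (simp add: funs_component_space_iff)
  have fHK: "funs H = funs K" using agreeD(1)[OF H] agreeD(1)[OF K] fe by blast
  have b: "\<forall>f\<in>funs H. (1 / sqrt B) * fnorm K f \<le> fnorm H f \<and> fnorm H f \<le> sqrt A * fnorm K f"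
  proof
    fix f assume "f \<in> funs H"
    then have f: "f \<in> funs (component_space u)" "f \<in> funs (component_space v)" using agreeD(1)[OF H] fe by auto
    show "(1 / sqrt B) * fnorm K f \<le> fnorm H f \<and> fnorm H f \<le> sqrt A * fnorm K f"
      using 1[OF f(2)] 2[OF f(2)] B(1) unfolding agreeD(2)[OF H f(1)] agreeD(2)[OF K f(2)]
      by (simp add: field_simps)
  qed
  have pos: "1 / sqrt B > 0" "sqrt A > 0" using A B by simp_all
  show ?thesis unfolding equal_equiv_norms_def
    by (rule conjI[OF fHK], rule exI[of _ "1 / sqrt B"], rule conjI[OF pos(1)], rule exI[of _ "sqrt A"], rule conjI[OF pos(2) b])
qed

section \<open>Identification of the Besov spaces\<close>

text \<open>The factor of degree \<open>n\<close> in the squared norm of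
  \<open>besov N (radial_weight \<beta>)\<close>: a power of \<open>n\<close> from the iterated
  radial derivative and a moment from the weight. The entry at 0 encodes the term with the value at
  the origin.\<close>

definition besov_coeff :: "nat \<Rightarrow> real \<Rightarrow> nat \<Rightarrow> nat \<Rightarrow> real"
  where "besov_coeff d \<beta> N n = (if n = 0 then 1 else real n ^ (2 * N)) * radial_moment \<beta> (2 * (n + d))"

lemma hom_expansion_0_eq: "f \<in> Hol \<Longrightarrow> hom_expansion f 0 = (\<lambda>z. f 0)"
  by (rule ext) (rule hom_expansion_0)

lemma measure_V_space: "measure V (space V :: (complex ^ 'd::finite) set) = 1"
  by (simp add: measure_def emeasure_V_space)

lemma bergman_norm2_const: "bergman_norm2 (\<lambda>z :: complex ^ 'd::finite. c) = (cmod c)\<^sup>2"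
  by (simp add: bergman_norm2_def measure_V_space)

lemma integral_radial_weight:
  assumes b: "\<beta> > 0"
  shows "(LINT z|V. radial_weight \<beta> (z :: complex ^ 'd::finite)) = radial_moment \<beta> (2 * CARD('d))"
    and "integrable V (radial_weight \<beta> :: complex ^ 'd \<Rightarrow> real)"
  using integral_V_homogeneous_weight[of "\<lambda>z :: complex ^ 'd. 1" \<beta> 0] b
  by (simp_all add: measure_V_space)

lemma same_space_besov:
  assumes b: "\<beta> > 0"
  shows "same_space (besov N (radial_weight \<beta>) :: 'd::finite fn_space) (component_space (besov_coeff CARD('d) \<beta> N))"
proof (cases "N = 0")
  case True
  have c: "besov_coeff CARD('d) \<beta> N = (\<lambda>n. radial_moment \<beta> (2 * (n + CARD('d))))"
    by (simp add: besov_coeff_def True fun_eq_iff)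
  have m: "f \<in> L2a (radial_weight \<beta>) \<longleftrightarrow> f \<in> funs (component_space (besov_coeff CARD('d) \<beta> N))" for f :: "complex ^ 'd \<Rightarrow> complex"
    unfolding funs_component_space_iff c using L2a_radial_weight_iff(1)[OF _ b, of f] by (auto simp: L2a_def)
  show ?thesis unfolding same_space_def
  proof (intro conjI ballI)
    show "funs (besov N (radial_weight \<beta>) :: 'd fn_space) = funs (component_space (besov_coeff CARD('d) \<beta> N))"
      using m by (auto simp: besov_def True)
    fix f :: "complex ^ 'd \<Rightarrow> complex" assume "f \<in> funs (component_space (besov_coeff CARD('d) \<beta> N))"
    then have L: "f \<in> L2a (radial_weight \<beta>)" "f \<in> Hol" using m by (auto intro: component_space_Hol)
    show "fnorm (besov N (radial_weight \<beta>)) f = fnorm (component_space (besov_coeff CARD('d) \<beta> N)) f"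
      unfolding fnorm_component_space c using L2a_radial_weight_iff(2)[OF L(2) b L(1)] by (simp add: besov_def True L2_norm_def)
  qed
next
  case False
  let ?a = "\<lambda>f n. radial_moment \<beta> (2 * (n + CARD('d))) * bergman_norm2 (hom_expansion ((radial_deriv ^^ N) f) n)"
  let ?b = "\<lambda>f n. besov_coeff CARD('d) \<beta> N n * bergman_norm2 (hom_expansion f n)"
  have ab: "?a f (Suc n) = ?b f (Suc n)" if "f \<in> Hol" for f :: "complex ^ 'd \<Rightarrow> complex" and n
    unfolding hom_expansion_radial_deriv_funpow[OF that] bergman_norm2_cmult besov_coeff_def
    by (simp add: norm_power power_mult[symmetric] mult.commute del: of_nat_Suc)
  have a0: "?a f 0 = 0" if "f \<in> Hol" for f :: "complex ^ 'd \<Rightarrow> complex"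
    unfolding hom_expansion_radial_deriv_funpow[OF that] bergman_norm2_cmult using False by simp
  \<comment> \<open>The radial derivative kills the constant component. The term with
    \<open>f 0\<close> restores it with the right factor, since the weight has total mass
    \<open>radial_moment \<beta> (2 * CARD('d))\<close>.\<close>
  have b0: "?b f 0 = radial_moment \<beta> (2 * CARD('d)) * (cmod (f 0))\<^sup>2" if "f \<in> Hol" for f :: "complex ^ 'd \<Rightarrow> complex"
    by (simp add: besov_coeff_def hom_expansion_0_eq[OF that] bergman_norm2_const)
  have sum: "summable (?a f) \<longleftrightarrow> summable (?b f)" if "f \<in> Hol" for f :: "complex ^ 'd \<Rightarrow> complex"
    using summable_Suc_iff[of "?a f"] summable_Suc_iff[of "?b f"] unfolding ab[OF that] by blast
  note L = L2a_radial_weight_iff[OF Hol_radial_deriv_funpow b]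
  show ?thesis unfolding same_space_def
  proof (intro conjI ballI)
    show "funs (besov N (radial_weight \<beta>) :: 'd fn_space) = funs (component_space (besov_coeff CARD('d) \<beta> N))"
    proof (rule set_eqI)
      fix f :: "complex ^ 'd \<Rightarrow> complex"
      have "f \<in> Hol \<Longrightarrow> (radial_deriv ^^ N) f \<in> L2a (radial_weight \<beta>) \<longleftrightarrow> summable (?b f)"
        using L(1)[of f] sum[of f] by (simp only:)
      then show "f \<in> funs (besov N (radial_weight \<beta>)) \<longleftrightarrow> f \<in> funs (component_space (besov_coeff CARD('d) \<beta> N))"
        using False unfolding besov_def funs_component_space_iff by (simp only: if_False fn_space.simps mem_Collect_eq) blast
    qed
    fix f :: "complex ^ 'd \<Rightarrow> complex" assume "f \<in> funs (component_space (besov_coeff CARD('d) \<beta> N))"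
    then have f: "f \<in> Hol" and sb: "summable (?b f)" by (auto simp: funs_component_space_iff)
    have sa: "summable (?a f)" using sum[OF f] sb by blast
    have "(\<Sum>n. ?b f n) = ?b f 0 + (\<Sum>n. ?b f (Suc n))" using suminf_split_head[OF sb] by simp
    also have "(\<Sum>n. ?b f (Suc n)) = (\<Sum>n. ?a f n)"
      using suminf_split_head[OF sa] unfolding ab[OF f] a0[OF f] by simp
    finally have e: "(\<Sum>n. ?b f n) = radial_moment \<beta> (2 * CARD('d)) * (cmod (f 0))\<^sup>2 + (\<Sum>n. ?a f n)"
      unfolding b0[OF f] .
    have "(radial_deriv ^^ N) f \<in> L2a (radial_weight \<beta>)" using L(1)[OF f] sa by blast
    from L(2)[OF f this] show "fnorm (besov N (radial_weight \<beta>)) f = fnorm (component_space (besov_coeff CARD('d) \<beta> N)) f"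
      unfolding fnorm_component_space e using False by (simp add: besov_def integral_radial_weight[OF b])
  qed
qed

text \<open>The moment of order 2 (n + d) is the reciprocal of
  \<open>kernel_coeff (\<beta> + 1) (n + d)\<close>, hence comparable with
  \<open>power_weight (- \<beta>) n\<close>.\<close>

lemma equiv_weights_besov_coeff:
  assumes b: "\<beta> > 0"
  shows "equiv_weights (besov_coeff d \<beta> N) (power_weight (2 * real N - \<beta>))"
proof -
  have "radial_moment \<beta> (2 * (n + d)) = 1 / kernel_coeff (\<beta> + 1) (n + d)" for n
    unfolding radial_moment_even[OF b] kernel_coeff_def by simp
  moreover have "(if n = 0 then 1 else real n ^ (2 * N)) = power_weight (2 * real N) n" for n
    unfolding power_weight_def using powr_realpow[of "real n" "2 * N"] by auto
  ultimately have e: "besov_coeff d \<beta> N = (\<lambda>n. power_weight (2 * real N) n / kernel_coeff (\<beta> + 1) (n + d))"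
    by (simp add: besov_coeff_def fun_eq_iff)
  have "equiv_weights (\<lambda>n. kernel_coeff (\<beta> + 1) (n + d)) (power_weight \<beta>)"
    using equiv_weights_trans[OF equiv_weights_kernel_coeff_shift equiv_weights_kernel_coeff_power_weight, of "\<beta> + 1" d] b by simp
  from equiv_weights_divide[OF equiv_weights_refl[of "power_weight (2 * real N)", OF power_weight_pos] this] show ?thesis
    unfolding e power_weight_divide .
qed

lemma same_space_refl: "same_space H H"
  by (simp add: same_space_def)

lemma same_space_B1: "same_space (B1 s :: 'd::finite fn_space) (component_space (power_weight (2 * s)))"
  unfolding same_space_def
proof (intro conjI ballI)
  have e: "real (Suc n) powr (2 * s) * (L2_norm (\<lambda>_. 1) (hom_expansion f (Suc n)))\<^sup>2 = power_weight (2 * s) (Suc n) * bergman_norm2 (hom_expansion f (Suc n))"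
    for f :: "complex ^ 'd \<Rightarrow> complex" and n
    by (simp only: L2_norm_1_power2 power_weight_def) simp
  show "funs (B1 s :: 'd fn_space) = funs (component_space (power_weight (2 * s)))"
  proof (rule set_eqI)
    fix f :: "complex ^ 'd \<Rightarrow> complex"
    show "f \<in> funs (B1 s) \<longleftrightarrow> f \<in> funs (component_space (power_weight (2 * s)))"
      unfolding B1_def e funs_component_space_iff fn_space.simps mem_Collect_eq
        summable_Suc_iff[of "\<lambda>n. power_weight (2 * s) n * bergman_norm2 (hom_expansion f n)"] ..
  qed
  fix f :: "complex ^ 'd \<Rightarrow> complex" assume "f \<in> funs (component_space (power_weight (2 * s)))"
  then have "summable (\<lambda>n. power_weight (2 * s) n * bergman_norm2 (hom_expansion f n))" by (simp add: funs_component_space_iff)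
  from suminf_split_head[OF this] show "fnorm (B1 s) f = fnorm (component_space (power_weight (2 * s))) f"
    unfolding B1_def e fnorm_component_space by (simp add: L2_norm_1_power2 power_weight_def)
qed

text \<open>Closedness involves limits that are merely measurable, outside the component spaces. For
  them the elementary inequality |x - y|^2 \<le> 2 |x|^2 + 2 |y|^2 plays the part of
  Minkowski's.\<close>

lemma weighted_L2_diff_le:
  assumes f: "f \<in> borel_measurable V" and g: "g \<in> borel_measurable V"
    and fi: "integrable V (\<lambda>z. (cmod (f z))\<^sup>2 * radial_weight \<beta> z)" and gi: "integrable V (\<lambda>z. (cmod (g z))\<^sup>2 * radial_weight \<beta> z)"
  shows "integrable V (\<lambda>z. (cmod (f z - g z))\<^sup>2 * radial_weight \<beta> z)"
    and "(LINT z|V. (cmod (f z - g z))\<^sup>2 * radial_weight \<beta> z)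
      \<le> 2 * (LINT z|V. (cmod (f z))\<^sup>2 * radial_weight \<beta> z) + 2 * (LINT z|V. (cmod (g z))\<^sup>2 * radial_weight \<beta> z)"
proof -
  let ?w = "radial_weight \<beta>"
  have pt: "(cmod (f z - g z))\<^sup>2 * ?w z \<le> 2 * ((cmod (f z))\<^sup>2 * ?w z) + 2 * ((cmod (g z))\<^sup>2 * ?w z)" for z
  proof -
    have "(cmod (f z - g z))\<^sup>2 \<le> (cmod (f z) + cmod (g z))\<^sup>2" by (intro power_mono norm_triangle_ineq4) simp
    also have "\<dots> \<le> 2 * (cmod (f z))\<^sup>2 + 2 * (cmod (g z))\<^sup>2"
      using zero_le_power2[of "cmod (f z) - cmod (g z)"] by (simp add: power2_eq_square algebra_simps)
    finally have "(cmod (f z - g z))\<^sup>2 * ?w z \<le> (2 * (cmod (f z))\<^sup>2 + 2 * (cmod (g z))\<^sup>2) * ?w z"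
      by (rule mult_right_mono) (rule radial_weight_nonneg)
    then show ?thesis by (simp add: algebra_simps)
  qed
  have i: "integrable V (\<lambda>z. 2 * ((cmod (f z))\<^sup>2 * ?w z) + 2 * ((cmod (g z))\<^sup>2 * ?w z))" using fi gi by simp
  show int: "integrable V (\<lambda>z. (cmod (f z - g z))\<^sup>2 * ?w z)"
  proof (rule Bochner_Integration.integrable_bound[OF i])
    note [measurable] = f g borel_measurable_V[OF borel_measurable_radial_weight]
    show "(\<lambda>z. (cmod (f z - g z))\<^sup>2 * ?w z) \<in> borel_measurable V" by measurable
    show "AE z in V. norm ((cmod (f z - g z))\<^sup>2 * ?w z) \<le> norm (2 * ((cmod (f z))\<^sup>2 * ?w z) + 2 * ((cmod (g z))\<^sup>2 * ?w z))"
    proof (rule AE_I2)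
      fix z
      have "0 \<le> (cmod (f z - g z))\<^sup>2 * ?w z" by (simp add: radial_weight_nonneg)
      then show "norm ((cmod (f z - g z))\<^sup>2 * ?w z) \<le> norm (2 * ((cmod (f z))\<^sup>2 * ?w z) + 2 * ((cmod (g z))\<^sup>2 * ?w z))"
        using pt[of z] unfolding real_norm_def by linarith
    qed
  qed
  have "(LINT z|V. (cmod (f z - g z))\<^sup>2 * ?w z) \<le> (LINT z|V. 2 * ((cmod (f z))\<^sup>2 * ?w z) + 2 * ((cmod (g z))\<^sup>2 * ?w z))"
    by (rule integral_mono[OF int i pt])
  also have "\<dots> = 2 * (LINT z|V. (cmod (f z))\<^sup>2 * ?w z) + 2 * (LINT z|V. (cmod (g z))\<^sup>2 * ?w z)" using fi gi by simp
  finally show "(LINT z|V. (cmod (f z - g z))\<^sup>2 * ?w z)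
      \<le> 2 * (LINT z|V. (cmod (f z))\<^sup>2 * ?w z) + 2 * (LINT z|V. (cmod (g z))\<^sup>2 * ?w z)" .
qed

text \<open>A sequence converging in the weighted L2 space is Cauchy in the component space, so it
  has a holomorphic limit there. The two limits agree almost everywhere.\<close>

lemma admissible_radial_weight:
  assumes b: "\<beta> > 0"
  shows "admissible_weight (radial_weight \<beta> :: complex ^ 'd::finite \<Rightarrow> real)"
proof -
  let ?w = "radial_weight \<beta> :: complex ^ 'd \<Rightarrow> real"
  let ?c = "besov_coeff CARD('d) \<beta> 0"
  let ?I = "\<lambda>f. LINT z|V. (cmod (f z))\<^sup>2 * ?w z"
  have kw: "kernel_weight TYPE('d) ?c"
    by (rule kernel_weightI[OF equiv_weights_besov_coeff[OF b, of _ 0]]) (use b in auto)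
  have cp: "?c n > 0" for n using kw by (simp add: kernel_weight_def)
  have fs: "L2a ?w = funs (component_space ?c)"
    using agreeD(1)[OF same_space_besov[OF b, of 0, where 'd = 'd]] by (simp add: besov_def)
  have ns: "L2_norm ?w f = fnorm (component_space ?c) f" if "f \<in> funs (component_space ?c)" for f
    using agreeD(2)[OF same_space_besov[OF b, of 0, where 'd = 'd] that] by (simp add: besov_def)
  have L2: "f \<in> borel_measurable V" "integrable V (\<lambda>z. (cmod (f z))\<^sup>2 * ?w z)" if "f \<in> L2 ?w" for f
    using that by (auto simp: L2_def)
  have LL: "f \<in> L2 ?w" if "f \<in> funs (component_space ?c)" for f using that unfolding fs[symmetric] L2a_def by blast
  have I0: "?I f \<ge> 0" for f by (rule Bochner_Integration.integral_nonneg) (simp add: radial_weight_nonneg)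
  have n2: "L2_norm ?w f = sqrt (?I f)" for f by (simp add: L2_norm_def)
  have closed: "\<exists>f\<in>L2a ?w. AE z in density V (\<lambda>z. ennreal (?w z)). f z = g z"
    if g: "g \<in> L2 ?w" and F: "\<And>k::nat. F k \<in> L2a ?w" and lim: "(\<lambda>k. L2_norm ?w (\<lambda>z. F k z - g z)) \<longlonglongrightarrow> 0" for F g
  proof -
    have FD: "F k \<in> funs (component_space ?c)" for k using F unfolding fs .
    have FL: "F k \<in> L2 ?w" for k by (rule LL[OF FD])
    have lim2: "(\<lambda>k. ?I (\<lambda>z. F k z - g z)) \<longlonglongrightarrow> 0"
      using tendsto_power[OF lim, of 2] I0 by (simp add: n2)
    note Fg = weighted_L2_diff_le[OF L2(1)[OF FL] L2(1)[OF g] L2(2)[OF FL] L2(2)[OF g]]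
    have Fgm: "(\<lambda>z. F k z - g z) \<in> borel_measurable V" for k using L2(1)[OF FL] L2(1)[OF g] by measurable
    have "\<exists>f\<in>funs (component_space ?c). (\<lambda>k. fnorm (component_space ?c) (\<lambda>z. F k z - f z)) \<longlonglongrightarrow> 0"
    proof (rule component_space_complete[OF kw FD])
      fix e :: real assume e: "e > 0"
      \<comment> \<open>Two distances to \<open>g\<close>, each squared and doubled, add up to less
        than the square of \<open>e\<close>.\<close>
      then have "e\<^sup>2 / 4 > 0" by simp
      from order_tendstoD(2)[OF lim2 this] obtain M where M: "\<And>k. k \<ge> M \<Longrightarrow> ?I (\<lambda>z. F k z - g z) < e\<^sup>2 / 4"
        unfolding eventually_sequentially by blast
      have "fnorm (component_space ?c) (\<lambda>z. F k z - F l z) < e" if kl: "k \<ge> M" "l \<ge> M" for k l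
      proof -
        have "?I (\<lambda>z. F k z - F l z) \<le> 2 * ?I (\<lambda>z. F k z - g z) + 2 * ?I (\<lambda>z. F l z - g z)"
          using weighted_L2_diff_le(2)[OF Fgm[of k] Fgm[of l] Fg(1) Fg(1)] by simp
        also have "\<dots> < e\<^sup>2" using M[OF kl(1)] M[OF kl(2)] by simp
        finally have "sqrt (?I (\<lambda>z. F k z - F l z)) < sqrt (e\<^sup>2)" by (rule real_sqrt_less_mono)
        then show ?thesis using e ns[OF component_space_diff[OF cp FD FD], of k l] by (simp add: n2)
      qed
      then show "\<exists>M. \<forall>k\<ge>M. \<forall>l\<ge>M. fnorm (component_space ?c) (\<lambda>z. F k z - F l z) < e" by blast
    qed
    then obtain f where f: "f \<in> funs (component_space ?c)" and fl: "(\<lambda>k. fnorm (component_space ?c) (\<lambda>z. F k z - f z)) \<longlonglongrightarrow> 0" by blast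
    note fL = LL[OF f]
    have "(\<lambda>k. L2_norm ?w (\<lambda>z. F k z - f z)) \<longlonglongrightarrow> 0"
      using fl ns[OF component_space_diff[OF cp FD f]] by simp
    from tendsto_power[OF this, of 2] have fl2: "(\<lambda>k. ?I (\<lambda>z. F k z - f z)) \<longlonglongrightarrow> 0" using I0 by (simp add: n2)
    note Ff = weighted_L2_diff_le[OF L2(1)[OF FL] L2(1)[OF fL] L2(2)[OF FL] L2(2)[OF fL]]
    have Ffm: "(\<lambda>z. F k z - f z) \<in> borel_measurable V" for k using L2(1)[OF FL] L2(1)[OF fL] by measurable
    note fg = weighted_L2_diff_le[OF L2(1)[OF fL] L2(1)[OF g] L2(2)[OF fL] L2(2)[OF g]]
    have "?I (\<lambda>z. f z - g z) \<le> 2 * ?I (\<lambda>z. F k z - g z) + 2 * ?I (\<lambda>z. F k z - f z)" for k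
      using weighted_L2_diff_le(2)[OF Fgm[of k] Ffm[of k] Fg(1) Ff(1)] by (simp add: norm_minus_commute)
    moreover have "(\<lambda>k. 2 * ?I (\<lambda>z. F k z - g z) + 2 * ?I (\<lambda>z. F k z - f z)) \<longlonglongrightarrow> 2 * 0 + 2 * 0"
      by (intro tendsto_intros lim2 fl2)
    ultimately have "?I (\<lambda>z. f z - g z) \<le> 0" by (intro LIMSEQ_le_const[where X = "\<lambda>k. 2 * ?I (\<lambda>z. F k z - g z) + 2 * ?I (\<lambda>z. F k z - f z)"]) auto
    then have "?I (\<lambda>z. f z - g z) = 0" using I0[of "\<lambda>z. f z - g z"] by linarith
    then have "AE z in V. (cmod (f z - g z))\<^sup>2 * ?w z = 0"
      using integral_nonneg_eq_0_iff_AE[OF fg(1)] by (simp add: radial_weight_nonneg)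
    \<comment> \<open>The weight is strictly positive on the ball, so it can be cancelled.\<close>
    then have "AE z in V. f z = g z"
      by (rule AE_mp) (rule AE_I2, use radial_weight_pos[of _ \<beta>] in \<open>force simp: space_V\<close>)
    moreover have "(\<lambda>z. ennreal (?w z)) \<in> borel_measurable V"
      by (rule measurable_compose[OF borel_measurable_V[OF borel_measurable_radial_weight] measurable_ennreal])
    ultimately have "AE z in density V (\<lambda>z. ennreal (?w z)). f z = g z"
      by (simp only: AE_density) (erule eventually_mono, simp)
    then show ?thesis using f fs by blast
  qed
  have eval: "\<exists>C. \<forall>f\<in>L2a ?w. cmod (f z) \<le> C * L2_norm ?w f" if z: "z \<in> unit_ball" for z
  proof (intro exI ballI)
    fix f assume "f \<in> L2a ?w"
    then have f: "f \<in> funs (component_space ?c)" unfolding fs .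
    show "cmod (f z) \<le> sqrt (\<Sum>n. kernel_coeff (real CARD('d) + 1) n / ?c n * ((norm z)\<^sup>2) ^ n) * L2_norm ?w f"
      unfolding ns[OF f] by (rule component_space_pointwise_bound[OF kw f order_refl]) (use z in simp)
  qed
  show ?thesis unfolding admissible_weight_def
  proof (intro conjI ballI allI impI)
    fix F g assume g: "g \<in> L2 ?w" and "(\<forall>k::nat. F k \<in> L2a ?w) \<and> (\<lambda>k. L2_norm ?w (\<lambda>z. F k z - g z)) \<longlonglongrightarrow> 0"
    then show "\<exists>f\<in>L2a ?w. AE z in density V (\<lambda>z. ennreal (?w z)). f z = g z"
      by (intro closed[OF g, of F]) blast+
  qed (use radial_weight_nonneg integral_radial_weight(2)[OF b] eval in simp_all)
qed

section \<open>Multipliers and the Schur product with the Drury--Arveson kernel\<close>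

text \<open>Compare coefficients in (1 - x)^(-a) (1 - x)^(-1) = (1 - x)^(-(a + 1)).\<close>

lemma sum_kernel_coeff: "(\<Sum>i\<le>n. kernel_coeff a i) = kernel_coeff (a + 1) n"
proof (induction n)
  case (Suc n)
  have r: "kernel_coeff a (Suc n) = kernel_coeff (a + 1) n * a / real (Suc n)"
    by (simp add: kernel_coeff_def pochhammer_rec mult_ac)
  show ?case using Suc unfolding sum.atMost_Suc r kernel_coeff_Suc[of "a + 1" n] by (simp add: field_simps)
qed simp

text \<open>Iterating a row or column of d operators m times indexes the products by words. Words,
  unlike multi-indices, bring in no multinomial coefficients.\<close>

definition words :: "nat \<Rightarrow> 'd::finite list set"
  where "words m = {w. length w = m}"

lemma words_0: "words 0 = {[]}"
  by (auto simp: words_def)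

lemma sum_words_Suc:
  fixes f :: "'d::finite list \<Rightarrow> 'b::comm_monoid_add"
  shows "(\<Sum>w\<in>words (Suc m). f w) = (\<Sum>i\<in>UNIV. \<Sum>w\<in>words m. f (i # w))"
proof -
  have "(words (Suc m) :: 'd list set) = (\<lambda>(i, w). i # w) ` (UNIV \<times> words m)"
    by (auto simp: words_def length_Suc_conv image_iff)
  moreover have "inj_on (\<lambda>(i :: 'd, w). i # w) (UNIV \<times> words m)" by (auto simp: inj_on_def)
  ultimately show ?thesis by (simp add: sum.reindex sum.cartesian_product split_def comp_def)
qed

definition word_mono :: "'d list \<Rightarrow> complex ^ 'd::finite \<Rightarrow> complex"
  where "word_mono w z = (\<Prod>i\<leftarrow>w. z $ i)"

lemma word_mono_simps: "word_mono [] z = 1" "word_mono (i # w) z = z $ i * word_mono w z"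
  by (simp_all add: word_mono_def)

lemma homogeneous_poly_word_mono: "homogeneous_poly (length w) (word_mono w)"
proof (induction w)
  case Nil
  then show ?case using homogeneous_poly_const[of 1] by (simp add: word_mono_def[abs_def])
next
  case (Cons i w)
  then show ?case using homogeneous_poly_vec_nth_mult[OF Cons, of i] by (simp add: word_mono_simps(2)[abs_def])
qed

text \<open>On homogeneous polynomials of degree \<open>n\<close> this is the squared Drury--Arveson norm.\<close>

definition da_norm2 :: "nat \<Rightarrow> (complex ^ 'd::finite \<Rightarrow> complex) \<Rightarrow> real"
  where "da_norm2 n p = kernel_coeff (real CARD('d) + 1) n * bergman_norm2 p"

lemma da_norm2_nonneg: "da_norm2 n p \<ge> 0"
  unfolding da_norm2_def by (intro mult_nonneg_nonneg bergman_norm2_nonneg less_imp_le kernel_coeff_pos) simp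

text \<open>From \<open>n\<close> to \<open>n + 1\<close> the factor
  \<open>kernel_coeff (real CARD('d) + 1)\<close> grows by (n + d + 1) / (n + 1), which is exactly
  the constant in \<open>bergman_norm2_row_mult\<close>.\<close>

lemma da_norm2_row:
  fixes p :: "'d::finite \<Rightarrow> complex ^ 'd \<Rightarrow> complex"
  assumes "\<And>i. homogeneous_poly n (p i)"
  shows "da_norm2 (Suc n) (\<lambda>z. \<Sum>i\<in>UNIV. z $ i * p i z) \<le> (\<Sum>i\<in>UNIV. da_norm2 n (p i))"
proof -
  let ?g = "\<lambda>z. \<Sum>i\<in>UNIV. z $ i * p i z" and ?k = "kernel_coeff (real CARD('d) + 1) n"
  have k: "?k / real (Suc n) > 0" by (intro divide_pos_pos kernel_coeff_pos) simp_all
  have "da_norm2 (Suc n) ?g = ?k / real (Suc n) * (real (n + CARD('d) + 1) * bergman_norm2 ?g)"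
    unfolding da_norm2_def kernel_coeff_Suc by (simp add: add_ac)
  also have "\<dots> \<le> ?k / real (Suc n) * (real (Suc n) * (\<Sum>i\<in>UNIV. bergman_norm2 (p i)))"
    by (rule mult_left_mono[OF bergman_norm2_row_mult[OF assms] less_imp_le[OF k]])
  also have "\<dots> = (\<Sum>i\<in>UNIV. da_norm2 n (p i))" unfolding da_norm2_def by (simp add: sum_distrib_left)
  finally show ?thesis .
qed

text \<open>Euler's identity splits \<open>p\<close> with \<open>q i\<close> the partial derivative
  divided by n + 1, and the norm formula for the derivatives makes this splitting isometric.\<close>

lemma da_norm2_column:
  fixes p :: "complex ^ 'd::finite \<Rightarrow> complex"
  assumes p: "homogeneous_poly (Suc n) p"
  shows "\<exists>q. (\<forall>i. homogeneous_poly n (q i)) \<and> (\<forall>z. p z = (\<Sum>i\<in>UNIV. z $ i * q i z)) \<and>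
    (\<Sum>i\<in>UNIV. da_norm2 n (q i)) = da_norm2 (Suc n) p"
proof (intro exI conjI allI)
  let ?c = "1 / of_nat (Suc n) :: complex"
  let ?q = "\<lambda>i z. ?c * partial_deriv i p z"
  show "homogeneous_poly n (?q i)" for i
    using homogeneous_poly_cmult[OF homogeneous_poly_partial_deriv[OF p, of i], of ?c] by (simp only: diff_Suc_1)
  have "(\<Sum>i\<in>UNIV. z $ i * ?q i z) = ?c * (\<Sum>i\<in>UNIV. z $ i * partial_deriv i p z)" for z
    by (simp add: sum_distrib_left mult.left_commute)
  then show "p z = (\<Sum>i\<in>UNIV. z $ i * ?q i z)" for z
    unfolding homogeneous_poly_euler[OF p] by (simp del: of_nat_Suc)
  have "cmod ?c = 1 / real (Suc n)" by (simp only: norm_divide norm_one norm_of_nat)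
  then have "bergman_norm2 (?q i) = (1 / real (Suc n))\<^sup>2 * bergman_norm2 (partial_deriv i p)" for i unfolding bergman_norm2_cmult by simp
  then have "(\<Sum>i\<in>UNIV. da_norm2 n (?q i)) = kernel_coeff (real CARD('d) + 1) n * (1 / real (Suc n))\<^sup>2 * (\<Sum>i\<in>UNIV. bergman_norm2 (partial_deriv i p))"
    unfolding da_norm2_def by (simp only: sum_distrib_left mult.assoc)
  also have "\<dots> = da_norm2 (Suc n) p"
    unfolding sum_bergman_norm2_partial_deriv[OF p] da_norm2_def kernel_coeff_Suc by (simp add: power2_eq_square add_ac del: of_nat_Suc)
  finally show "(\<Sum>i\<in>UNIV. da_norm2 n (?q i)) = da_norm2 (Suc n) p" .
qed

lemma homogeneous_poly_word_sum:
  assumes "\<And>w. w \<in> words m \<Longrightarrow> homogeneous_poly n (p w)"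
  shows "homogeneous_poly (n + m) (\<lambda>z. \<Sum>w\<in>words m. word_mono w z * p w z)"
proof (rule homogeneous_poly_sum)
  fix w :: "'a list" assume w: "w \<in> words m"
  then have "length w + n = n + m" by (simp add: words_def)
  then show "homogeneous_poly (n + m) (\<lambda>z. word_mono w z * p w z)"
    using homogeneous_poly_mult[OF homogeneous_poly_word_mono[of w] assms[OF w]] by (simp only:)
qed

lemma da_norm2_word_row:
  fixes p :: "'d::finite list \<Rightarrow> complex ^ 'd \<Rightarrow> complex"
  assumes "\<And>w. w \<in> words m \<Longrightarrow> homogeneous_poly n (p w)"
  shows "da_norm2 (n + m) (\<lambda>z. \<Sum>w\<in>words m. word_mono w z * p w z) \<le> (\<Sum>w\<in>words m. da_norm2 n (p w))"
  using assms
proof (induction m arbitrary: p)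
  case 0
  then show ?case by (simp add: words_0 word_mono_simps)
next
  case (Suc m)
  have h: "homogeneous_poly n (p (i # w))" if "w \<in> words m" for i w
    by (rule Suc.prems) (use that in \<open>simp add: words_def\<close>)
  let ?g = "\<lambda>i z. \<Sum>w\<in>words m. word_mono w z * p (i # w) z"
  have "(\<lambda>z. \<Sum>w\<in>words (Suc m). word_mono w z * p w z) = (\<lambda>z. \<Sum>i\<in>UNIV. z $ i * ?g i z)"
    by (simp add: fun_eq_iff sum_words_Suc word_mono_simps sum_distrib_left mult.assoc)
  then have "da_norm2 (n + Suc m) (\<lambda>z. \<Sum>w\<in>words (Suc m). word_mono w z * p w z) = da_norm2 (Suc (n + m)) (\<lambda>z. \<Sum>i\<in>UNIV. z $ i * ?g i z)"
    by simp
  also have "\<dots> \<le> (\<Sum>i\<in>UNIV. da_norm2 (n + m) (?g i))"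
    by (rule da_norm2_row) (rule homogeneous_poly_word_sum[OF h])
  also have "\<dots> \<le> (\<Sum>i\<in>UNIV. \<Sum>w\<in>words m. da_norm2 n (p (i # w)))"
    by (intro sum_mono Suc.IH h)
  finally show ?case by (simp add: sum_words_Suc)
qed

text \<open>The isometric splitting is applied repeatedly; the first letter of a word records the
  first splitting and its tail those of the resulting piece.\<close>

lemma da_norm2_word_column:
  fixes p :: "complex ^ 'd::finite \<Rightarrow> complex"
  assumes p: "homogeneous_poly (n + m) p"
  shows "\<exists>q. (\<forall>w\<in>words m. homogeneous_poly n (q w)) \<and> (\<forall>z. p z = (\<Sum>w\<in>words m. word_mono w z * q w z)) \<and>
    (\<Sum>w\<in>words m. da_norm2 n (q w)) = da_norm2 (n + m) p"
  using p
proof (induction m arbitrary: p)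
  case 0
  then show ?case by (intro exI[of _ "\<lambda>_. p"]) (simp add: words_0 word_mono_simps)
next
  case (Suc m)
  have "homogeneous_poly (Suc (n + m)) p" using Suc.prems by simp
  from da_norm2_column[OF this] obtain r where r: "\<And>i. homogeneous_poly (n + m) (r i)" "\<And>z. p z = (\<Sum>i\<in>UNIV. z $ i * r i z)"
    "(\<Sum>i\<in>UNIV. da_norm2 (n + m) (r i)) = da_norm2 (Suc (n + m)) p"
    by blast
  have "\<forall>i. \<exists>q. (\<forall>w\<in>words m. homogeneous_poly n (q w)) \<and> (\<forall>z. r i z = (\<Sum>w\<in>words m. word_mono w z * q w z)) \<and>
    (\<Sum>w\<in>words m. da_norm2 n (q w)) = da_norm2 (n + m) (r i)"
    by (intro allI Suc.IH r(1))
  from choice[OF this] obtain Q where Q': "\<forall>i. (\<forall>w\<in>words m. homogeneous_poly n (Q i w)) \<and>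
      (\<forall>z. r i z = (\<Sum>w\<in>words m. word_mono w z * Q i w z)) \<and> (\<Sum>w\<in>words m. da_norm2 n (Q i w)) = da_norm2 (n + m) (r i)" ..
  have Q: "w \<in> words m \<Longrightarrow> homogeneous_poly n (Q i w)" "r i z = (\<Sum>w\<in>words m. word_mono w z * Q i w z)"
    "(\<Sum>w\<in>words m. da_norm2 n (Q i w)) = da_norm2 (n + m) (r i)" for i w z
    using Q' by simp_all
  let ?q = "\<lambda>w. Q (hd w) (tl w)"
  have q1: "\<forall>w\<in>words (Suc m). homogeneous_poly n (?q w)" using Q(1) by (auto simp: words_def)
  have q2: "\<forall>z. p z = (\<Sum>w\<in>words (Suc m). word_mono w z * ?q w z)"
    by (simp add: r(2) Q(2) sum_words_Suc word_mono_simps sum_distrib_left mult.assoc)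
  have q3: "(\<Sum>w\<in>words (Suc m). da_norm2 n (?q w)) = da_norm2 (n + Suc m) p"
    by (simp add: sum_words_Suc Q(3) r(3))
  show ?case by (rule exI[of _ ?q], rule conjI[OF q1 conjI[OF q2 q3]])
qed

text \<open>Pointwise Cauchy-Schwarz with free weights. They will be Taylor coefficients whose sum
  is again a Taylor coefficient, with exponent one higher.\<close>

lemma bergman_norm2_weighted_sum_le:
  assumes x: "\<And>m. m \<in> A \<Longrightarrow> homogeneous_poly n (x m)" and l: "\<And>m. m \<in> A \<Longrightarrow> l m > 0"
  shows "bergman_norm2 (\<lambda>z. \<Sum>m\<in>A. x m z) \<le> (\<Sum>m\<in>A. l m) * (\<Sum>m\<in>A. bergman_norm2 (x m) / l m)"
proof -
  have pt: "(cmod (\<Sum>m\<in>A. x m z))\<^sup>2 \<le> (\<Sum>m\<in>A. l m) * (\<Sum>m\<in>A. (cmod (x m z))\<^sup>2 / l m)" for z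
  proof -
    have "(\<Sum>m\<in>A. x m z) = (\<Sum>m\<in>A. complex_of_real (sqrt (l m)) * (x m z / complex_of_real (sqrt (l m))))"
      by (rule sum.cong) (use l in auto, use l in force)
    then have "(cmod (\<Sum>m\<in>A. x m z))\<^sup>2 \<le> (\<Sum>m\<in>A. (cmod (complex_of_real (sqrt (l m))))\<^sup>2) * (\<Sum>m\<in>A. (cmod (x m z / complex_of_real (sqrt (l m))))\<^sup>2)"
      using sum_cauchy_schwarz_complex[of "\<lambda>m. complex_of_real (sqrt (l m))" "\<lambda>m. x m z / complex_of_real (sqrt (l m))" A] by simp
    also have "(\<Sum>m\<in>A. (cmod (complex_of_real (sqrt (l m))))\<^sup>2) = (\<Sum>m\<in>A. l m)"
      by (rule sum.cong) (use l in \<open>auto simp: less_imp_le\<close>)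
    also have "(\<Sum>m\<in>A. (cmod (x m z / complex_of_real (sqrt (l m))))\<^sup>2) = (\<Sum>m\<in>A. (cmod (x m z))\<^sup>2 / l m)"
      by (rule sum.cong) (use l in \<open>auto simp: norm_divide power_divide less_imp_le\<close>)
    finally show ?thesis .
  qed
  have i: "integrable V (\<lambda>z. (cmod (x m z))\<^sup>2 / l m)" if "m \<in> A" for m
    using integrable_poly_sq[OF x[OF that]] by simp
  have "bergman_norm2 (\<lambda>z. \<Sum>m\<in>A. x m z) \<le> (LINT z|V. (\<Sum>m\<in>A. l m) * (\<Sum>m\<in>A. (cmod (x m z))\<^sup>2 / l m))"
    unfolding bergman_norm2_def
    by (rule integral_mono[OF integrable_poly_sq[OF homogeneous_poly_sum[OF x]]])
       (use i pt in \<open>auto intro!: Bochner_Integration.integrable_sum\<close>)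
  also have "\<dots> = (\<Sum>m\<in>A. l m) * (\<Sum>m\<in>A. bergman_norm2 (x m) / l m)"
    using i by (simp add: Bochner_Integration.integral_sum bergman_norm2_def)
  finally show ?thesis .
qed

section \<open>Spaces with exact kernel and the step from exponent a to a + 1\<close>

abbreviation kspace :: "real \<Rightarrow> 'd::finite fn_space"
  where "kspace a \<equiv> component_space (kernel_exponent_weight (real CARD('d)) a)"

lemma kernel_exponent_weight_pos: "a > 0 \<Longrightarrow> D \<ge> 0 \<Longrightarrow> kernel_exponent_weight D a n > 0"
  by (simp add: kernel_exponent_weight_def kernel_coeff_pos)

lemma kernel_exponent_weight_bergman_norm2:
  "kernel_exponent_weight (real CARD('d)) a n * bergman_norm2 p = da_norm2 n p / kernel_coeff a n" for p :: "complex ^ 'd::finite \<Rightarrow> complex"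
  by (simp add: kernel_exponent_weight_def da_norm2_def)

lemma fnorm_kspace_power2:
  fixes f :: "complex ^ 'd::finite \<Rightarrow> complex"
  assumes "a > 0" "f \<in> funs (kspace a)"
  shows "(\<lambda>n. da_norm2 n (hom_expansion f n) / kernel_coeff a n) sums ((fnorm (kspace a) f)\<^sup>2)"
  using fnorm_component_space_power2[OF kernel_exponent_weight_pos assms(2)] assms
  by (simp add: funs_component_space_iff kernel_exponent_weight_bergman_norm2 summable_sums)

lemma triangle_sum:
  fixes f :: "nat \<Rightarrow> nat \<Rightarrow> 'b::comm_monoid_add"
  shows "(\<Sum>n\<le>T. \<Sum>m\<le>n. f m (n - m)) = (\<Sum>m\<le>T. \<Sum>j\<le>T - m. f m j)"
proof -
  have "(\<Sum>n\<le>T. \<Sum>m\<le>n. f m (n - m)) = (\<Sum>(m, j)\<in>{(m, j). m + j \<le> T}. f m j)"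
    by (rule sum.triangle_reindex_eq[symmetric])
  also have "{(m, j). m + j \<le> T} = Sigma {..T} (\<lambda>m. {..T - m})" by auto
  finally show ?thesis by (simp add: sum.Sigma)
qed

lemma hom_expansion_homogeneous_mult:
  assumes e: "homogeneous_poly m e" and g: "g \<in> Hol"
  shows "hom_expansion (\<lambda>z. e z * g z) n = (\<lambda>z. if m \<le> n then e z * hom_expansion g (n - m) z else 0)"
proof
  fix z
  have "hom_expansion (\<lambda>z. e z * g z) n z = (\<Sum>i\<le>n. if i = m then e z * hom_expansion g (n - i) z else 0)"
    unfolding hom_expansion_mult[OF Hol_homogeneous_poly[OF e] g] hom_expansion_homogeneous_poly[OF e]
    by (intro sum.cong) auto
  then show "hom_expansion (\<lambda>z. e z * g z) n z = (if m \<le> n then e z * hom_expansion g (n - m) z else 0)"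
    by (simp add: sum.delta)
qed

lemma hom_expansion_poly:
  assumes "\<And>n. n \<le> T \<Longrightarrow> homogeneous_poly n (h n)"
  shows "hom_expansion (\<lambda>z. \<Sum>n\<le>T. h n z) = (\<lambda>n z. if n \<le> T then h n z else 0)"
proof (rule hom_expansionI)
  show "homogeneous_poly n (\<lambda>z. if n \<le> T then h n z else 0)" for n
    using assms by (cases "n \<le> T") (simp_all add: homogeneous_poly_zero)
  show "(\<lambda>n. if n \<le> T then h n z else 0) sums (\<Sum>n\<le>T. h n z)" for z
    using sums_If_finite_set[of "{..T}" "\<lambda>n. h n z"] by simp
qed

lemma Hol_poly: "(\<And>n. n \<le> T \<Longrightarrow> homogeneous_poly n (h n)) \<Longrightarrow> (\<lambda>z. \<Sum>n\<le>T. h n z) \<in> Hol"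
  by (intro Hol_sum) (auto intro: Hol_homogeneous_poly)

lemma kspace_poly:
  fixes h :: "nat \<Rightarrow> complex ^ 'd::finite \<Rightarrow> complex"
  assumes a: "a > 0" and h: "\<And>n. n \<le> T \<Longrightarrow> homogeneous_poly n (h n)"
  shows "(\<lambda>z. \<Sum>n\<le>T. h n z) \<in> funs (kspace a)"
    and "(fnorm (kspace a) (\<lambda>z. \<Sum>n\<le>T. h n z))\<^sup>2 = (\<Sum>n\<le>T. da_norm2 n (h n) / kernel_coeff a n)"
proof -
  have "(\<lambda>n. if n \<in> {..T} then da_norm2 n (h n) / kernel_coeff a n else 0) sums (\<Sum>n\<le>T. da_norm2 n (h n) / kernel_coeff a n)"
    by (rule sums_If_finite_set) simp
  moreover have "(\<lambda>n. if n \<in> {..T} then da_norm2 n (h n) / kernel_coeff a n else 0) = (\<lambda>n. da_norm2 n (hom_expansion (\<lambda>z. \<Sum>n\<le>T. h n z) n) / kernel_coeff a n)"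
    by (simp add: fun_eq_iff hom_expansion_poly[OF h] da_norm2_def bergman_norm2_def)
  ultimately have s: "(\<lambda>n. da_norm2 n (hom_expansion (\<lambda>z. \<Sum>n\<le>T. h n z) n) / kernel_coeff a n) sums (\<Sum>n\<le>T. da_norm2 n (h n) / kernel_coeff a n)" by simp
  then show f: "(\<lambda>z. \<Sum>n\<le>T. h n z) \<in> funs (kspace a)"
    using Hol_poly[of T h] h by (simp add: funs_component_space_iff kernel_exponent_weight_bergman_norm2 sums_iff)
  show "(fnorm (kspace a) (\<lambda>z. \<Sum>n\<le>T. h n z))\<^sup>2 = (\<Sum>n\<le>T. da_norm2 n (h n) / kernel_coeff a n)"
    by (rule sums_unique2[OF fnorm_kspace_power2[OF a f] s])
qed

text \<open>An explicit constant in place of the supremum in \<open>Mult_norm\<close>, so that it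
  can be followed through the steps. The pointwise l2 condition of \<open>Mult\<close> depends on
  neither space and is carried separately.\<close>

definition mult_bound :: "'d::finite fn_space \<Rightarrow> 'd fn_space \<Rightarrow> (nat \<Rightarrow> complex ^ 'd \<Rightarrow> complex) \<Rightarrow> real \<Rightarrow> bool"
  where "mult_bound H K \<Phi> C \<longleftrightarrow> 0 \<le> C \<and> (\<forall>h\<in>funs H. (\<forall>k. (\<lambda>z. \<Phi> k z * h z) \<in> funs K) \<and>
      summable (\<lambda>k. (fnorm K (\<lambda>z. \<Phi> k z * h z))\<^sup>2) \<and>
      sqrt (\<Sum>k. (fnorm K (\<lambda>z. \<Phi> k z * h z))\<^sup>2) \<le> C * fnorm H h)"

lemma mult_bound_funs:
  "mult_bound H K \<Phi> C \<Longrightarrow> h \<in> funs H \<Longrightarrow> (\<lambda>z. \<Phi> k z * h z) \<in> funs K"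
  by (simp add: mult_bound_def)

lemma mult_bound_partial_sum:
  assumes "mult_bound H K \<Phi> C" "h \<in> funs H" "fnorm H h \<ge> 0"
  shows "(\<Sum>k<T. (fnorm K (\<lambda>z. \<Phi> k z * h z))\<^sup>2) \<le> C\<^sup>2 * (fnorm H h)\<^sup>2"
proof -
  let ?S = "\<Sum>k. (fnorm K (\<lambda>z. \<Phi> k z * h z))\<^sup>2"
  have s: "summable (\<lambda>k. (fnorm K (\<lambda>z. \<Phi> k z * h z))\<^sup>2)" and le: "sqrt ?S \<le> C * fnorm H h"
    using assms by (auto simp: mult_bound_def)
  have "(\<Sum>k<T. (fnorm K (\<lambda>z. \<Phi> k z * h z))\<^sup>2) \<le> ?S" by (rule sum_le_suminf[OF s]) auto
  also have "\<dots> = (sqrt ?S)\<^sup>2" by (rule real_sqrt_pow2[symmetric]) (rule suminf_nonneg[OF s], simp)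
  also have "\<dots> \<le> (C * fnorm H h)\<^sup>2"
    by (rule power_mono[OF le]) (simp add: suminf_nonneg[OF s])
  finally show ?thesis by (simp add: power_mult_distrib)
qed

text \<open>If \<open>k\<^sub>b I - \<Phi> \<Phi>\<^sup>* k\<^sub>a \<ge> 0\<close>, then multiplying by the positive kernel \<open>1 / (1 - \<langle>z, w\<rangle>)\<close>
  preserves positivity. In terms of functions: a polynomial \<open>h\<close> is split as
  \<open>h = \<Sum> z\<^sub>w h\<^sub>w\<close> over words \<open>w\<close>, optimally for the two norms, and \<open>\<Phi>\<close> is applied to each \<open>h\<^sub>w\<close>.\<close>

lemma mult_bound_poly:
  fixes h :: "nat \<Rightarrow> complex ^ 'd::finite \<Rightarrow> complex"
  assumes a: "a > 0" and b: "b > 0" and M: "mult_bound (kspace a) (kspace b) \<Phi> C"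
    and h: "\<And>n. homogeneous_poly n (h n)"
  shows "(\<Sum>k<K. \<Sum>n\<le>T. da_norm2 n (hom_expansion (\<lambda>z. \<Phi> k z * (\<Sum>n\<le>T. h n z)) n) / kernel_coeff (b + 1) n)
     \<le> C\<^sup>2 * (\<Sum>n\<le>T. da_norm2 n (h n) / kernel_coeff (a + 1) n)"
proof -
  let ?W = "words :: nat \<Rightarrow> 'd list set"
  have "\<forall>m j. \<exists>q. (\<forall>w\<in>?W m. homogeneous_poly j (q w)) \<and> (\<forall>z. h (j + m) z = (\<Sum>w\<in>?W m. word_mono w z * q w z)) \<and>
    (\<Sum>w\<in>?W m. da_norm2 j (q w)) = da_norm2 (j + m) (h (j + m))"
    by (intro allI da_norm2_word_column h)
  then have "\<forall>mj. \<exists>q. (\<forall>w\<in>?W (fst mj). homogeneous_poly (snd mj) (q w)) \<and>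
     (\<forall>z. h (snd mj + fst mj) z = (\<Sum>w\<in>?W (fst mj). word_mono w z * q w z)) \<and>
    (\<Sum>w\<in>?W (fst mj). da_norm2 (snd mj) (q w)) = da_norm2 (snd mj + fst mj) (h (snd mj + fst mj))" by blast
  from choice[OF this] obtain q' where q': "\<forall>mj. (\<forall>w\<in>?W (fst mj). homogeneous_poly (snd mj) (q' mj w)) \<and>
     (\<forall>z. h (snd mj + fst mj) z = (\<Sum>w\<in>?W (fst mj). word_mono w z * q' mj w z)) \<and>
    (\<Sum>w\<in>?W (fst mj). da_norm2 (snd mj) (q' mj w)) = da_norm2 (snd mj + fst mj) (h (snd mj + fst mj))" ..
  define q where "q m j = q' (m, j)" for m j
  have q: "w \<in> ?W m \<Longrightarrow> homogeneous_poly j (q m j w)" "h (j + m) z = (\<Sum>w\<in>?W m. word_mono w z * q m j w z)"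
    "(\<Sum>w\<in>?W m. da_norm2 j (q m j w)) = da_norm2 (j + m) (h (j + m))" for m j w z
    using spec[OF q', of "(m, j)"] by (simp_all add: q_def)
  \<comment> \<open>The share of degree j + m that passes through words of length m. For fixed n = j
    + m the shares sum to 1 by \<open>sum_kernel_coeff\<close>, and among such shares they minimise
    the sum of t^2 / \<open>kernel_coeff a j\<close>.\<close>
  let ?t = "\<lambda>m j. kernel_coeff a j / kernel_coeff (a + 1) (j + m)"
  define g where "g m j w z = complex_of_real (?t m j) * q m j w z" for m j w z
  \<comment> \<open>The coefficient polynomial of the word \<open>w\<close>; its degree stops at
    \<open>T - m\<close> because the word itself has degree \<open>m\<close>.\<close>
  define H where "H m w z = (\<Sum>j\<le>T - m. g m j w z)" for m w z
  have gp: "homogeneous_poly j (g m j w)" if "w \<in> ?W m" for m j w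
    unfolding g_def[abs_def] by (rule homogeneous_poly_cmult[OF q(1)[OF that]])
  have kp: "kernel_coeff a n > 0" "kernel_coeff (a + 1) n > 0" "kernel_coeff b n > 0" "kernel_coeff (b + 1) n > 0" for n
    using a b by (simp_all add: kernel_coeff_pos)
  have HD: "H m w \<in> funs (kspace a)" and Hn: "(fnorm (kspace a) (H m w))\<^sup>2 = (\<Sum>j\<le>T - m. da_norm2 j (g m j w) / kernel_coeff a j)"
    if "w \<in> ?W m" for m w
    unfolding H_def[abs_def] by (rule kspace_poly[OF a gp[OF that]])+
  have \<Phi>D: "(\<lambda>z. \<Phi> k z * H m w z) \<in> funs (kspace b)" if "w \<in> ?W m" for k m w
    by (rule mult_bound_funs[OF M HD[OF that]])
  have refl_sum: "(\<Sum>m\<le>n. kernel_coeff c (n - m)) = kernel_coeff (c + 1) n" for c n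
    unfolding sum_kernel_coeff[symmetric] by (rule sum.reindex_bij_witness[of _ "\<lambda>i. n - i" "\<lambda>i. n - i"]) auto
  have decomp: "(\<Sum>n\<le>T. h n z) = (\<Sum>m\<le>T. \<Sum>w\<in>?W m. word_mono w z * H m w z)" for z
  proof -
    have "(\<Sum>m\<le>T. \<Sum>w\<in>?W m. word_mono w z * H m w z) = (\<Sum>m\<le>T. \<Sum>j\<le>T - m. \<Sum>w\<in>?W m. word_mono w z * g m j w z)"
      unfolding H_def sum_distrib_left by (intro sum.cong refl sum.swap)
    also have "\<dots> = (\<Sum>m\<le>T. \<Sum>j\<le>T - m. complex_of_real (?t m j) * h (j + m) z)"
      unfolding q(2) g_def sum_distrib_left by (intro sum.cong refl) (simp add: mult_ac)
    also have "\<dots> = (\<Sum>n\<le>T. \<Sum>m\<le>n. complex_of_real (?t m (n - m)) * h ((n - m) + m) z)"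
      by (rule triangle_sum[symmetric])
    also have "\<dots> = (\<Sum>n\<le>T. complex_of_real ((\<Sum>m\<le>n. kernel_coeff a (n - m)) / kernel_coeff (a + 1) n) * h n z)"
      by (intro sum.cong refl) (simp add: sum_distrib_right sum_divide_distrib)
    also have "\<dots> = (\<Sum>n\<le>T. h n z)"
    proof (rule sum.cong[OF refl])
      fix n
      show "complex_of_real ((\<Sum>m\<le>n. kernel_coeff a (n - m)) / kernel_coeff (a + 1) n) * h n z = h n z"
        using kp(2)[of n] by (simp add: refl_sum)
    qed
    finally show ?thesis by simp
  qed
  \<comment> \<open>Two losses are controlled: the row contraction handles words of one length,
    weighted Cauchy-Schwarz combines the lengths.\<close>
  have deg: "da_norm2 n (hom_expansion (\<lambda>z. \<Phi> k z * (\<Sum>n\<le>T. h n z)) n) / kernel_coeff (b + 1) n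
     \<le> (\<Sum>m\<le>n. \<Sum>w\<in>?W m. da_norm2 (n - m) (hom_expansion (\<lambda>z. \<Phi> k z * H m w z) (n - m)) / kernel_coeff b (n - m))"
    if n: "n \<le> T" for k n
  proof -
    let ?F = "\<lambda>m w. hom_expansion (\<lambda>z. \<Phi> k z * H m w z)"
    have FH: "(\<lambda>z. \<Phi> k z * H m w z) \<in> Hol" if "w \<in> ?W m" for m w by (rule component_space_Hol[OF \<Phi>D[OF that]])
    have eH: "homogeneous_poly m (word_mono w)" if "w \<in> ?W m" for m and w :: "'d list"
      using homogeneous_poly_word_mono[of w] that by (simp add: words_def)
    have eFH: "(\<lambda>z. word_mono w z * (\<Phi> k z * H m w z)) \<in> Hol" if "w \<in> ?W m" for m w
      by (rule Hol_mult[OF Hol_homogeneous_poly[OF eH[OF that]] FH[OF that]])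
    let ?x = "\<lambda>m z. \<Sum>w\<in>?W m. word_mono w z * ?F m w (n - m) z"
    have "hom_expansion (\<lambda>z. \<Phi> k z * (\<Sum>n\<le>T. h n z)) n = hom_expansion (\<lambda>z. \<Sum>m\<le>T. \<Sum>w\<in>?W m. word_mono w z * (\<Phi> k z * H m w z)) n"
      unfolding decomp by (simp add: sum_distrib_left mult.left_commute)
    also have "\<dots> = (\<lambda>z. \<Sum>m\<le>T. \<Sum>w\<in>?W m. hom_expansion (\<lambda>z. word_mono w z * (\<Phi> k z * H m w z)) n z)"
      by (simp add: hom_expansion_sum Hol_sum eFH)
    also have "\<dots> = (\<lambda>z. \<Sum>m\<le>T. if m \<le> n then ?x m z else 0)"
      by (intro ext sum.cong refl) (simp add: hom_expansion_homogeneous_mult[OF eH FH] cong: sum.cong)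
    also have "\<dots> = (\<lambda>z. \<Sum>m\<le>n. ?x m z)"
    proof
      fix z
      have "(\<Sum>m\<le>T. if m \<le> n then ?x m z else 0) = (\<Sum>m\<in>{m \<in> {..T}. m \<le> n}. ?x m z)"
        by (rule sum.inter_filter[symmetric]) simp
      also have "{m \<in> {..T}. m \<le> n} = {..n}" using n by auto
      finally show "(\<Sum>m\<le>T. if m \<le> n then ?x m z else 0) = (\<Sum>m\<le>n. ?x m z)" .
    qed
    finally have hx: "hom_expansion (\<lambda>z. \<Phi> k z * (\<Sum>n\<le>T. h n z)) n = (\<lambda>z. \<Sum>m\<le>n. ?x m z)" .
    have Fp: "homogeneous_poly (n - m) (?F m w (n - m))" if "w \<in> ?W m" for m w
      by (rule homogeneous_poly_hom_expansion[OF FH[OF that]])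
    have xp: "homogeneous_poly n (?x m)" if "m \<le> n" for m
      using homogeneous_poly_word_sum[of m "n - m" "\<lambda>w. ?F m w (n - m)"] Fp that by simp
    have row: "da_norm2 n (?x m) \<le> (\<Sum>w\<in>?W m. da_norm2 (n - m) (?F m w (n - m)))" if "m \<le> n" for m
      using da_norm2_word_row[of m "n - m" "\<lambda>w. ?F m w (n - m)"] Fp that by simp
    \<comment> \<open>These weights add up to \<open>kernel_coeff (b + 1) n\<close>, the denominator
      of the norm on the target side.\<close>
    have "bergman_norm2 (\<lambda>z. \<Sum>m\<le>n. ?x m z) \<le> (\<Sum>m\<le>n. kernel_coeff b (n - m)) * (\<Sum>m\<le>n. bergman_norm2 (?x m) / kernel_coeff b (n - m))"
      by (rule bergman_norm2_weighted_sum_le) (use xp kp in auto)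
    then have "bergman_norm2 (\<lambda>z. \<Sum>m\<le>n. ?x m z) \<le> kernel_coeff (b + 1) n * (\<Sum>m\<le>n. bergman_norm2 (?x m) / kernel_coeff b (n - m))" unfolding refl_sum .
    then have "kernel_coeff (real CARD('d) + 1) n * bergman_norm2 (\<lambda>z. \<Sum>m\<le>n. ?x m z) \<le> kernel_coeff (real CARD('d) + 1) n * (kernel_coeff (b + 1) n * (\<Sum>m\<le>n. bergman_norm2 (?x m) / kernel_coeff b (n - m)))"
      by (rule mult_left_mono) (intro less_imp_le kernel_coeff_pos, simp)
    also have "\<dots> = kernel_coeff (b + 1) n * (\<Sum>m\<le>n. da_norm2 n (?x m) / kernel_coeff b (n - m))"
      by (simp add: da_norm2_def sum_distrib_left mult_ac)
    finally have "da_norm2 n (\<lambda>z. \<Sum>m\<le>n. ?x m z) / kernel_coeff (b + 1) n \<le> (\<Sum>m\<le>n. da_norm2 n (?x m) / kernel_coeff b (n - m))"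
      using kp(4)[of n] by (simp add: da_norm2_def divide_le_eq mult.commute)
    also have "\<dots> \<le> (\<Sum>m\<le>n. (\<Sum>w\<in>?W m. da_norm2 (n - m) (?F m w (n - m))) / kernel_coeff b (n - m))"
      by (intro sum_mono divide_right_mono row) (use kp in \<open>auto simp: less_imp_le\<close>)
    finally show ?thesis unfolding hx by (simp add: sum_divide_distrib)
  qed
  have part: "(\<Sum>j\<le>J. da_norm2 j (hom_expansion (\<lambda>z. \<Phi> k z * H m w z) j) / kernel_coeff b j) \<le> (fnorm (kspace b) (\<lambda>z. \<Phi> k z * H m w z))\<^sup>2"
    if "w \<in> ?W m" for J k m w
  proof -
    note s = fnorm_kspace_power2[OF b \<Phi>D[OF that, of k]]
    have "(\<Sum>j\<in>{..J}. da_norm2 j (hom_expansion (\<lambda>z. \<Phi> k z * H m w z) j) / kernel_coeff b j) \<le> (\<Sum>j. da_norm2 j (hom_expansion (\<lambda>z. \<Phi> k z * H m w z) j) / kernel_coeff b j)"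
      by (rule sum_le_suminf[OF sums_summable[OF s]]) (auto intro!: divide_nonneg_nonneg da_norm2_nonneg less_imp_le[OF kp(3)])
    then show ?thesis using sums_unique[OF s] by simp
  qed
  have "(\<Sum>k<K. \<Sum>n\<le>T. da_norm2 n (hom_expansion (\<lambda>z. \<Phi> k z * (\<Sum>n\<le>T. h n z)) n) / kernel_coeff (b + 1) n)
     \<le> (\<Sum>k<K. \<Sum>n\<le>T. \<Sum>m\<le>n. \<Sum>w\<in>?W m. da_norm2 (n - m) (hom_expansion (\<lambda>z. \<Phi> k z * H m w z) (n - m)) / kernel_coeff b (n - m))"
    by (intro sum_mono deg) simp
  also have "\<dots> = (\<Sum>k<K. \<Sum>m\<le>T. \<Sum>j\<le>T - m. \<Sum>w\<in>?W m. da_norm2 j (hom_expansion (\<lambda>z. \<Phi> k z * H m w z) j) / kernel_coeff b j)"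
    by (intro sum.cong refl triangle_sum)
  also have "\<dots> = (\<Sum>k<K. \<Sum>m\<le>T. \<Sum>w\<in>?W m. \<Sum>j\<le>T - m. da_norm2 j (hom_expansion (\<lambda>z. \<Phi> k z * H m w z) j) / kernel_coeff b j)"
    by (intro sum.cong refl sum.swap)
  also have "\<dots> \<le> (\<Sum>k<K. \<Sum>m\<le>T. \<Sum>w\<in>?W m. (fnorm (kspace b) (\<lambda>z. \<Phi> k z * H m w z))\<^sup>2)"
    by (intro sum_mono part)
  also have "\<dots> = (\<Sum>m\<le>T. \<Sum>w\<in>?W m. \<Sum>k<K. (fnorm (kspace b) (\<lambda>z. \<Phi> k z * H m w z))\<^sup>2)"
    by (subst sum.swap) (intro sum.cong refl sum.swap)
  \<comment> \<open>The hypothesis on \<Phi> is applied to each \<open>H m w\<close> separately;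
    since squared norms are added over words, the constant does not grow.\<close>
  also have "\<dots> \<le> (\<Sum>m\<le>T. \<Sum>w\<in>?W m. C\<^sup>2 * (fnorm (kspace a) (H m w))\<^sup>2)"
    by (intro sum_mono mult_bound_partial_sum[OF M] HD fnorm_component_space_nonneg kernel_exponent_weight_pos a) simp_all
  also have "\<dots> = C\<^sup>2 * (\<Sum>m\<le>T. \<Sum>w\<in>?W m. \<Sum>j\<le>T - m. da_norm2 j (g m j w) / kernel_coeff a j)"
    unfolding sum_distrib_left by (intro sum.cong refl) (simp add: Hn sum_distrib_left)
  also have "(\<Sum>m\<le>T. \<Sum>w\<in>?W m. \<Sum>j\<le>T - m. da_norm2 j (g m j w) / kernel_coeff a j) = (\<Sum>m\<le>T. \<Sum>j\<le>T - m. \<Sum>w\<in>?W m. da_norm2 j (g m j w) / kernel_coeff a j)"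
    by (intro sum.cong refl sum.swap)
  also have "\<dots> = (\<Sum>m\<le>T. \<Sum>j\<le>T - m. kernel_coeff a j / (kernel_coeff (a + 1) (j + m))\<^sup>2 * da_norm2 (j + m) (h (j + m)))"
  proof (intro sum.cong refl)
    fix m j
    have "da_norm2 j (g m j w) = (?t m j)\<^sup>2 * da_norm2 j (q m j w)" for w
      unfolding g_def[abs_def] da_norm2_def bergman_norm2_cmult norm_of_real power2_abs by (simp only: mult_ac)
    then have "(\<Sum>w\<in>?W m. da_norm2 j (g m j w) / kernel_coeff a j) = (?t m j)\<^sup>2 / kernel_coeff a j * da_norm2 (j + m) (h (j + m))"
      unfolding q(3)[symmetric] by (simp add: sum_distrib_left)
    then show "(\<Sum>w\<in>?W m. da_norm2 j (g m j w) / kernel_coeff a j) = kernel_coeff a j / (kernel_coeff (a + 1) (j + m))\<^sup>2 * da_norm2 (j + m) (h (j + m))"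
      using kp(1)[of j] by (simp add: power2_eq_square)
  qed
  also have "\<dots> = (\<Sum>n\<le>T. \<Sum>m\<le>n. kernel_coeff a (n - m) / (kernel_coeff (a + 1) ((n - m) + m))\<^sup>2 * da_norm2 ((n - m) + m) (h ((n - m) + m)))"
    by (rule triangle_sum[symmetric])
  \<comment> \<open>For fixed \<open>n\<close> the numerators sum to
    \<open>kernel_coeff (a + 1) n\<close> and cancel one of the two factors below.\<close>
  also have "\<dots> = (\<Sum>n\<le>T. (\<Sum>m\<le>n. kernel_coeff a (n - m)) / (kernel_coeff (a + 1) n)\<^sup>2 * da_norm2 n (h n))"
    by (intro sum.cong refl) (simp add: sum_distrib_right sum_divide_distrib)
  also have "\<dots> = (\<Sum>n\<le>T. da_norm2 n (h n) / kernel_coeff (a + 1) n)"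
    unfolding refl_sum by (intro sum.cong refl) (simp add: power2_eq_square)
  finally show ?thesis .
qed

text \<open>The polynomial estimate is uniform in the number \<open>K\<close> of entries of \<Phi>
  and in the degree \<open>T\<close>, so both can tend to infinity.\<close>

lemma mult_bound_step:
  assumes a: "a > 0" and b: "b > 0" and M: "mult_bound (kspace a) (kspace b) \<Phi> C"
  shows "mult_bound (kspace (a + 1) :: 'd::finite fn_space) (kspace (b + 1)) \<Phi> C"
proof -
  have C: "0 \<le> C" using M by (simp add: mult_bound_def)
  \<comment> \<open>Constants belong to the space, so each entry of \<Phi>, being its product with
    1, is holomorphic.\<close>
  have one: "(\<lambda>z :: complex ^ 'd. 1) \<in> funs (kspace a)"
    using kspace_poly(1)[OF a, of 0 "\<lambda>_ _. 1"] homogeneous_poly_const[of 1] by simp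
  have \<Phi>H: "\<Phi> k \<in> Hol" for k
  proof -
    have "(\<lambda>z. \<Phi> k z * 1) \<in> Hol" by (rule component_space_Hol[OF mult_bound_funs[OF M one]])
    then show ?thesis by simp
  qed
  have a1: "a + 1 > 0" and b1: "b + 1 > 0" using a b by simp_all
  show ?thesis unfolding mult_bound_def
  proof (intro conjI ballI C)
    fix h :: "complex ^ 'd \<Rightarrow> complex" assume h: "h \<in> funs (kspace (a + 1))"
    note hH = component_space_Hol[OF h]
    have FH: "(\<lambda>z. \<Phi> k z * h z) \<in> Hol" for k by (intro Hol_mult \<Phi>H hH)
    let ?d = "\<lambda>k n. da_norm2 n (hom_expansion (\<lambda>z. \<Phi> k z * h z) n) / kernel_coeff (b + 1) n"
    have d0: "?d k n \<ge> 0" for k n by (intro divide_nonneg_nonneg da_norm2_nonneg less_imp_le kernel_coeff_pos b1)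
    let ?B = "C\<^sup>2 * (fnorm (kspace (a + 1)) h)\<^sup>2"
    have main: "(\<Sum>k<K. \<Sum>n\<le>T. ?d k n) \<le> ?B" for K T
    proof -
      let ?hT = "\<lambda>z. \<Sum>n\<le>T. hom_expansion h n z"
      note hp = homogeneous_poly_hom_expansion[OF hH]
      \<comment> \<open>A component of degree \<open>n \<le> T\<close> of the product involves
        components of \<open>h\<close> up to degree \<open>n\<close>, so truncating \<open>h\<close>
        at \<open>T\<close> does not change it.\<close>
      have "hom_expansion (\<lambda>z. \<Phi> k z * h z) n = hom_expansion (\<lambda>z. \<Phi> k z * ?hT z) n" if "n \<le> T" for k n
        unfolding hom_expansion_mult[OF \<Phi>H hH] hom_expansion_mult[OF \<Phi>H Hol_poly[OF hp]] hom_expansion_poly[OF hp]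
        using that by (intro ext sum.cong refl) simp
      then have "(\<Sum>k<K. \<Sum>n\<le>T. ?d k n) = (\<Sum>k<K. \<Sum>n\<le>T. da_norm2 n (hom_expansion (\<lambda>z. \<Phi> k z * ?hT z) n) / kernel_coeff (b + 1) n)"
        by simp
      also have "\<dots> \<le> C\<^sup>2 * (\<Sum>n\<le>T. da_norm2 n (hom_expansion h n) / kernel_coeff (a + 1) n)"
        by (rule mult_bound_poly[OF a b M hp])
      also have "(\<Sum>n\<le>T. da_norm2 n (hom_expansion h n) / kernel_coeff (a + 1) n) \<le> (\<Sum>n. da_norm2 n (hom_expansion h n) / kernel_coeff (a + 1) n)"
        by (rule sum_le_suminf[OF sums_summable[OF fnorm_kspace_power2[OF a1 h]]])
           (simp, rule divide_nonneg_nonneg[OF da_norm2_nonneg less_imp_le[OF kernel_coeff_pos[OF a1]]])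
      also have "\<dots> = (fnorm (kspace (a + 1)) h)\<^sup>2" by (rule sums_unique[OF fnorm_kspace_power2[OF a1 h], symmetric])
      finally show ?thesis by (simp add: mult_left_mono)
    qed
    have sk: "summable (?d k)" for k
    proof (rule summableI_nonneg_bounded[OF d0])
      fix n
      have "(\<Sum>i<n. ?d k i) \<le> (\<Sum>i\<le>n. ?d k i)" by (rule sum_mono2) (use d0 in auto)
      also have "\<dots> \<le> (\<Sum>k<Suc k. \<Sum>i\<le>n. ?d k i)" by (rule member_le_sum) (auto intro!: sum_nonneg d0)
      also have "\<dots> \<le> ?B" by (rule main)
      finally show "(\<Sum>i<n. ?d k i) \<le> ?B" .
    qed
    show fD: "\<forall>k. (\<lambda>z. \<Phi> k z * h z) \<in> funs (kspace (b + 1))"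
      using FH sk by (simp add: funs_component_space_iff kernel_exponent_weight_bergman_norm2)
    have n2: "(fnorm (kspace (b + 1)) (\<lambda>z. \<Phi> k z * h z))\<^sup>2 = (\<Sum>n. ?d k n)" for k
      using sums_unique[OF fnorm_kspace_power2[OF b1]] fD by blast
    have bd: "(\<Sum>k<K. (fnorm (kspace (b + 1)) (\<lambda>z. \<Phi> k z * h z))\<^sup>2) \<le> ?B" for K
    proof (rule LIMSEQ_le_const2)
      show "(\<lambda>T. \<Sum>k<K. \<Sum>n\<le>T. ?d k n) \<longlonglongrightarrow> (\<Sum>k<K. (fnorm (kspace (b + 1)) (\<lambda>z. \<Phi> k z * h z))\<^sup>2)"
        unfolding n2 by (intro tendsto_sum summable_LIMSEQ' sk)
    qed (use main in blast)
    show s: "summable (\<lambda>k. (fnorm (kspace (b + 1)) (\<lambda>z. \<Phi> k z * h z))\<^sup>2)"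
      by (rule summableI_nonneg_bounded[OF _ bd]) simp
    have "sqrt (\<Sum>k. (fnorm (kspace (b + 1)) (\<lambda>z. \<Phi> k z * h z))\<^sup>2) \<le> sqrt ?B"
      by (intro real_sqrt_le_mono suminf_le_const s bd)
    also have "\<dots> = C * fnorm (kspace (a + 1)) h"
      using C fnorm_component_space_nonneg[OF kernel_exponent_weight_pos h] a1 by (simp add: real_sqrt_mult)
    finally show "sqrt (\<Sum>k. (fnorm (kspace (b + 1)) (\<lambda>z. \<Phi> k z * h z))\<^sup>2) \<le> C * fnorm (kspace (a + 1)) h" .
  qed
qed

lemma component_space_zero: "(\<lambda>z. 0) \<in> funs (component_space w :: 'd::finite fn_space)"
  and fnorm_component_space_zero: "fnorm (component_space w :: 'd fn_space) (\<lambda>z. 0) = 0"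
proof -
  have "hom_expansion (\<lambda>z :: complex ^ 'd. 0) = (\<lambda>n z. 0)"
    using hom_expansion_homogeneous_poly[OF homogeneous_poly_zero[of 0]] by (simp add: fun_eq_iff)
  then show "(\<lambda>z. 0) \<in> funs (component_space w :: 'd fn_space)" "fnorm (component_space w :: 'd fn_space) (\<lambda>z. 0) = 0"
    by (simp_all add: funs_component_space_iff Hol_const fnorm_component_space bergman_norm2_def)
qed

section \<open>The multiplier inclusion condition\<close>

lemma fnorm_same_space_nonneg: "same_space H (component_space u) \<Longrightarrow> (\<And>n. u n > 0) \<Longrightarrow> f \<in> funs H \<Longrightarrow> 0 \<le> fnorm H f"
  using fnorm_component_space_nonneg agreeD by metis

lemma Mult_norm_le:
  assumes H: "same_space H (component_space u)" and M: "mult_bound H K \<Phi> C"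
  shows "Mult_norm H K \<Phi> \<le> C"
  unfolding Mult_norm_def
proof (rule cSUP_least)
  have "(\<lambda>z. 0) \<in> {h \<in> funs H. fnorm H h \<le> 1}"
    using agreeD(1)[OF H] agreeD(2)[OF H component_space_zero] by (simp add: component_space_zero fnorm_component_space_zero)
  then show "{h \<in> funs H. fnorm H h \<le> 1} \<noteq> {}" by blast
  fix h assume h: "h \<in> {h \<in> funs H. fnorm H h \<le> 1}"
  have "0 \<le> C" using M by (simp add: mult_bound_def)
  have "sqrt (\<Sum>k. (fnorm K (\<lambda>z. \<Phi> k z * h z))\<^sup>2) \<le> C * fnorm H h" using M h by (simp add: mult_bound_def)
  also have "C * fnorm H h \<le> C * 1" using h \<open>0 \<le> C\<close> by (intro mult_left_mono) auto
  finally show "sqrt (\<Sum>k. (fnorm K (\<lambda>z. \<Phi> k z * h z))\<^sup>2) \<le> C" by simp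
qed

text \<open>The constant provided by \<open>Mult\<close> makes the supremum finite; scaling to unit
  norm then extends its bound from the unit ball of the space to all of the space.\<close>

lemma mult_bound_Mult_norm:
  assumes H: "same_space H (component_space u)" and u: "\<And>n. u n > 0" and K: "same_space K (component_space v)" and v: "\<And>n. v n > 0"
    and \<Phi>: "\<Phi> \<in> Mult H K"
  shows "mult_bound H K \<Phi> (Mult_norm H K \<Phi>)"
proof -
  let ?S = "\<lambda>h. sqrt (\<Sum>k. (fnorm K (\<lambda>z. \<Phi> k z * h z))\<^sup>2)"
  let ?U = "{h \<in> funs H. fnorm H h \<le> 1}"
  note nn = fnorm_same_space_nonneg[OF H u]
  have fK: "(\<lambda>z. \<Phi> k z * h z) \<in> funs K" if "h \<in> funs H" for h k
    using \<Phi> that by (simp add: Mult_def)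
  have s: "summable (\<lambda>k. (fnorm K (\<lambda>z. \<Phi> k z * h z))\<^sup>2)" if "h \<in> funs H" for h
    using \<Phi> that by (simp add: Mult_def)
  have "\<exists>C. \<forall>h\<in>funs H. ?S h \<le> C * fnorm H h" using \<Phi> by (simp add: Mult_def)
  then obtain C where C: "\<And>h. h \<in> funs H \<Longrightarrow> ?S h \<le> C * fnorm H h" by auto
  have S0: "?S h \<ge> 0" if "h \<in> funs H" for h
    by (intro real_sqrt_ge_zero suminf_nonneg s that) simp
  have "?S h \<le> max 0 C" if "h \<in> ?U" for h
  proof -
    have "?S h \<le> C * fnorm H h" using C that by blast
    also have "\<dots> \<le> max 0 C * 1" using that nn[of h] by (intro mult_mono) auto
    finally show ?thesis by simp
  qed
  then have bdd: "bdd_above (?S ` ?U)" by (auto intro!: bdd_aboveI)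
  have le: "?S h \<le> Mult_norm H K \<Phi>" if "h \<in> ?U" for h
    unfolding Mult_norm_def by (rule cSUP_upper[OF that bdd])
  have zU: "(\<lambda>z. 0) \<in> ?U"
    using agreeD(1)[OF H] agreeD(2)[OF H component_space_zero] by (simp add: component_space_zero fnorm_component_space_zero)
  have M0: "0 \<le> Mult_norm H K \<Phi>" using order_trans[OF S0 le[OF zU]] zU by blast
  have sc: "(\<lambda>z. c * g z) \<in> funs K \<and> fnorm K (\<lambda>z. c * g z) = cmod c * fnorm K g" if "g \<in> funs K" for c g
    using component_space_cmult[of g v c] agreeD[OF K] that by simp
  have scH: "(\<lambda>z. c * g z) \<in> funs H \<and> fnorm H (\<lambda>z. c * g z) = cmod c * fnorm H g" if "g \<in> funs H" for c g
    using component_space_cmult[of g u c] agreeD[OF H] that by simp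
  have "?S h \<le> Mult_norm H K \<Phi> * fnorm H h" if h: "h \<in> funs H" for h
  proof (cases "fnorm H h = 0")
    \<comment> \<open>A function of norm 0 cannot be normalised, but the bound with \<open>C\<close>
      already gives 0.\<close>
    case True
    then show ?thesis using C[OF h] by simp
  next
    case False
    then have r: "fnorm H h > 0" using nn[OF h] by simp
    define c where "c = complex_of_real (1 / fnorm H h)"
    have cn: "cmod c = 1 / fnorm H h" unfolding c_def norm_of_real using r by simp
    have "(\<lambda>z. c * h z) \<in> ?U" using scH[OF h, of c] cn r by simp
    note le[OF this]
    moreover have "(fnorm K (\<lambda>z. \<Phi> k z * (c * h z)))\<^sup>2 = (1 / fnorm H h)\<^sup>2 * (fnorm K (\<lambda>z. \<Phi> k z * h z))\<^sup>2" for k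
    proof -
      have "fnorm K (\<lambda>z. \<Phi> k z * (c * h z)) = fnorm K (\<lambda>z. c * (\<Phi> k z * h z))" by (simp add: mult.left_commute)
      then show ?thesis using sc[OF fK[OF h], of c k] cn by (simp add: power_mult_distrib power_divide)
    qed
    ultimately have "sqrt ((1 / fnorm H h)\<^sup>2 * (\<Sum>k. (fnorm K (\<lambda>z. \<Phi> k z * h z))\<^sup>2)) \<le> Mult_norm H K \<Phi>"
      by (simp add: suminf_mult[OF s[OF h]])
    then have "1 / fnorm H h * ?S h \<le> Mult_norm H K \<Phi>" using r by (simp add: real_sqrt_mult)
    then show ?thesis using r by (simp add: field_simps)
  qed
  then show ?thesis unfolding mult_bound_def using M0 fK s by simp
qed

lemma Mult_mult_bound:
  "mult_bound H K \<Phi> C \<Longrightarrow> (\<And>z. z \<in> unit_ball \<Longrightarrow> summable (\<lambda>k. (cmod (\<Phi> k z))\<^sup>2)) \<Longrightarrow> \<Phi> \<in> Mult H K"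
  unfolding Mult_def mult_bound_def by auto

text \<open>The factor is chosen before \<Phi> and \<open>C\<close>; this uniformity is what makes
  the final inclusions continuous.\<close>

lemma mult_bound_equiv:
  assumes HH: "equal_equiv_norms H H'" and KK: "equal_equiv_norms K K'"
    and nH: "\<And>f. f \<in> funs H' \<Longrightarrow> 0 \<le> fnorm H' f" and nK: "\<And>f. f \<in> funs K' \<Longrightarrow> 0 \<le> fnorm K' f"
  shows "\<exists>c>0. \<forall>\<Phi> C. mult_bound H K \<Phi> C \<longrightarrow> mult_bound H' K' \<Phi> (c * C)"
proof -
  obtain b1 where b1: "b1 > 0" "\<And>f. f \<in> funs H' \<Longrightarrow> fnorm H f \<le> b1 * fnorm H' f" and fH: "funs H = funs H'"
    using HH unfolding equal_equiv_norms_def by auto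
  obtain a2 where a2: "a2 > 0" "\<And>f. f \<in> funs K' \<Longrightarrow> a2 * fnorm K' f \<le> fnorm K f" and fK: "funs K = funs K'"
    using KK unfolding equal_equiv_norms_def by auto
  have "mult_bound H' K' \<Phi> (b1 / a2 * C)" if M: "mult_bound H K \<Phi> C" for \<Phi> C
    unfolding mult_bound_def
  proof (intro conjI ballI allI)
    have C: "0 \<le> C" using M by (simp add: mult_bound_def)
    then show "0 \<le> b1 / a2 * C" using a2 b1 by simp
    fix h assume h: "h \<in> funs H'"
    have f: "(\<lambda>z. \<Phi> k z * h z) \<in> funs K'" for k using mult_bound_funs[OF M] h fH fK by simp
    then show "(\<lambda>z. \<Phi> k z * h z) \<in> funs K'" for k .
    let ?x = "\<lambda>k. (fnorm K (\<lambda>z. \<Phi> k z * h z))\<^sup>2" and ?y = "\<lambda>k. (fnorm K' (\<lambda>z. \<Phi> k z * h z))\<^sup>2"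
    have sx: "summable ?x" and le: "sqrt (\<Sum>k. ?x k) \<le> C * fnorm H h" using M h fH by (auto simp: mult_bound_def)
    have yx: "?y k \<le> 1 / a2\<^sup>2 * ?x k" for k
    proof -
      have "(a2 * fnorm K' (\<lambda>z. \<Phi> k z * h z))\<^sup>2 \<le> ?x k"
        using a2 f nK by (intro power_mono) auto
      then show ?thesis using a2(1) by (simp add: power_mult_distrib field_simps)
    qed
    show sy: "summable ?y" by (rule summable_comparison_test'[OF summable_mult[OF sx, of "1 / a2\<^sup>2"], of 0]) (use yx in simp)
    have "(\<Sum>k. ?y k) \<le> (\<Sum>k. 1 / a2\<^sup>2 * ?x k)" by (rule suminf_le[OF yx sy summable_mult[OF sx]])
    also have "\<dots> = 1 / a2\<^sup>2 * (\<Sum>k. ?x k)" by (rule suminf_mult[OF sx])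
    finally have "sqrt (\<Sum>k. ?y k) \<le> sqrt (1 / a2\<^sup>2 * (\<Sum>k. ?x k))" by (rule real_sqrt_le_mono)
    also have "\<dots> = 1 / a2 * sqrt (\<Sum>k. ?x k)" using a2(1) by (simp add: real_sqrt_divide)
    also have "\<dots> \<le> 1 / a2 * (C * (b1 * fnorm H' h))"
      using le mult_left_mono[OF b1(2)[OF h] C] a2(1) by (intro mult_left_mono) auto
    finally show "sqrt (\<Sum>k. ?y k) \<le> b1 / a2 * C * fnorm H' h" by (simp add: mult_ac)
  qed
  then show ?thesis using a2(1) b1(1) by (intro exI[of _ "b1 / a2"]) simp
qed

lemma besov_equiv_kspace:
  assumes b: "\<beta> > 0" and a: "a > 0" "a = real CARD('d) + 1 - (2 * real n - \<beta>)"
  shows "equiv_weights (besov_coeff CARD('d::finite) \<beta> n) (kernel_exponent_weight (real CARD('d)) a)"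
proof -
  have "equiv_weights (kernel_exponent_weight (real CARD('d)) a) (power_weight (real CARD('d) + 1 - a))"
    by (rule equiv_weights_kernel_exponent_weight[OF a(1)]) simp
  from equiv_weights_trans[OF equiv_weights_besov_coeff[OF b, of "CARD('d)" n] equiv_weights_sym] this show ?thesis by (simp add: a(2))
qed

text \<open>A change of norm to kernel spaces, two exact steps of \<open>mult_bound_step\<close>,
  and a change of norm back. Two steps are required because \<open>n\<close> enters the kernel
  exponent as \<open>2 * real n\<close>.\<close>

lemma besov_mult_bound_step:
  assumes b: "\<beta> > 0" "\<beta>' > 0" and n: "n \<ge> 1"
    and a: "2 * real n - \<beta> < real CARD('d) + 1" "2 * real n - \<beta>' < real CARD('d) + 1"
  shows "\<exists>c>0. \<forall>\<Phi> C. mult_bound (besov n (radial_weight \<beta>)) (besov n (radial_weight \<beta>')) \<Phi> C \<longrightarrow>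
    mult_bound (besov (n - 1) (radial_weight \<beta>)) (besov (n - 1) (radial_weight \<beta>') :: 'd::finite fn_space) \<Phi> (c * C)"
proof -
  define x where "x = real CARD('d) + 1 - (2 * real n - \<beta>)"
  define y where "y = real CARD('d) + 1 - (2 * real n - \<beta>')"
  have xy: "x > 0" "y > 0" using a by (simp_all add: x_def y_def)
  have xy2: "x + 1 + 1 = real CARD('d) + 1 - (2 * real (n - 1) - \<beta>)" "y + 1 + 1 = real CARD('d) + 1 - (2 * real (n - 1) - \<beta>')"
    using n by (simp_all add: x_def y_def of_nat_diff)
  have xp: "x + 1 + 1 > 0" "y + 1 + 1 > 0" "x + 1 > 0" "y + 1 > 0" using xy by simp_all
  note e1 = besov_equiv_kspace[OF b(1) xy(1) x_def] besov_equiv_kspace[OF b(2) xy(2) y_def]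
  note e2 = besov_equiv_kspace[OF b(1) xp(1) xy2(1)] besov_equiv_kspace[OF b(2) xp(2) xy2(2)]
  note ag = same_space_besov[OF b(1), where 'd = 'd] same_space_besov[OF b(2), where 'd = 'd]
  have "\<exists>c>0. \<forall>\<Phi> C. mult_bound (besov n (radial_weight \<beta>)) (besov n (radial_weight \<beta>')) \<Phi> C \<longrightarrow>
      mult_bound (kspace x) (kspace y :: 'd fn_space) \<Phi> (c * C)"
    by (rule mult_bound_equiv[OF equal_equiv_norms_component_space[OF e1(1) ag(1) same_space_refl] equal_equiv_norms_component_space[OF e1(2) ag(2) same_space_refl]])
       (intro fnorm_component_space_nonneg kernel_exponent_weight_pos xy; simp)+
  then obtain c1 where c1: "c1 > 0" "\<And>\<Phi> C. mult_bound (besov n (radial_weight \<beta>)) (besov n (radial_weight \<beta>')) \<Phi> C \<Longrightarrow>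
      mult_bound (kspace x) (kspace y :: 'd fn_space) \<Phi> (c1 * C)" by blast
  have "\<exists>c>0. \<forall>\<Phi> C. mult_bound (kspace (x + 1 + 1)) (kspace (y + 1 + 1)) \<Phi> C \<longrightarrow>
      mult_bound (besov (n - 1) (radial_weight \<beta>)) (besov (n - 1) (radial_weight \<beta>') :: 'd fn_space) \<Phi> (c * C)"
    by (rule mult_bound_equiv[OF equal_equiv_norms_component_space[OF equiv_weights_sym[OF e2(1)] same_space_refl ag(1)]
          equal_equiv_norms_component_space[OF equiv_weights_sym[OF e2(2)] same_space_refl ag(2)]])
       (rule fnorm_same_space_nonneg[OF ag(1) equiv_weights_pos(1)[OF e2(1)]], assumption,
        rule fnorm_same_space_nonneg[OF ag(2) equiv_weights_pos(1)[OF e2(2)]], assumption)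
  then obtain c2 where c2: "c2 > 0" "\<And>\<Phi> C. mult_bound (kspace (x + 1 + 1)) (kspace (y + 1 + 1)) \<Phi> C \<Longrightarrow>
      mult_bound (besov (n - 1) (radial_weight \<beta>)) (besov (n - 1) (radial_weight \<beta>') :: 'd fn_space) \<Phi> (c2 * C)" by blast
  show ?thesis
  proof (rule exI[of _ "c2 * c1"], intro conjI allI impI)
    show "c2 * c1 > 0" using c1 c2 by simp
    fix \<Phi> C assume "mult_bound (besov n (radial_weight \<beta>)) (besov n (radial_weight \<beta>') :: 'd fn_space) \<Phi> C"
    from c2(2)[OF mult_bound_step[OF xp(3,4) mult_bound_step[OF xy c1(2)[OF this]]]]
    show "mult_bound (besov (n - 1) (radial_weight \<beta>)) (besov (n - 1) (radial_weight \<beta>') :: 'd fn_space) \<Phi> (c2 * c1 * C)"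
      by (simp add: mult.assoc)
  qed
qed

lemma equal_equiv_norms_B1_besov:
  assumes "s < real N"
  shows "equal_equiv_norms (B1 s :: 'd::finite fn_space) (besov N (radial_weight (2 * (real N - s))))"
proof -
  have b: "2 * (real N - s) > 0" using assms by simp
  have "equiv_weights (besov_coeff CARD('d) (2 * (real N - s)) N) (power_weight (2 * s))"
    using equiv_weights_besov_coeff[OF b, of "CARD('d)" N] by (simp add: algebra_simps)
  from equal_equiv_norms_component_space[OF equiv_weights_sym[OF this] same_space_B1 same_space_besov[OF b]] show ?thesis .
qed

lemma weighted_besov_space_B1:
  assumes "s < real N" "s < (real CARD('d) + 1) / 2"
  shows "weighted_besov_space (B1 s :: 'd::finite fn_space)"
  unfolding weighted_besov_space_def
proof (intro conjI exI)
  have "kernel_weight TYPE('d) (power_weight (2 * s))"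
    by (rule kernel_weightI[OF equiv_weights_refl[OF power_weight_pos]]) (use assms in simp)
  then show "hilbert_analytic_space (B1 s :: 'd fn_space)"
    by (rule hilbert_analytic_space_component_space[OF _ same_space_B1])
  show "admissible_weight (radial_weight (2 * (real N - s)) :: complex ^ 'd \<Rightarrow> real)"
    by (rule admissible_radial_weight) (use assms in simp)
  show "equal_equiv_norms (B1 s :: 'd fn_space) (besov N (radial_weight (2 * (real N - s))))"
    by (rule equal_equiv_norms_B1_besov[OF assms(1)])
qed

theorem mainTheorem7:
  fixes s t :: real
  assumes "t \<le> s" and "s < (real CARD('d) + 1) / 2"
  shows "multiplier_inclusion_condition (B1 s :: 'd::finite fn_space) (B1 t)"
proof -
  \<comment> \<open>\<open>s < N\<close> makes both weight exponents 2 (N - s) and 2 (N - t)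
    positive, with \<open>t \<le> s\<close> letting one \<open>N\<close> serve both; the lower bound
    1 makes the chain nonempty.\<close>
  obtain N :: nat where "max s 1 < real N" using reals_Archimedean2 by blast
  then have N: "s < real N" "t < real N" "N \<ge> 1" using assms(1) by auto
  have t: "t < (real CARD('d) + 1) / 2" using assms by simp
  define \<beta> where "\<beta> = 2 * (real N - s)"
  define \<beta>' where "\<beta>' = 2 * (real N - t)"
  have b: "\<beta> > 0" "\<beta>' > 0" using N by (simp_all add: \<beta>_def \<beta>'_def)
  have step: "Mult (besov n (radial_weight \<beta>)) (besov n (radial_weight \<beta>') :: 'd fn_space)
        \<subseteq> Mult (besov (n - 1) (radial_weight \<beta>)) (besov (n - 1) (radial_weight \<beta>')) \<and>
      (\<exists>c>0. \<forall>\<Phi>\<in>Mult (besov n (radial_weight \<beta>)) (besov n (radial_weight \<beta>') :: 'd fn_space).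
        Mult_norm (besov (n - 1) (radial_weight \<beta>)) (besov (n - 1) (radial_weight \<beta>')) \<Phi>
          \<le> c * Mult_norm (besov n (radial_weight \<beta>)) (besov n (radial_weight \<beta>')) \<Phi>)"
    if n: "n \<in> {1..N}" for n
  proof -
    note ag = same_space_besov[OF b(1), where 'd = 'd] same_space_besov[OF b(2), where 'd = 'd]
    note pos = equiv_weights_pos(1)[OF equiv_weights_besov_coeff[OF b(1)]] equiv_weights_pos(1)[OF equiv_weights_besov_coeff[OF b(2)]]
    \<comment> \<open>For \<open>n \<le> N\<close> the indices \<open>2 * real n - \<beta>\<close>
      and \<open>2 * real n - \<beta>'\<close> are at most 2 s and 2 t, so every kernel exponent
      along the chain is positive.\<close>
    have "real n \<le> real N" using n by simp
    then have lt: "2 * real n - \<beta> < real CARD('d) + 1" "2 * real n - \<beta>' < real CARD('d) + 1"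
      using assms t by (simp_all add: \<beta>_def \<beta>'_def)
    have "n \<ge> 1" using n by simp
    from besov_mult_bound_step[OF b this lt] obtain c where c: "c > 0"
      "\<And>\<Phi> C. mult_bound (besov n (radial_weight \<beta>)) (besov n (radial_weight \<beta>')) \<Phi> C \<Longrightarrow>
        mult_bound (besov (n - 1) (radial_weight \<beta>)) (besov (n - 1) (radial_weight \<beta>') :: 'd fn_space) \<Phi> (c * C)"
      by blast
    have mb: "mult_bound (besov (n - 1) (radial_weight \<beta>)) (besov (n - 1) (radial_weight \<beta>') :: 'd fn_space) \<Phi>
        (c * Mult_norm (besov n (radial_weight \<beta>)) (besov n (radial_weight \<beta>')) \<Phi>)"
      if "\<Phi> \<in> Mult (besov n (radial_weight \<beta>)) (besov n (radial_weight \<beta>'))" for \<Phi>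
      by (rule c(2)[OF mult_bound_Mult_norm[OF ag(1) pos(1) ag(2) pos(2) that]])
    show ?thesis
    proof (intro conjI subsetI exI[of _ c] ballI c(1))
      fix \<Phi> assume \<Phi>: "\<Phi> \<in> Mult (besov n (radial_weight \<beta>)) (besov n (radial_weight \<beta>') :: 'd fn_space)"
      show "Mult_norm (besov (n - 1) (radial_weight \<beta>)) (besov (n - 1) (radial_weight \<beta>')) \<Phi>
          \<le> c * Mult_norm (besov n (radial_weight \<beta>)) (besov n (radial_weight \<beta>')) \<Phi>"
        by (rule Mult_norm_le[OF ag(1) mb[OF \<Phi>]])
      \<comment> \<open>The pointwise square-summability is inherited from the membership of \<Phi>
        at level \<open>n\<close>.\<close>
      show "\<Phi> \<in> Mult (besov (n - 1) (radial_weight \<beta>)) (besov (n - 1) (radial_weight \<beta>'))"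
        by (rule Mult_mult_bound[OF mb[OF \<Phi>]]) (use \<Phi> in \<open>simp add: Mult_def\<close>)
    qed
  qed
  show ?thesis unfolding multiplier_inclusion_condition_def
  proof (rule conjI[OF weighted_besov_space_B1[OF N(1) assms(2)] conjI[OF weighted_besov_space_B1[OF N(2) t]]],
      rule exI[of _ "radial_weight \<beta>"], rule exI[of _ "radial_weight \<beta>'"], rule exI[of _ N], intro conjI ballI)
    show "1 \<le> N" by (rule N(3))
    show "admissible_weight (radial_weight \<beta> :: complex ^ 'd \<Rightarrow> real)" "admissible_weight (radial_weight \<beta>' :: complex ^ 'd \<Rightarrow> real)"
      by (rule admissible_radial_weight[OF b(1)], rule admissible_radial_weight[OF b(2)])
    show "equal_equiv_norms (B1 s :: 'd fn_space) (besov N (radial_weight \<beta>))"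
      "equal_equiv_norms (B1 t :: 'd fn_space) (besov N (radial_weight \<beta>'))"
      unfolding \<beta>_def \<beta>'_def by (rule equal_equiv_norms_B1_besov[OF N(1)], rule equal_equiv_norms_B1_besov[OF N(2)])
  qed (use step in simp_all)
qed

end
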